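(* For a semi-abelian category $\mathcal{C}$, the following conditions are equivalent: (i) $\mathcal{C}$ satisfies (NH); (ii) for all $K, L\leq X\leq Y$ in $\mathcal{C}$, if $K\lhd Y$ and $L\lhd Y$, then $[K,L]_X=[K,L]_Y$; (iii) for all $K, L\leq X\lhd Y$ in $\mathcal{C}$, if $K\lhd Y$ and $L\lhd Y$, then $[K,L]_X=[K,L]_Y$; (iv) for all $K, L\leq X$ in $\mathcal{C}$ with $X$ a protosplit normal subobject of $Y$, if $K\lhd Y$ and $L\lhd Y$, then $[K,L]_X=[K,L]_Y$; (v) for all $K, L\leq X\lhd Y$ in $\mathcal{C}$, if $K\lhd Y$, $L\lhd Y$ and $X=K\vee L$, then $[K,L]_X=[K,L]_Y$; (vi) for all $K, L\leq X$ in $\mathcal{C}$ with $X$ a protosplit normal subobject of $Y$, if $K\lhd Y$, $L\lhd Y$ and $X=K\vee L$, then $[K,L]_X=[K,L]_Y$; (vii) for every object $Z$ of $\mathcal{C}$, every object $(Y,f,s)$ of $\mathrm{Pt}_Z(\mathcal{C})$ with kernel $x\colon X\to Y$ of $f$, and every pair of normal monomorphisms $k'\colon K'\to Y$ and $l'\colon L'\to Y$ in $\mathrm{Pt}_Z(\mathcal{C})$ with restrictions to kernels $k=\mathrm{Ker}(k')\colon K\to X$ and $l=\mathrm{Ker}(l')\colon L\to X$, there exists a normal subobject $N\lhd Y$ in $\mathrm{Pt}_Z(\mathcal{C})$ such that $\mathrm{Ker}(N\lhd Y)=\big([K,L]_X\lhd X\big)$; (viii) for all data as in (vii) (an object $Z$,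 an object $(Y,f,s)$ of $\mathrm{Pt}_Z(\mathcal{C})$ with kernel $x\colon X\to Y$ of $f$, and normal monomorphisms $k'\colon K'\to Y$, $l'\colon L'\to Y$ in $\mathrm{Pt}_Z(\mathcal{C})$ with restrictions to kernels $k\colon K\to X$ and $l\colon L\to X$) such that moreover $X=K\vee L$, there exists a normal subobject $N\lhd Y$ in $\mathrm{Pt}_Z(\mathcal{C})$ such that $\mathrm{Ker}(N\lhd Y)=\big([K,L]_X\lhd X\big)$.
   Context: A semi-abelian category is a pointed, Barr-exact, Bourn-protomodular category with binary coproducts. $K\leq X$ means that $K$ is a subobject of $X$; $K\lhd X$ means that $K$ is a normal subobject, i.e. represented by a kernel; $K\vee L$ is the join of subobjects. A protosplit normal subobject $X$ of $Y$ is a subobject whose representing monomorphisms are kernels of split epimorphisms. When $K\leq X\leq Y$, $K$ is regarded as a subobject of $Y$ by composition. Two morphisms $f\colon A\to C$, $g\colon B\to C$ commute if there is a (necessarily unique) $\varphi\colon A\times B\to C$ with $\varphi\circ\langle 1_A,0\rangle=f$ and $\varphi\circ\langle 0,1_B\rangle=g$. For subobjects $k\colon K\to X$, $l\colon L\to X$, the Huq commutator $[K,L]_X\lhd X$ is the smallest normal subobject of $X$ such that the images of $k$ and $l$ in the quotient $X/[K,L]_X$ commute. The Higgins commutator $[K,L]\leq X$ is the regular image of the composite $K\diamond L\to K+L\to X$, where $K\diamond L\to K+L$ is the kernel of the canonical morphism $K+L\to K\times L$ (which is $\langle 1_K,0\rangle$ on $K$ and $\langle 0,1_L\rangle$ on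 $L$) and $K+L\to X$ is induced by $k$ and $l$. A semi-abelian category satisfies (NH) when for each pair of normal subobjects $K,L\lhd X$ of an object $X$, the Higgins commutator $[K,L]\leq X$ is normal in $X$. $\mathrm{Pt}_Z(\mathcal{C})$ is the category of points over $Z$: objects are triples $(Y,f\colon Y\to Z,s\colon Z\to Y)$ with $f\circ s=1_Z$, and morphisms are morphisms of $\mathcal{C}$ between the domains $Y$ commuting with the split epimorphisms and with the sections. It is again a semi-abelian category. The kernel functor $\mathrm{Ker}\colon\mathrm{Pt}_Z(\mathcal{C})\to\mathcal{C}$ sends $(Y,f,s)$ to the kernel object of $f$ and a morphism to its restriction to kernels. *)

theory Defs
  imports Main
begin

section \<open>Categories\<close>

record ('o, 'm) category =
  Ob :: "'o set"
  Arr :: "'m set"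
  Dom :: "'m \<Rightarrow> 'o"
  Cod :: "'m \<Rightarrow> 'o"
  Ident :: "'o \<Rightarrow> 'm"
  Comp :: "'m \<Rightarrow> 'm \<Rightarrow> 'm" (infixr "\<cdot>\<index>" 70)

definition hom :: "('o, 'm) category \<Rightarrow> 'o \<Rightarrow> 'o \<Rightarrow> 'm set" where
  "hom C a b = {f \<in> Arr C. Dom C f = a \<and> Cod C f = b}"

definition is_category :: "('o, 'm) category \<Rightarrow> bool" where
  "is_category C \<longleftrightarrow>
     (\<forall>f\<in>Arr C. Dom C f \<in> Ob C \<and> Cod C f \<in> Ob C) \<and>
     (\<forall>a\<in>Ob C. Ident C a \<in> hom C a a) \<and>
     (\<forall>f\<in>Arr C. \<forall>g\<in>Arr C. Cod C f = Dom C g \<longrightarrow> g \<cdot>\<^bsub>C\<^esub> f \<in> hom C (Dom C f) (Cod C g)) \<and>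
     (\<forall>f\<in>Arr C. f \<cdot>\<^bsub>C\<^esub> Ident C (Dom C f) = f \<and> Ident C (Cod C f) \<cdot>\<^bsub>C\<^esub> f = f) \<and>
     (\<forall>f\<in>Arr C. \<forall>g\<in>Arr C. \<forall>h\<in>Arr C. Cod C f = Dom C g \<longrightarrow> Cod C g = Dom C h \<longrightarrow>
        h \<cdot>\<^bsub>C\<^esub> (g \<cdot>\<^bsub>C\<^esub> f) = (h \<cdot>\<^bsub>C\<^esub> g) \<cdot>\<^bsub>C\<^esub> f)"

definition is_mono :: "('o, 'm) category \<Rightarrow> 'm \<Rightarrow> bool" where
  "is_mono C m \<longleftrightarrow> m \<in> Arr C \<and>
     (\<forall>a. \<forall>u\<in>hom C a (Dom C m). \<forall>v\<in>hom C a (Dom C m). m \<cdot>\<^bsub>C\<^esub> u = m \<cdot>\<^bsub>C\<^esub> v \<longrightarrow> u = v)"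

definition is_iso :: "('o, 'm) category \<Rightarrow> 'm \<Rightarrow> bool" where
  "is_iso C f \<longleftrightarrow> f \<in> Arr C \<and>
     (\<exists>g\<in>hom C (Cod C f) (Dom C f).
        g \<cdot>\<^bsub>C\<^esub> f = Ident C (Dom C f) \<and> f \<cdot>\<^bsub>C\<^esub> g = Ident C (Cod C f))"


section \<open>Limits and colimits\<close>

text \<open>Objects that carry a (co)limit are not named separately: they are the domains
  (codomains) of its projections (injections).\<close>

definition is_terminal :: "('o, 'm) category \<Rightarrow> 'o \<Rightarrow> bool" where
  "is_terminal C t \<longleftrightarrow> t \<in> Ob C \<and> (\<forall>a\<in>Ob C. \<exists>!f. f \<in> hom C a t)"

definition is_initial :: "('o, 'm) category \<Rightarrow> 'o \<Rightarrow> bool" where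
  "is_initial C i \<longleftrightarrow> i \<in> Ob C \<and> (\<forall>a\<in>Ob C. \<exists>!f. f \<in> hom C i a)"

definition is_product :: "('o, 'm) category \<Rightarrow> 'o \<Rightarrow> 'o \<Rightarrow> 'm \<Rightarrow> 'm \<Rightarrow> bool" where
  "is_product C a b p q \<longleftrightarrow>
     p \<in> hom C (Dom C p) a \<and> q \<in> hom C (Dom C p) b \<and>
     (\<forall>c. \<forall>f\<in>hom C c a. \<forall>g\<in>hom C c b.
        \<exists>!h. h \<in> hom C c (Dom C p) \<and> p \<cdot>\<^bsub>C\<^esub> h = f \<and> q \<cdot>\<^bsub>C\<^esub> h = g)"

definition is_coproduct :: "('o, 'm) category \<Rightarrow> 'o \<Rightarrow> 'o \<Rightarrow> 'm \<Rightarrow> 'm \<Rightarrow> bool" where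
  "is_coproduct C a b i j \<longleftrightarrow>
     i \<in> hom C a (Cod C i) \<and> j \<in> hom C b (Cod C i) \<and>
     (\<forall>c. \<forall>f\<in>hom C a c. \<forall>g\<in>hom C b c.
        \<exists>!h. h \<in> hom C (Cod C i) c \<and> h \<cdot>\<^bsub>C\<^esub> i = f \<and> h \<cdot>\<^bsub>C\<^esub> j = g)"

definition is_equalizer :: "('o, 'm) category \<Rightarrow> 'm \<Rightarrow> 'm \<Rightarrow> 'm \<Rightarrow> bool" where
  "is_equalizer C u v e \<longleftrightarrow>
     u \<in> Arr C \<and> v \<in> hom C (Dom C u) (Cod C u) \<and>
     e \<in> hom C (Dom C e) (Dom C u) \<and> u \<cdot>\<^bsub>C\<^esub> e = v \<cdot>\<^bsub>C\<^esub> e \<and>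
     (\<forall>c. \<forall>f\<in>hom C c (Dom C u). u \<cdot>\<^bsub>C\<^esub> f = v \<cdot>\<^bsub>C\<^esub> f \<longrightarrow>
        (\<exists>!h. h \<in> hom C c (Dom C e) \<and> e \<cdot>\<^bsub>C\<^esub> h = f))"

definition is_coequalizer :: "('o, 'm) category \<Rightarrow> 'm \<Rightarrow> 'm \<Rightarrow> 'm \<Rightarrow> bool" where
  "is_coequalizer C u v e \<longleftrightarrow>
     u \<in> Arr C \<and> v \<in> hom C (Dom C u) (Cod C u) \<and>
     e \<in> hom C (Cod C u) (Cod C e) \<and> e \<cdot>\<^bsub>C\<^esub> u = e \<cdot>\<^bsub>C\<^esub> v \<and>
     (\<forall>c. \<forall>f\<in>hom C (Cod C u) c. f \<cdot>\<^bsub>C\<^esub> u = f \<cdot>\<^bsub>C\<^esub> v \<longrightarrow>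
        (\<exists>!h. h \<in> hom C (Cod C e) c \<and> h \<cdot>\<^bsub>C\<^esub> e = f))"

definition is_pullback :: "('o, 'm) category \<Rightarrow> 'm \<Rightarrow> 'm \<Rightarrow> 'm \<Rightarrow> 'm \<Rightarrow> bool" where
  "is_pullback C f g p q \<longleftrightarrow>
     f \<in> Arr C \<and> g \<in> hom C (Dom C g) (Cod C f) \<and>
     p \<in> hom C (Dom C p) (Dom C f) \<and> q \<in> hom C (Dom C p) (Dom C g) \<and>
     f \<cdot>\<^bsub>C\<^esub> p = g \<cdot>\<^bsub>C\<^esub> q \<and>
     (\<forall>c. \<forall>u\<in>hom C c (Dom C f). \<forall>v\<in>hom C c (Dom C g). f \<cdot>\<^bsub>C\<^esub> u = g \<cdot>\<^bsub>C\<^esub> v \<longrightarrow>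
        (\<exists>!h. h \<in> hom C c (Dom C p) \<and> p \<cdot>\<^bsub>C\<^esub> h = u \<and> q \<cdot>\<^bsub>C\<^esub> h = v))"

definition finitely_complete :: "('o, 'm) category \<Rightarrow> bool" where
  "finitely_complete C \<longleftrightarrow>
     (\<exists>t. is_terminal C t) \<and>
     (\<forall>a\<in>Ob C. \<forall>b\<in>Ob C. \<exists>p q. is_product C a b p q) \<and>
     (\<forall>u\<in>Arr C. \<forall>v\<in>hom C (Dom C u) (Cod C u). \<exists>e. is_equalizer C u v e)"

definition has_binary_coproducts :: "('o, 'm) category \<Rightarrow> bool" where
  "has_binary_coproducts C \<longleftrightarrow> (\<forall>a\<in>Ob C. \<forall>b\<in>Ob C. \<exists>i j. is_coproduct C a b i j)"


section \<open>Pointed categories\<close>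

definition is_zero_object :: "('o, 'm) category \<Rightarrow> 'o \<Rightarrow> bool" where
  "is_zero_object C z \<longleftrightarrow> is_initial C z \<and> is_terminal C z"

definition pointed :: "('o, 'm) category \<Rightarrow> bool" where
  "pointed C \<longleftrightarrow> (\<exists>z. is_zero_object C z)"

definition is_zero_arrow :: "('o, 'm) category \<Rightarrow> 'm \<Rightarrow> bool" where
  "is_zero_arrow C f \<longleftrightarrow> f \<in> Arr C \<and>
     (\<exists>z. is_zero_object C z \<and>
        (\<exists>u\<in>hom C (Dom C f) z. \<exists>v\<in>hom C z (Cod C f). f = v \<cdot>\<^bsub>C\<^esub> u))"

definition is_kernel :: "('o, 'm) category \<Rightarrow> 'm \<Rightarrow> 'm \<Rightarrow> bool" where
  "is_kernel C f k \<longleftrightarrow>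
     f \<in> Arr C \<and> k \<in> hom C (Dom C k) (Dom C f) \<and> is_zero_arrow C (f \<cdot>\<^bsub>C\<^esub> k) \<and>
     (\<forall>c. \<forall>g\<in>hom C c (Dom C f). is_zero_arrow C (f \<cdot>\<^bsub>C\<^esub> g) \<longrightarrow>
        (\<exists>!h. h \<in> hom C c (Dom C k) \<and> k \<cdot>\<^bsub>C\<^esub> h = g))"

definition is_cokernel :: "('o, 'm) category \<Rightarrow> 'm \<Rightarrow> 'm \<Rightarrow> bool" where
  "is_cokernel C f q \<longleftrightarrow>
     f \<in> Arr C \<and> q \<in> hom C (Cod C f) (Cod C q) \<and> is_zero_arrow C (q \<cdot>\<^bsub>C\<^esub> f) \<and>
     (\<forall>c. \<forall>g\<in>hom C (Cod C f) c. is_zero_arrow C (g \<cdot>\<^bsub>C\<^esub> f) \<longrightarrow>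
        (\<exists>!h. h \<in> hom C (Cod C q) c \<and> h \<cdot>\<^bsub>C\<^esub> q = g))"


section \<open>Semi-abelian categories\<close>

definition regular_epi :: "('o, 'm) category \<Rightarrow> 'm \<Rightarrow> bool" where
  "regular_epi C e \<longleftrightarrow> (\<exists>u v. is_coequalizer C u v e)"

definition regular_category :: "('o, 'm) category \<Rightarrow> bool" where
  "regular_category C \<longleftrightarrow>
     finitely_complete C \<and>
     (\<forall>f p q. is_pullback C f f p q \<longrightarrow> (\<exists>e. is_coequalizer C p q e)) \<and>
     (\<forall>e g p q. regular_epi C e \<and> is_pullback C e g p q \<longrightarrow> regular_epi C q)"

text \<open>Internal equivalence relations, given by their two projections.\<close>

definition equivalence_relation :: "('o, 'm) category \<Rightarrow> 'm \<Rightarrow> 'm \<Rightarrow> bool" where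
  "equivalence_relation C d e \<longleftrightarrow>
     d \<in> Arr C \<and> e \<in> hom C (Dom C d) (Cod C d) \<and>
     (\<forall>a. \<forall>u\<in>hom C a (Dom C d). \<forall>v\<in>hom C a (Dom C d).
        d \<cdot>\<^bsub>C\<^esub> u = d \<cdot>\<^bsub>C\<^esub> v \<and> e \<cdot>\<^bsub>C\<^esub> u = e \<cdot>\<^bsub>C\<^esub> v \<longrightarrow> u = v) \<and>
     (\<exists>r\<in>hom C (Cod C d) (Dom C d).
        d \<cdot>\<^bsub>C\<^esub> r = Ident C (Cod C d) \<and> e \<cdot>\<^bsub>C\<^esub> r = Ident C (Cod C d)) \<and>
     (\<exists>s\<in>hom C (Dom C d) (Dom C d). d \<cdot>\<^bsub>C\<^esub> s = e \<and> e \<cdot>\<^bsub>C\<^esub> s = d) \<and>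
     (\<forall>p q. is_pullback C e d p q \<longrightarrow>
        (\<exists>t\<in>hom C (Dom C p) (Dom C d). d \<cdot>\<^bsub>C\<^esub> t = d \<cdot>\<^bsub>C\<^esub> p \<and> e \<cdot>\<^bsub>C\<^esub> t = e \<cdot>\<^bsub>C\<^esub> q))"

definition barr_exact :: "('o, 'm) category \<Rightarrow> bool" where
  "barr_exact C \<longleftrightarrow>
     regular_category C \<and>
     (\<forall>d e. equivalence_relation C d e \<longrightarrow> (\<exists>f. is_pullback C f f d e))"

definition Pt :: "('o, 'm) category \<Rightarrow> 'o \<Rightarrow>
    ('o \<times> 'm \<times> 'm, ('o \<times> 'm \<times> 'm) \<times> 'm \<times> ('o \<times> 'm \<times> 'm)) category" where
  "Pt C Z = (let P = {(Y, f, s). Y \<in> Ob C \<and> f \<in> hom C Y Z \<and> s \<in> hom C Z Y \<and>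
                                  f \<cdot>\<^bsub>C\<^esub> s = Ident C Z} in
     \<lparr> Ob = P,
       Arr = {((Y, f, s), m, (Y', f', s')) | Y f s m Y' f' s'.
                (Y, f, s) \<in> P \<and> (Y', f', s') \<in> P \<and> m \<in> hom C Y Y' \<and>
                f' \<cdot>\<^bsub>C\<^esub> m = f \<and> m \<cdot>\<^bsub>C\<^esub> s = s'},
       Dom = (\<lambda>(A, m, B). A),
       Cod = (\<lambda>(A, m, B). B),
       Ident = (\<lambda>A. (A, Ident C (fst A), A)),
       Comp = (\<lambda>(_, n, D) (A, m, _). (A, n \<cdot>\<^bsub>C\<^esub> m, D)) \<rparr>)"

text \<open>Protomodularity says that the change-of-base functor
  \<open>v\<^sup>* : Pt C (Cod C v) \<rightarrow> Pt C (Dom C v)\<close> reflects isomorphisms for every arrow \<open>v\<close>.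
  Below, \<open>(p, p')\<close> and \<open>(q, q')\<close> are pullbacks of the two points along \<open>v\<close>, and \<open>h'\<close> is
  the arrow \<open>v\<^sup>* h\<close> induced between them.\<close>

definition protomodular :: "('o, 'm) category \<Rightarrow> bool" where
  "protomodular C \<longleftrightarrow>
     (\<forall>v\<in>Arr C. \<forall>A f s h B g t p p' q q' h'.
        ((A, f, s), h, (B, g, t)) \<in> Arr (Pt C (Cod C v)) \<and>
        is_pullback C v f p p' \<and> is_pullback C v g q q' \<and>
        h' \<in> hom C (Dom C p) (Dom C q) \<and>
        q \<cdot>\<^bsub>C\<^esub> h' = p \<and> q' \<cdot>\<^bsub>C\<^esub> h' = h \<cdot>\<^bsub>C\<^esub> p' \<and>
        is_iso C h' \<longrightarrow> is_iso C h)"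

definition semi_abelian :: "('o, 'm) category \<Rightarrow> bool" where
  "semi_abelian C \<longleftrightarrow>
     is_category C \<and> pointed C \<and> barr_exact C \<and> protomodular C \<and> has_binary_coproducts C"


section \<open>Subobjects\<close>

text \<open>A subobject of \<open>X\<close> is handled through a representing monomorphism; equality of
  subobjects is then \<open>same_sub\<close>, not equality of arrows.\<close>

definition Sub :: "('o, 'm) category \<Rightarrow> 'o \<Rightarrow> 'm set" where
  "Sub C X = {m. is_mono C m \<and> Cod C m = X}"

definition sub_le :: "('o, 'm) category \<Rightarrow> 'm \<Rightarrow> 'm \<Rightarrow> bool" where
  "sub_le C m n \<longleftrightarrow> (\<exists>h\<in>hom C (Dom C m) (Dom C n). n \<cdot>\<^bsub>C\<^esub> h = m)"

definition same_sub :: "('o, 'm) category \<Rightarrow> 'm \<Rightarrow> 'm \<Rightarrow> bool" where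
  "same_sub C m n \<longleftrightarrow> is_mono C m \<and> is_mono C n \<and> sub_le C m n \<and> sub_le C n m"

definition normal_mono :: "('o, 'm) category \<Rightarrow> 'm \<Rightarrow> bool" where
  "normal_mono C m \<longleftrightarrow> (\<exists>f. is_kernel C f m)"

definition NSub :: "('o, 'm) category \<Rightarrow> 'o \<Rightarrow> 'm set" where
  "NSub C X = {m. normal_mono C m \<and> Cod C m = X}"

definition protosplit_NSub :: "('o, 'm) category \<Rightarrow> 'o \<Rightarrow> 'm set" where
  "protosplit_NSub C Y = {x. Cod C x = Y \<and>
     (\<exists>f. is_kernel C f x \<and> (\<exists>s\<in>hom C (Cod C f) (Dom C f). f \<cdot>\<^bsub>C\<^esub> s = Ident C (Cod C f)))}"

definition is_join :: "('o, 'm) category \<Rightarrow> 'm \<Rightarrow> 'm \<Rightarrow> 'm \<Rightarrow> bool" where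
  "is_join C k l j \<longleftrightarrow>
     j \<in> Sub C (Cod C k) \<and> sub_le C k j \<and> sub_le C l j \<and>
     (\<forall>n\<in>Sub C (Cod C k). sub_le C k n \<and> sub_le C l n \<longrightarrow> sub_le C j n)"

definition is_regular_image :: "('o, 'm) category \<Rightarrow> 'm \<Rightarrow> 'm \<Rightarrow> bool" where
  "is_regular_image C f m \<longleftrightarrow>
     is_mono C m \<and>
     (\<exists>e\<in>hom C (Dom C f) (Dom C m). regular_epi C e \<and> m \<cdot>\<^bsub>C\<^esub> e = f)"


section \<open>Commutators\<close>

text \<open>\<open>a\<close> and \<open>b\<close> are the arrows \<open>\<langle>1,0\<rangle>\<close> and \<open>\<langle>0,1\<rangle>\<close> into the product with
  projections \<open>p\<close>, \<open>q\<close>.\<close>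

definition is_product_insertions ::
    "('o, 'm) category \<Rightarrow> 'o \<Rightarrow> 'o \<Rightarrow> 'm \<Rightarrow> 'm \<Rightarrow> 'm \<Rightarrow> 'm \<Rightarrow> bool" where
  "is_product_insertions C A B p q a b \<longleftrightarrow>
     is_product C A B p q \<and> a \<in> hom C A (Dom C p) \<and> b \<in> hom C B (Dom C p) \<and>
     p \<cdot>\<^bsub>C\<^esub> a = Ident C A \<and> is_zero_arrow C (q \<cdot>\<^bsub>C\<^esub> a) \<and>
     is_zero_arrow C (p \<cdot>\<^bsub>C\<^esub> b) \<and> q \<cdot>\<^bsub>C\<^esub> b = Ident C B"

definition arrows_commute :: "('o, 'm) category \<Rightarrow> 'm \<Rightarrow> 'm \<Rightarrow> bool" where
  "arrows_commute C f g \<longleftrightarrow>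
     f \<in> Arr C \<and> g \<in> hom C (Dom C g) (Cod C f) \<and>
     (\<exists>p q a b. is_product_insertions C (Dom C f) (Dom C g) p q a b \<and>
        (\<exists>\<phi>\<in>hom C (Dom C p) (Cod C f). \<phi> \<cdot>\<^bsub>C\<^esub> a = f \<and> \<phi> \<cdot>\<^bsub>C\<^esub> b = g))"

definition commute_modulo :: "('o, 'm) category \<Rightarrow> 'm \<Rightarrow> 'm \<Rightarrow> 'm \<Rightarrow> bool" where
  "commute_modulo C k l n \<longleftrightarrow>
     (\<exists>q. is_cokernel C n q \<and> arrows_commute C (q \<cdot>\<^bsub>C\<^esub> k) (q \<cdot>\<^bsub>C\<^esub> l))"

definition is_huq_commutator :: "('o, 'm) category \<Rightarrow> 'm \<Rightarrow> 'm \<Rightarrow> 'm \<Rightarrow> bool" where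
  "is_huq_commutator C k l h \<longleftrightarrow>
     h \<in> NSub C (Cod C k) \<and> commute_modulo C k l h \<and>
     (\<forall>n\<in>NSub C (Cod C k). commute_modulo C k l n \<longrightarrow> sub_le C h n)"

text \<open>\<open>\<kappa>\<close> represents \<open>K \<diamond> L \<rightarrow> K + L\<close>, the kernel of the canonical \<open>\<sigma> : K + L \<rightarrow> K \<times> L\<close>,
  and \<open>w : K + L \<rightarrow> X\<close> is induced by \<open>k\<close> and \<open>l\<close>.\<close>

definition is_higgins_commutator :: "('o, 'm) category \<Rightarrow> 'm \<Rightarrow> 'm \<Rightarrow> 'm \<Rightarrow> bool" where
  "is_higgins_commutator C k l m \<longleftrightarrow>
     (\<exists>i j p q a b \<sigma> \<kappa> w.
        is_coproduct C (Dom C k) (Dom C l) i j \<and>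
        is_product_insertions C (Dom C k) (Dom C l) p q a b \<and>
        \<sigma> \<in> hom C (Cod C i) (Dom C p) \<and> \<sigma> \<cdot>\<^bsub>C\<^esub> i = a \<and> \<sigma> \<cdot>\<^bsub>C\<^esub> j = b \<and>
        is_kernel C \<sigma> \<kappa> \<and>
        w \<in> hom C (Cod C i) (Cod C k) \<and> w \<cdot>\<^bsub>C\<^esub> i = k \<and> w \<cdot>\<^bsub>C\<^esub> j = l \<and>
        is_regular_image C (w \<cdot>\<^bsub>C\<^esub> \<kappa>) m)"

text \<open>Both commutators are determined as subobjects of \<open>X = Cod C k\<close>, and they exist in every
  semi-abelian category; the following pick an arbitrary representing monomorphism.\<close>

definition huq :: "('o, 'm) category \<Rightarrow> 'm \<Rightarrow> 'm \<Rightarrow> 'm" where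
  "huq C k l = (SOME h. is_huq_commutator C k l h)"

definition higgins :: "('o, 'm) category \<Rightarrow> 'm \<Rightarrow> 'm \<Rightarrow> 'm" where
  "higgins C k l = (SOME m. is_higgins_commutator C k l m)"

definition NH :: "('o, 'm) category \<Rightarrow> bool" where
  "NH C \<longleftrightarrow> (\<forall>X\<in>Ob C. \<forall>k\<in>NSub C X. \<forall>l\<in>NSub C X. higgins C k l \<in> NSub C X)"


section \<open>The kernel functor on points\<close>

text \<open>\<open>is_Ker C x m k\<close>: the arrow \<open>m\<close> of points has restriction \<open>k\<close> to kernels, where \<open>x\<close> is
  the kernel chosen for the codomain of \<open>m\<close> and the kernel \<open>\<kappa>\<close> for its domain is arbitrary
  (so \<open>k\<close> represents \<open>Ker m\<close> for any choice of the functor \<open>Ker\<close>).\<close>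

definition is_Ker :: "('o, 'm) category \<Rightarrow> 'm \<Rightarrow>
    ('o \<times> 'm \<times> 'm) \<times> 'm \<times> ('o \<times> 'm \<times> 'm) \<Rightarrow> 'm \<Rightarrow> bool" where
  "is_Ker C x m k \<longleftrightarrow>
     (case m of ((Y', f', s'), g, (Y, f, s)) \<Rightarrow>
        is_kernel C f x \<and>
        (\<exists>\<kappa>. is_kernel C f' \<kappa> \<and> k \<in> hom C (Dom C \<kappa>) (Dom C x) \<and> x \<cdot>\<^bsub>C\<^esub> k = g \<cdot>\<^bsub>C\<^esub> \<kappa>))"

definition all_equivalent :: "bool list \<Rightarrow> bool" where
  "all_equivalent ps \<longleftrightarrow> (\<forall>p\<in>set ps. \<forall>q\<in>set ps. p \<longleftrightarrow> q)"

end

theory Submission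
  imports Defs
begin

text \<open>All eight conditions are about one question: when is a commutator \<open>[K,L]\<close>, computed in a
  subobject \<open>X\<close> of \<open>Y\<close>, still normal in \<open>Y\<close>?

  \<^item> The canonical arrow \<open>K + L \<rightarrow> K \<times> L\<close> is a regular epimorphism, hence the cokernel of
  \<open>K \<diamond> L \<rightarrow> K + L\<close>. So \<open>K\<close> and \<open>L\<close> commute modulo a normal subobject exactly when it contains
  the Higgins commutator \<open>[K,L]\<close>, and \<open>[K,L]\<^sub>X\<close> is the normal closure of \<open>[K,L]\<close> in \<open>X\<close>
  (\<open>huq_iff\<close>). Since \<open>[K,L]\<close> does not depend on the ambient object (\<open>higgins_comp\<close>),
  \<open>[K,L]\<^sub>X = [K,L]\<^sub>Y\<close> holds if and only if \<open>[K,L]\<^sub>X\<close> is normal in \<open>Y\<close>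
  (\<open>huq_agrees_iff_normal\<close>). Under (NH) both Huq commutators are the Higgins commutator, which
  gives (ii); conditions (iii) to (vi) are special cases of it.

  \<^item> The functor \<open>Ker\<close> identifies the normal subobjects of a point \<open>(Y, f, s)\<close> with the
  subobjects of the kernel \<open>X\<close> of \<open>f\<close> that are normal in \<open>Y\<close> (\<open>kernel_of_normal_in_points\<close> and
  \<open>normal_in_points_exists\<close>). Therefore (iv) implies (vii), its special case (viii)
  follows, and (viii) implies (vi).

  \<^item> It remains to get from (vi) back to (NH) (\<open>protosplit_imp_higgins_normal\<close>). Let \<open>K\<close> and \<open>L\<close>
  be normal in \<open>X\<close>. Their join \<open>J\<close> is normal too (\<open>join_of_normal_exists\<close>), so it is the class
  of zero for an equivalence relation \<open>R\<close> on \<open>X\<close>, and \<open>J\<close> embeds in \<open>R\<close> by \<open>y \<mapsto> (0, y)\<close> as the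
  kernel of the first projection, which is split by the diagonal. The images of \<open>K\<close> and \<open>L\<close> in
  \<open>R\<close> are normal. As \<open>[K,L]\<close> is always normal in \<open>K \<or> L\<close> (\<open>higgins_normal_in_join\<close>), it equals
  \<open>[K,L]\<^sub>J\<close>, and (vi) makes it normal in \<open>R\<close>. The second projection \<open>R \<rightarrow> X\<close> is a regular
  epimorphism and maps this copy of \<open>[K,L]\<close> onto \<open>[K,L] \<le> X\<close>, which is normal because regular
  images of normal subobjects are normal (\<open>regular_image_normal\<close>).

  Everything is argued with generalized elements: \<open>t \<lesssim> m\<close> says that the element \<open>t\<close> lies in the
  subobject \<open>m\<close>. Protomodularity is used in the following form only: in a split extension, a
  subobject that contains the section and the kernel is everything
  (\<open>split_extension_generated\<close>). Barr-exactness enters because this makes every reflexive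
  relation an equivalence relation, hence a kernel pair (\<open>reflexive_relation_effective\<close>); from it
  come normal closures and the normality of regular images.\<close>

section \<open>Elementary category theory\<close>

locale cat =
  fixes C :: "('o, 'm) category" (structure)
  assumes category: "is_category C"
begin

abbreviation factors (infix "\<lesssim>" 50) where
  "t \<lesssim> m \<equiv> sub_le C t m"

lemma Dom_Ob: "f \<in> Arr C \<Longrightarrow> Dom C f \<in> Ob C"
  and Cod_Ob: "f \<in> Arr C \<Longrightarrow> Cod C f \<in> Ob C"
  using category by (auto simp: is_category_def)

lemma hom_iff:
  "f \<in> hom C a b \<longleftrightarrow> f \<in> Arr C \<and> Dom C f = a \<and> Cod C f = b \<and> a \<in> Ob C \<and> b \<in> Ob C"
  using Dom_Ob Cod_Ob by (auto simp: hom_def)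

lemma arr_hom: "f \<in> Arr C \<Longrightarrow> f \<in> hom C (Dom C f) (Cod C f)"
  by (simp add: hom_def)

lemma Ident_hom: "a \<in> Ob C \<Longrightarrow> Ident C a \<in> hom C a a"
  using category by (auto simp: is_category_def)

lemma Ident_simps:
  assumes "a \<in> Ob C"
  shows "Ident C a \<in> Arr C" "Dom C (Ident C a) = a" "Cod C (Ident C a) = a"
  using Ident_hom[OF assms] by (auto simp: hom_def)

lemma comp_hom: "f \<in> hom C a b \<Longrightarrow> g \<in> hom C b c \<Longrightarrow> g \<cdot> f \<in> hom C a c"
  using category by (auto simp: is_category_def hom_def)

lemma comp_simps:
  assumes "f \<in> Arr C" "g \<in> Arr C" "Cod C f = Dom C g"
  shows "g \<cdot> f \<in> Arr C" "Dom C (g \<cdot> f) = Dom C f" "Cod C (g \<cdot> f) = Cod C g"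
  using comp_hom[of f "Dom C f" "Dom C g" g "Cod C g"] assms by (auto simp: hom_def)

lemma comp_Ident: "f \<in> Arr C \<Longrightarrow> Dom C f = a \<Longrightarrow> f \<cdot> Ident C a = f"
  and Ident_comp: "f \<in> Arr C \<Longrightarrow> Cod C f = a \<Longrightarrow> Ident C a \<cdot> f = f"
  using category by (auto simp: is_category_def)

lemma comp_assoc:
  "f \<in> Arr C \<Longrightarrow> g \<in> Arr C \<Longrightarrow> h \<in> Arr C \<Longrightarrow> Cod C f = Dom C g \<Longrightarrow> Cod C g = Dom C h \<Longrightarrow>
    (h \<cdot> g) \<cdot> f = h \<cdot> (g \<cdot> f)"
  using category by (auto simp: is_category_def)

text \<open>Composites are kept bracketed to the right, so an equation between composites has to be
  available in this form to be applied in the middle of a longer composite.\<close>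

lemma comp_subst:
  "g \<cdot> f = r \<Longrightarrow> f \<in> Arr C \<Longrightarrow> g \<in> Arr C \<Longrightarrow> h \<in> Arr C \<Longrightarrow> Cod C f = Dom C g \<Longrightarrow> Cod C h = Dom C f \<Longrightarrow>
    g \<cdot> (f \<cdot> h) = r \<cdot> h"
  by (simp add: comp_assoc[symmetric])

lemmas cat_simps =
  hom_iff Dom_Ob Cod_Ob Ident_simps comp_simps comp_Ident Ident_comp comp_assoc

subsection \<open>Monomorphisms and factorization through them\<close>

lemma monoI:
  assumes "m \<in> hom C a b"
    and "\<And>T u v. u \<in> hom C T a \<Longrightarrow> v \<in> hom C T a \<Longrightarrow> m \<cdot> u = m \<cdot> v \<Longrightarrow> u = v"
  shows "is_mono C m"
  using assms unfolding is_mono_def by (simp add: cat_simps)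

lemma mono_arr: "is_mono C m \<Longrightarrow> m \<in> Arr C"
  by (simp add: is_mono_def)

lemma mono_cancel:
  "is_mono C m \<Longrightarrow> m \<cdot> u = m \<cdot> v \<Longrightarrow> u \<in> hom C T (Dom C m) \<Longrightarrow> v \<in> hom C T (Dom C m) \<Longrightarrow> u = v"
  by (auto simp: is_mono_def)

lemma mono_comp:
  assumes "is_mono C m" "is_mono C n" "Cod C n = Dom C m"
  shows "is_mono C (m \<cdot> n)"
proof (rule monoI)
  have ar: "m \<in> Arr C" "n \<in> Arr C" using assms mono_arr by auto
  show "m \<cdot> n \<in> hom C (Dom C n) (Cod C m)" using ar assms(3) by (simp add: cat_simps)
  fix T u v
  assume u: "u \<in> hom C T (Dom C n)" and v: "v \<in> hom C T (Dom C n)" and e: "(m \<cdot> n) \<cdot> u = (m \<cdot> n) \<cdot> v"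
  have "n \<cdot> u = n \<cdot> v"
    by (rule mono_cancel[OF assms(1), of _ _ T]) (use ar u v e assms(3) in \<open>simp_all add: cat_simps\<close>)
  then show "u = v" using mono_cancel[OF assms(2) _ u v] by blast
qed

lemma mono_right_factor:
  assumes "is_mono C (m \<cdot> n)" "n \<in> hom C a b" "m \<in> hom C b c"
  shows "is_mono C n"
proof (rule monoI[OF assms(2)])
  fix T u v
  assume u: "u \<in> hom C T a" and v: "v \<in> hom C T a" and e: "n \<cdot> u = n \<cdot> v"
  show "u = v"
    by (rule mono_cancel[OF assms(1), of _ _ T]) (use u v e assms in \<open>simp_all add: cat_simps\<close>)
qed

lemma mono_Ident: "a \<in> Ob C \<Longrightarrow> is_mono C (Ident C a)"
  by (rule monoI[OF Ident_hom]) (simp_all add: cat_simps)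

lemma split_mono:
  assumes "r \<cdot> m = Ident C a" "m \<in> hom C a b" "r \<in> hom C b a"
  shows "is_mono C m"
  using mono_right_factor[of r m] mono_Ident assms by (simp add: cat_simps)

lemma factorsI: "m \<cdot> h = t \<Longrightarrow> h \<in> hom C (Dom C t) (Dom C m) \<Longrightarrow> t \<lesssim> m"
  by (auto simp: sub_le_def)

lemma factorsE:
  assumes "t \<lesssim> m"
  obtains h where "h \<in> hom C (Dom C t) (Dom C m)" "m \<cdot> h = t"
  using assms by (auto simp: sub_le_def)

lemma factors_Cod:
  assumes "t \<lesssim> m" "m \<in> Arr C"
  shows "Cod C t = Cod C m"
proof -
  obtain h where "h \<in> hom C (Dom C t) (Dom C m)" "m \<cdot> h = t" using assms(1) by (rule factorsE)
  then show ?thesis using assms(2) comp_simps(3)[of h m] by (simp add: hom_iff)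
qed

lemma factors_refl: "m \<in> Arr C \<Longrightarrow> m \<lesssim> m"
  by (rule factorsI[of _ "Ident C (Dom C m)"]) (simp_all add: cat_simps)

lemma factors_trans:
  assumes "s \<lesssim> t" "t \<lesssim> m" "m \<in> Arr C"
  shows "s \<lesssim> m"
proof -
  obtain h where h: "h \<in> hom C (Dom C s) (Dom C t)" "t \<cdot> h = s" using assms(1) by (rule factorsE)
  obtain g where g: "g \<in> hom C (Dom C t) (Dom C m)" "m \<cdot> g = t" using assms(2) by (rule factorsE)
  show ?thesis
    by (rule factorsI[of _ "g \<cdot> h"]) (use h g g(2)[THEN comp_subst] assms(3) in \<open>simp_all add: cat_simps\<close>)
qed

lemma factors_comp_left: "h \<in> Arr C \<Longrightarrow> Cod C h = Dom C m \<Longrightarrow> m \<in> Arr C \<Longrightarrow> m \<cdot> h \<lesssim> m"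
  by (rule factorsI[of _ h]) (simp_all add: cat_simps)

lemma factors_comp:
  "t \<lesssim> m \<Longrightarrow> t \<in> Arr C \<Longrightarrow> m \<in> Arr C \<Longrightarrow> h \<in> Arr C \<Longrightarrow> Cod C h = Dom C t \<Longrightarrow> t \<cdot> h \<lesssim> m"
  by (rule factors_trans[OF factors_comp_left]) simp_all

lemma comp_factors_comp_iff:
  assumes "is_mono C x" "m \<in> hom C a (Dom C x)" "t \<in> hom C b (Dom C x)"
  shows "x \<cdot> t \<lesssim> x \<cdot> m \<longleftrightarrow> t \<lesssim> m"
proof
  have x: "x \<in> Arr C" using assms(1) by (rule mono_arr)
  assume "x \<cdot> t \<lesssim> x \<cdot> m"
  then obtain h where "h \<in> hom C (Dom C (x \<cdot> t)) (Dom C (x \<cdot> m))" "(x \<cdot> m) \<cdot> h = x \<cdot> t"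
    by (rule factorsE)
  then have h: "h \<in> hom C b a" "(x \<cdot> m) \<cdot> h = x \<cdot> t"
    using assms(2,3) x by (simp_all add: cat_simps)
  have "m \<cdot> h = t"
    by (rule mono_cancel[OF assms(1), of _ _ b]) (use h x assms(2,3) in \<open>simp_all add: cat_simps\<close>)
  then show "t \<lesssim> m" by (rule factorsI) (use h assms in \<open>simp add: cat_simps\<close>)
next
  have x: "x \<in> Arr C" using assms(1) by (rule mono_arr)
  assume "t \<lesssim> m"
  then obtain h where h: "h \<in> hom C (Dom C t) (Dom C m)" "m \<cdot> h = t" by (rule factorsE)
  show "x \<cdot> t \<lesssim> x \<cdot> m"
    by (rule factorsI[of _ h]) (use h x assms(2,3) in \<open>simp_all add: cat_simps\<close>)
qed

lemma SubD: "m \<in> Sub C X \<Longrightarrow> is_mono C m \<and> m \<in> Arr C \<and> Cod C m = X \<and> X \<in> Ob C"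
  using mono_arr Cod_Ob by (auto simp: Sub_def)

text \<open>If the identity factors through \<open>m\<close>, then everything does; for a monomorphism \<open>m\<close> this
  says that \<open>m\<close> is an isomorphism, without naming an inverse.\<close>

lemma factors_of_Ident:
  assumes "Ident C X \<lesssim> m" "m \<in> Arr C" "t \<in> hom C T X"
  shows "t \<lesssim> m"
proof -
  have "Ident C X \<cdot> t \<lesssim> m"
    by (rule factors_comp) (use assms in \<open>simp_all add: cat_simps\<close>)
  then show ?thesis using assms by (simp add: cat_simps)
qed

lemma same_subD:
  "same_sub C m n \<Longrightarrow> is_mono C m \<and> is_mono C n \<and> m \<in> Arr C \<and> n \<in> Arr C \<and> m \<lesssim> n \<and> n \<lesssim> m \<and> Cod C m = Cod C n"
  by (simp add: same_sub_def mono_arr factors_Cod)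

lemma same_sub_sym: "same_sub C m n \<Longrightarrow> same_sub C n m"
  by (auto simp: same_sub_def)

lemma same_sub_comp:
  assumes "same_sub C m n" "is_mono C x" "Cod C m = Dom C x"
  shows "same_sub C (x \<cdot> m) (x \<cdot> n)"
proof -
  note D = same_subD[OF assms(1)]
  have x: "x \<in> Arr C" using assms(2) by (rule mono_arr)
  have "m \<in> hom C (Dom C m) (Dom C x)" "n \<in> hom C (Dom C n) (Dom C x)"
    using D x assms(3) by (simp_all add: cat_simps)
  then show ?thesis
    using D assms(2,3) by (simp add: same_sub_def mono_comp comp_factors_comp_iff)
qed


subsection \<open>Universal properties\<close>

lemma pullbackD:
  assumes "is_pullback C f g p q"
  shows "f \<in> Arr C" "g \<in> Arr C" "p \<in> Arr C" "q \<in> Arr C" "Cod C g = Cod C f" "Cod C p = Dom C f"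
    "Cod C q = Dom C g" "Dom C q = Dom C p" "f \<cdot> p = g \<cdot> q"
  using assms by (auto simp: is_pullback_def hom_def)

lemma pullback_lift:
  assumes "is_pullback C f g p q" "f \<cdot> u = g \<cdot> v" "u \<in> hom C T (Dom C f)" "v \<in> hom C T (Dom C g)"
  obtains h where "h \<in> hom C T (Dom C p)" "p \<cdot> h = u" "q \<cdot> h = v"
  using assms unfolding is_pullback_def by blast

definition jointly_monic where
  "jointly_monic d e \<longleftrightarrow>
    (\<forall>T u v. u \<in> hom C T (Dom C d) \<longrightarrow> v \<in> hom C T (Dom C d) \<longrightarrow> d \<cdot> u = d \<cdot> v \<longrightarrow> e \<cdot> u = e \<cdot> v \<longrightarrow> u = v)"

lemma jointly_monicD:
  "jointly_monic d e \<Longrightarrow> d \<cdot> u = d \<cdot> v \<Longrightarrow> e \<cdot> u = e \<cdot> v \<Longrightarrow>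
    u \<in> hom C T (Dom C d) \<Longrightarrow> v \<in> hom C T (Dom C d) \<Longrightarrow> u = v"
  by (auto simp: jointly_monic_def)

lemma pullback_jointly_monic:
  assumes "is_pullback C f g p q"
  shows "jointly_monic p q"
  unfolding jointly_monic_def
proof (intro allI impI)
  fix T u v
  assume uv: "u \<in> hom C T (Dom C p)" "v \<in> hom C T (Dom C p)" "p \<cdot> u = p \<cdot> v" "q \<cdot> u = q \<cdot> v"
  note D = pullbackD[OF assms]
  have "p \<cdot> u \<in> hom C T (Dom C f)" "q \<cdot> u \<in> hom C T (Dom C g)" "f \<cdot> (p \<cdot> u) = g \<cdot> (q \<cdot> u)"
    using uv(1) D D(9)[THEN comp_subst] by (simp_all add: cat_simps)
  then have "\<exists>!h. h \<in> hom C T (Dom C p) \<and> p \<cdot> h = p \<cdot> u \<and> q \<cdot> h = q \<cdot> u"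
    using assms unfolding is_pullback_def by blast
  then show "u = v" using uv by metis
qed

lemma is_pullbackI:
  assumes "f \<in> hom C a c" "g \<in> hom C b c" "p \<in> hom C P a" "q \<in> hom C P b" "f \<cdot> p = g \<cdot> q"
    "jointly_monic p q"
    and "\<And>T u v. u \<in> hom C T a \<Longrightarrow> v \<in> hom C T b \<Longrightarrow> f \<cdot> u = g \<cdot> v \<Longrightarrow> \<exists>h\<in>hom C T P. p \<cdot> h = u \<and> q \<cdot> h = v"
  shows "is_pullback C f g p q"
proof -
  have D: "Dom C f = a" "Dom C g = b" "Dom C p = P" "Cod C f = c" using assms by (auto simp: cat_simps)
  have "\<exists>!h. h \<in> hom C T P \<and> p \<cdot> h = u \<and> q \<cdot> h = v"
    if "u \<in> hom C T a" "v \<in> hom C T b" "f \<cdot> u = g \<cdot> v" for T u v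
    using assms(7)[OF that] jointly_monicD[OF assms(6), of _ _ T] D by metis
  then show ?thesis using assms D unfolding is_pullback_def by (auto simp: hom_def)
qed

lemma productD:
  assumes "is_product C a b p q"
  shows "p \<in> Arr C" "q \<in> Arr C" "Cod C p = a" "Cod C q = b" "Dom C q = Dom C p" "a \<in> Ob C" "b \<in> Ob C"
  using assms by (auto simp: is_product_def cat_simps)

lemma product_lift:
  assumes "is_product C a b p q" "u \<in> hom C T a" "v \<in> hom C T b"
  obtains h where "h \<in> hom C T (Dom C p)" "p \<cdot> h = u" "q \<cdot> h = v"
  using assms unfolding is_product_def by blast

lemma product_jointly_monic:
  assumes "is_product C a b p q"
  shows "jointly_monic p q"
  unfolding jointly_monic_def
proof (intro allI impI)
  fix T u v
  assume uv: "u \<in> hom C T (Dom C p)" "v \<in> hom C T (Dom C p)" "p \<cdot> u = p \<cdot> v" "q \<cdot> u = q \<cdot> v"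
  note D = productD[OF assms]
  have "p \<cdot> u \<in> hom C T a" "q \<cdot> u \<in> hom C T b"
    using uv(1) D by (simp_all add: cat_simps)
  then have "\<exists>!h. h \<in> hom C T (Dom C p) \<and> p \<cdot> h = p \<cdot> u \<and> q \<cdot> h = q \<cdot> u"
    using assms unfolding is_product_def by blast
  then show "u = v" using uv by metis
qed

lemma coproductD:
  assumes "is_coproduct C a b i j"
  shows "i \<in> Arr C" "j \<in> Arr C" "Dom C i = a" "Dom C j = b" "Cod C j = Cod C i" "a \<in> Ob C" "b \<in> Ob C"
  using assms by (auto simp: is_coproduct_def cat_simps)

lemma coproduct_desc:
  assumes "is_coproduct C a b i j" "u \<in> hom C a T" "v \<in> hom C b T"
  obtains h where "h \<in> hom C (Cod C i) T" "h \<cdot> i = u" "h \<cdot> j = v"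
  using assms unfolding is_coproduct_def by blast

lemma coproduct_jointly_epic:
  assumes "is_coproduct C a b i j" "u \<cdot> i = v \<cdot> i" "u \<cdot> j = v \<cdot> j"
    "u \<in> hom C (Cod C i) T" "v \<in> hom C (Cod C i) T"
  shows "u = v"
proof -
  note D = coproductD[OF assms(1)]
  have "u \<cdot> i \<in> hom C a T" "u \<cdot> j \<in> hom C b T"
    using assms(4) D by (simp_all add: cat_simps)
  then have "\<exists>!h. h \<in> hom C (Cod C i) T \<and> h \<cdot> i = u \<cdot> i \<and> h \<cdot> j = u \<cdot> j"
    using assms unfolding is_coproduct_def by blast
  then show "u = v" using assms by metis
qed

lemma coequalizerD:
  assumes "is_coequalizer C u v e"
  shows "u \<in> Arr C" "v \<in> Arr C" "e \<in> Arr C" "Dom C v = Dom C u" "Cod C v = Cod C u" "Dom C e = Cod C u"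
    "e \<cdot> u = e \<cdot> v"
  using assms by (auto simp: is_coequalizer_def hom_def)

lemma coequalizer_desc:
  assumes "is_coequalizer C u v e" "f \<cdot> u = f \<cdot> v" "f \<in> hom C (Cod C u) T"
  obtains h where "h \<in> hom C (Cod C e) T" "h \<cdot> e = f"
  using assms unfolding is_coequalizer_def by blast

lemma regular_epi_arr: "regular_epi C e \<Longrightarrow> e \<in> Arr C"
  using coequalizerD by (auto simp: regular_epi_def)

lemma regular_epi_cancel:
  assumes "regular_epi C e" "f \<cdot> e = g \<cdot> e" "f \<in> hom C (Cod C e) T" "g \<in> hom C (Cod C e) T"
  shows "f = g"
proof -
  obtain u v where ce: "is_coequalizer C u v e" using assms(1) by (auto simp: regular_epi_def)
  note D = coequalizerD[OF ce]
  have "f \<cdot> e \<in> hom C (Cod C u) T" "(f \<cdot> e) \<cdot> u = (f \<cdot> e) \<cdot> v"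
    using D assms(3) by (simp_all add: cat_simps)
  then have "\<exists>!h. h \<in> hom C (Cod C e) T \<and> h \<cdot> e = f \<cdot> e"
    using ce unfolding is_coequalizer_def by blast
  then show ?thesis using assms by metis
qed

text \<open>Factoring through a monomorphism can be tested after precomposition with a regular
  epimorphism. This is what makes it possible to argue with generalized elements that exist only
  after passing to a cover.\<close>

lemma regular_epi_factors_local:
  assumes e: "regular_epi C e" and m: "is_mono C m" and f: "f \<in> hom C (Cod C e) (Cod C m)"
    and fe: "f \<cdot> e \<lesssim> m"
  shows "f \<lesssim> m"
proof -
  obtain u v where ce: "is_coequalizer C u v e" using e by (auto simp: regular_epi_def)
  note D = coequalizerD[OF ce] mono_arr[OF m]
  obtain h where h: "h \<in> hom C (Dom C e) (Dom C m)" "m \<cdot> h = f \<cdot> e"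
    using fe f D by (auto simp: sub_le_def cat_simps)
  have "h \<cdot> u = h \<cdot> v"
    by (rule mono_cancel[OF m, of _ _ "Dom C u"]) (use h h(2)[THEN comp_subst] f D in \<open>simp_all add: cat_simps\<close>)
  then obtain g where g: "g \<in> hom C (Cod C e) (Dom C m)" "g \<cdot> e = h"
    using coequalizer_desc[OF ce, of h "Dom C m"] h D by (auto simp: cat_simps)
  have "m \<cdot> g = f"
    by (rule regular_epi_cancel[OF e, of _ _ "Cod C m"]) (use h g f D in \<open>simp_all add: cat_simps\<close>)
  then show ?thesis by (rule factorsI) (use g f in \<open>simp add: cat_simps\<close>)
qed

text \<open>Membership in \<open>m\<close> is tested on the cover \<open>e\<close> of the codomain.\<close>

lemma regular_epi_extremal:
  assumes e: "regular_epi C e" and m: "is_mono C m" and "Cod C m = Cod C e" and em: "e \<lesssim> m"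
  shows "Ident C (Cod C e) \<lesssim> m"
  by (rule regular_epi_factors_local[OF e m])
    (use assms regular_epi_arr[OF e] in \<open>simp_all add: cat_simps\<close>)

lemma split_epi_regular:
  assumes "e \<cdot> s = Ident C b" "e \<in> hom C a b" "s \<in> hom C b a"
  shows "regular_epi C e"
proof -
  have "\<exists>!h. h \<in> hom C b T \<and> h \<cdot> e = f" if f: "f \<in> hom C a T" "f \<cdot> Ident C a = f \<cdot> (s \<cdot> e)" for T f
  proof (rule ex1I[of _ "f \<cdot> s"])
    show "f \<cdot> s \<in> hom C b T \<and> (f \<cdot> s) \<cdot> e = f" using f assms by (simp add: cat_simps)
    fix h assume "h \<in> hom C b T \<and> h \<cdot> e = f"
    then show "h = f \<cdot> s" using assms by (auto simp: cat_simps)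
  qed
  then have "\<forall>T. \<forall>f\<in>hom C a T. f \<cdot> Ident C a = f \<cdot> (s \<cdot> e) \<longrightarrow> (\<exists>!h. h \<in> hom C b T \<and> h \<cdot> e = f)"
    by blast
  moreover have "e \<cdot> (s \<cdot> e) = e" using assms assms(1)[THEN comp_subst] by (simp add: cat_simps)
  ultimately have "is_coequalizer C (Ident C a) (s \<cdot> e) e"
    using assms unfolding is_coequalizer_def by (simp add: cat_simps)
  then show ?thesis by (auto simp: regular_epi_def)
qed

lemma regular_epi_Ident: "a \<in> Ob C \<Longrightarrow> regular_epi C (Ident C a)"
  by (rule split_epi_regular[of _ "Ident C a" a a]) (simp_all add: cat_simps)

end

section \<open>Subobjects defined by equations\<close>

locale lex_cat = cat +
  assumes finitely_complete: "finitely_complete C"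
begin

lemma product_exists:
  assumes "a \<in> Ob C" "b \<in> Ob C"
  obtains p q where "is_product C a b p q"
  using finitely_complete assms unfolding finitely_complete_def by blast

text \<open>The subobjects \<open>{t. u t = v t}\<close>, \<open>{t. g t \<in> m}\<close> and \<open>{t. (u t, v t) \<in> S}\<close>, described by
  their generalized elements.\<close>

lemma equalizer_subobject:
  assumes u: "u \<in> hom C a b" and v: "v \<in> hom C a b"
  obtains n where "n \<in> Sub C a" "\<And>T t. t \<in> hom C T a \<Longrightarrow> t \<lesssim> n \<longleftrightarrow> u \<cdot> t = v \<cdot> t"
proof -
  have "u \<in> Arr C" "v \<in> hom C (Dom C u) (Cod C u)" using u v by (simp_all add: cat_simps)
  then obtain n where n: "is_equalizer C u v n"
    using finitely_complete unfolding finitely_complete_def by blast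
  have "n \<in> hom C (Dom C n) (Dom C u)" "u \<cdot> n = v \<cdot> n"
    using n unfolding is_equalizer_def by blast+
  then have D: "n \<in> Arr C" "Cod C n = a" "u \<cdot> n = v \<cdot> n" "Dom C u = a"
    using u by (simp_all add: hom_iff)
  have lift: "\<exists>!h. h \<in> hom C T (Dom C n) \<and> n \<cdot> h = t" if "t \<in> hom C T a" "u \<cdot> t = v \<cdot> t" for T t
    using n that unfolding is_equalizer_def D(4) by blast
  have mono: "is_mono C n"
  proof (rule monoI)
    show "n \<in> hom C (Dom C n) a" using D by (auto simp: cat_simps)
    fix T s t assume st: "s \<in> hom C T (Dom C n)" "t \<in> hom C T (Dom C n)" "n \<cdot> s = n \<cdot> t"
    have "\<exists>!h. h \<in> hom C T (Dom C n) \<and> n \<cdot> h = n \<cdot> s"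
      by (rule lift) (use st u v D D(3)[THEN comp_subst] in \<open>simp_all add: cat_simps\<close>)
    then show "s = t" using st by metis
  qed
  have "t \<lesssim> n \<longleftrightarrow> u \<cdot> t = v \<cdot> t" if t: "t \<in> hom C T a" for T t
  proof
    assume "t \<lesssim> n"
    then obtain h where h: "h \<in> hom C (Dom C t) (Dom C n)" "n \<cdot> h = t" by (rule factorsE)
    have "u \<cdot> (n \<cdot> h) = v \<cdot> (n \<cdot> h)"
      using h(1) D u v D(3)[THEN comp_subst] by (simp add: cat_simps)
    then show "u \<cdot> t = v \<cdot> t" using h by simp
  next
    assume "u \<cdot> t = v \<cdot> t"
    then obtain h where "h \<in> hom C T (Dom C n)" "n \<cdot> h = t" using lift[OF t] by blast
    then show "t \<lesssim> n" using t by (intro factorsI[of n h]) (simp_all add: hom_iff)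
  qed
  then show thesis using that mono D by (simp add: Sub_def)
qed

lemma pullback_exists:
  assumes f: "f \<in> hom C a c" and g: "g \<in> hom C b c"
  obtains p q where "is_pullback C f g p q"
proof -
  obtain p q where pq: "is_product C a b p q"
    by (rule product_exists[of a b]) (use f g in \<open>simp_all add: cat_simps\<close>)
  note D = productD[OF pq]
  have "f \<cdot> p \<in> hom C (Dom C p) c" "g \<cdot> q \<in> hom C (Dom C p) c"
    using f g D by (simp_all add: cat_simps)
  then obtain n where n: "n \<in> Sub C (Dom C p)"
    "\<And>T t. t \<in> hom C T (Dom C p) \<Longrightarrow> t \<lesssim> n \<longleftrightarrow> (f \<cdot> p) \<cdot> t = (g \<cdot> q) \<cdot> t"
    by (rule equalizer_subobject) blast
  note N = SubD[OF n(1)]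
  have "n \<lesssim> n" using N by (simp add: factors_refl)
  then have eq: "f \<cdot> (p \<cdot> n) = g \<cdot> (q \<cdot> n)"
    using n(2)[of n "Dom C n"] f g D N by (simp add: cat_simps)
  have "is_pullback C f g (p \<cdot> n) (q \<cdot> n)"
  proof (rule is_pullbackI[OF f g _ _ eq])
    show "p \<cdot> n \<in> hom C (Dom C n) a" "q \<cdot> n \<in> hom C (Dom C n) b"
      using D N by (simp_all add: cat_simps)
    show "jointly_monic (p \<cdot> n) (q \<cdot> n)"
      unfolding jointly_monic_def
    proof (intro allI impI)
      fix T u v assume uv: "u \<in> hom C T (Dom C (p \<cdot> n))" "v \<in> hom C T (Dom C (p \<cdot> n))"
        "(p \<cdot> n) \<cdot> u = (p \<cdot> n) \<cdot> v" "(q \<cdot> n) \<cdot> u = (q \<cdot> n) \<cdot> v"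
      have "n \<cdot> u = n \<cdot> v"
        by (rule jointly_monicD[OF product_jointly_monic[OF pq], of _ _ T])
          (use uv D N in \<open>simp_all add: cat_simps\<close>)
      then show "u = v"
        by (rule mono_cancel[rotated, of _ _ _ T]) (use uv D N in \<open>simp_all add: cat_simps\<close>)
    qed
    fix T u v assume uv: "u \<in> hom C T a" "v \<in> hom C T b" "f \<cdot> u = g \<cdot> v"
    obtain h where h: "h \<in> hom C T (Dom C p)" "p \<cdot> h = u" "q \<cdot> h = v"
      using product_lift[OF pq uv(1,2)] .
    have "h \<lesssim> n" using n(2)[OF h(1)] h uv f g D by (simp add: cat_simps)
    then obtain h' where "h' \<in> hom C (Dom C h) (Dom C n)" "n \<cdot> h' = h" by (rule factorsE)
    then show "\<exists>h\<in>hom C T (Dom C n). (p \<cdot> n) \<cdot> h = u \<and> (q \<cdot> n) \<cdot> h = v"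
      using h D N by (intro bexI[of _ h']) (simp_all add: cat_simps)
  qed
  then show thesis by (rule that)
qed

lemma inverse_image:
  assumes m: "m \<in> Sub C Y" and g: "g \<in> hom C P Y"
  obtains n where "n \<in> Sub C P" "\<And>T t. t \<in> hom C T P \<Longrightarrow> t \<lesssim> n \<longleftrightarrow> g \<cdot> t \<lesssim> m"
proof -
  note M = SubD[OF m]
  obtain p n where pb: "is_pullback C m g p n"
    by (rule pullback_exists[of m "Dom C m" Y g P]) (use M g in \<open>simp_all add: cat_simps\<close>)
  note D = pullbackD[OF pb]
  have D': "Cod C n = P" "Dom C n = Dom C p" using D g by (auto simp: hom_iff)
  have "is_mono C n"
  proof (rule monoI)
    show "n \<in> hom C (Dom C p) P" using D D' by (auto simp: cat_simps)
    fix T u v assume uv: "u \<in> hom C T (Dom C p)" "v \<in> hom C T (Dom C p)" "n \<cdot> u = n \<cdot> v"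
    have "g \<cdot> (n \<cdot> u) = g \<cdot> (n \<cdot> v)" using uv by simp
    then have "m \<cdot> (p \<cdot> u) = m \<cdot> (p \<cdot> v)"
      using uv(1,2) D D(9)[THEN comp_subst] g by (simp add: cat_simps)
    then have "p \<cdot> u = p \<cdot> v"
      by (rule mono_cancel[rotated, of _ _ _ T]) (use uv D M in \<open>simp_all add: cat_simps\<close>)
    then show "u = v"
      by (rule jointly_monicD[OF pullback_jointly_monic[OF pb]]) (use uv in simp_all)
  qed
  moreover have "t \<lesssim> n \<longleftrightarrow> g \<cdot> t \<lesssim> m" if t: "t \<in> hom C T P" for T t
  proof
    assume "t \<lesssim> n"
    then obtain h where h: "h \<in> hom C (Dom C t) (Dom C n)" "n \<cdot> h = t" by (rule factorsE)
    have "m \<cdot> (p \<cdot> h) = g \<cdot> (n \<cdot> h)"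
      using h(1) D D(9)[THEN comp_subst] D' by (simp add: cat_simps)
    then have "m \<cdot> (p \<cdot> h) = g \<cdot> t" using h by simp
    then show "g \<cdot> t \<lesssim> m"
      by (rule factorsI) (use h(1) D D' t g in \<open>simp add: cat_simps\<close>)
  next
    assume "g \<cdot> t \<lesssim> m"
    then obtain h where h: "h \<in> hom C (Dom C (g \<cdot> t)) (Dom C m)" "m \<cdot> h = g \<cdot> t" by (rule factorsE)
    have ty: "h \<in> hom C T (Dom C m)" "t \<in> hom C T (Dom C g)" using h t g by (simp_all add: cat_simps)
    obtain k where k: "k \<in> hom C T (Dom C p)" "p \<cdot> k = h" "n \<cdot> k = t"
      using pullback_lift[OF pb h(2) ty] .
    show "t \<lesssim> n" by (rule factorsI[OF k(3)]) (use k(1) t D' in \<open>simp add: cat_simps\<close>)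
  qed
  ultimately show thesis using that D' by (simp add: Sub_def)
qed

definition related where
  "related d e u v \<longleftrightarrow> (\<exists>h\<in>hom C (Dom C u) (Dom C d). d \<cdot> h = u \<and> e \<cdot> h = v)"

lemma relatedI: "d \<cdot> h = u \<Longrightarrow> e \<cdot> h = v \<Longrightarrow> h \<in> hom C (Dom C u) (Dom C d) \<Longrightarrow> related d e u v"
  by (auto simp: related_def)

lemma relatedE:
  assumes "related d e u v"
  obtains h where "h \<in> hom C (Dom C u) (Dom C d)" "d \<cdot> h = u" "e \<cdot> h = v"
  using assms by (auto simp: related_def)

lemma pairing_mono:
  assumes pr: "is_product C a b p q" and jm: "jointly_monic (p \<cdot> m) (q \<cdot> m)" and m: "m \<in> hom C S (Dom C p)"
  shows "is_mono C m"
proof (rule monoI[OF m])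
  note D = productD[OF pr]
  fix T u v assume uv: "u \<in> hom C T S" "v \<in> hom C T S" "m \<cdot> u = m \<cdot> v"
  have "(p \<cdot> m) \<cdot> u = (p \<cdot> m) \<cdot> v" "(q \<cdot> m) \<cdot> u = (q \<cdot> m) \<cdot> v"
    using uv m D by (simp_all add: cat_simps)
  then show "u = v"
    by (rule jointly_monicD[OF jm, of _ _ T]) (use uv m D in \<open>simp_all add: cat_simps\<close>)
qed

lemma relation_subobject:
  assumes jm: "jointly_monic d e" and d: "d \<in> hom C S a" and e: "e \<in> hom C S b"
    and u: "u \<in> hom C P a" and v: "v \<in> hom C P b"
  obtains n where "n \<in> Sub C P" "\<And>T t. t \<in> hom C T P \<Longrightarrow> t \<lesssim> n \<longleftrightarrow> related d e (u \<cdot> t) (v \<cdot> t)"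
proof -
  obtain p q where pq: "is_product C a b p q"
    by (rule product_exists[of a b]) (use d e in \<open>simp_all add: cat_simps\<close>)
  note D = productD[OF pq]
  obtain m where m: "m \<in> hom C S (Dom C p)" "p \<cdot> m = d" "q \<cdot> m = e"
    using product_lift[OF pq d e] .
  obtain g where g: "g \<in> hom C P (Dom C p)" "p \<cdot> g = u" "q \<cdot> g = v"
    using product_lift[OF pq u v] .
  have "m \<in> Sub C (Dom C p)"
    using pairing_mono[OF pq, of m] m jm by (simp add: Sub_def cat_simps)
  then obtain n where n: "n \<in> Sub C P" "\<And>T t. t \<in> hom C T P \<Longrightarrow> t \<lesssim> n \<longleftrightarrow> g \<cdot> t \<lesssim> m"
    using inverse_image g(1) by blast
  have "g \<cdot> t \<lesssim> m \<longleftrightarrow> related d e (u \<cdot> t) (v \<cdot> t)" if t: "t \<in> hom C T P" for T t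
  proof
    assume "g \<cdot> t \<lesssim> m"
    then obtain h where h: "h \<in> hom C (Dom C (g \<cdot> t)) (Dom C m)" "m \<cdot> h = g \<cdot> t" by (rule factorsE)
    have "d \<cdot> h = p \<cdot> (m \<cdot> h)" "e \<cdot> h = q \<cdot> (m \<cdot> h)"
      using h(1) m t g D m(2,3)[THEN comp_subst] by (simp_all add: cat_simps)
    then have "d \<cdot> h = u \<cdot> t" "e \<cdot> h = v \<cdot> t"
      using h(2) g D t g(2,3)[THEN comp_subst] by (simp_all add: cat_simps)
    then show "related d e (u \<cdot> t) (v \<cdot> t)"
      by (rule relatedI) (use h(1) m(1) g(1) t u d in \<open>simp add: cat_simps\<close>)
  next
    assume "related d e (u \<cdot> t) (v \<cdot> t)"
    then obtain h where h: "h \<in> hom C (Dom C (u \<cdot> t)) (Dom C d)" "d \<cdot> h = u \<cdot> t" "e \<cdot> h = v \<cdot> t"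
      by (rule relatedE)
    have "m \<cdot> h = g \<cdot> t"
      by (rule jointly_monicD[OF product_jointly_monic[OF pq], of _ _ T])
        (use h t u v d e m g D m(2,3)[THEN comp_subst] g(2,3)[THEN comp_subst] in \<open>simp_all add: cat_simps\<close>)
    then show "g \<cdot> t \<lesssim> m" by (rule factorsI) (use h(1) m(1) g(1) t u d in \<open>simp add: cat_simps\<close>)
  qed
  then show thesis using that n by blast
qed

end

section \<open>Images and covers in regular categories\<close>

locale regular_cat = cat +
  assumes regular: "regular_category C"

sublocale regular_cat \<subseteq> lex_cat
  by unfold_locales (use regular in \<open>simp add: regular_category_def\<close>)

context regular_cat
begin

lemma regular_epi_pullback: "is_pullback C e g p q \<Longrightarrow> regular_epi C e \<Longrightarrow> regular_epi C q"
  using regular unfolding regular_category_def by blast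

text \<open>An element of the codomain of a regular epimorphism lifts to the domain after passing to a cover
  of its stage of definition.\<close>

lemma cover_lift:
  assumes e: "regular_epi C e" and t: "t \<in> hom C T (Cod C e)"
  obtains T' \<alpha> \<beta> where "regular_epi C \<alpha>" "\<alpha> \<in> hom C T' T" "\<beta> \<in> hom C T' (Dom C e)" "e \<cdot> \<beta> = t \<cdot> \<alpha>"
proof -
  obtain \<beta> \<alpha> where pb: "is_pullback C e t \<beta> \<alpha>"
    by (rule pullback_exists[of e "Dom C e" "Cod C e" t T])
      (use t regular_epi_arr[OF e] in \<open>simp_all add: cat_simps\<close>)
  note D = pullbackD[OF pb]
  show thesis
    by (rule that[of \<alpha> "Dom C \<beta>" \<beta>])
      (use D t regular_epi_pullback[OF pb e] in \<open>simp_all add: cat_simps\<close>)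
qed

text \<open>The coequalizer of the kernel pair of \<open>f\<close> is the regular epimorphic part. That the remaining
  factor is monic uses the stability of regular epimorphisms under pullback.\<close>

lemma image_factorization:
  assumes f: "f \<in> hom C a b"
  obtains I m c where "is_mono C m" "m \<in> hom C I b" "regular_epi C c" "c \<in> hom C a I" "m \<cdot> c = f"
proof -
  obtain p q where pb: "is_pullback C f f p q" using pullback_exists[OF f f] .
  note D = pullbackD[OF pb]
  obtain c where ce: "is_coequalizer C p q c"
    using regular pb unfolding regular_category_def by blast
  note E = coequalizerD[OF ce]
  have c: "regular_epi C c" using ce by (auto simp: regular_epi_def)
  have "f \<in> hom C (Cod C p) b" using f D by (simp add: cat_simps)
  then obtain m where m: "m \<in> hom C (Cod C c) b" "m \<cdot> c = f"
    using coequalizer_desc[OF ce D(9)] by blast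
  have "is_mono C m"
  proof (rule monoI[OF m(1)])
    \<comment> \<open>After passing to a cover of \<open>T\<close>, both elements of the image lift to the domain of \<open>f\<close>,
      where they form an element of the kernel pair.\<close>
    fix T u v assume uv: "u \<in> hom C T (Cod C c)" "v \<in> hom C T (Cod C c)" "m \<cdot> u = m \<cdot> v"
    obtain B1 \<alpha> x where x: "regular_epi C \<alpha>" "\<alpha> \<in> hom C B1 T" "x \<in> hom C B1 (Dom C c)" "c \<cdot> x = u \<cdot> \<alpha>"
      using cover_lift[OF c uv(1)] .
    have "v \<cdot> \<alpha> \<in> hom C B1 (Cod C c)" using x uv by (simp add: cat_simps)
    then obtain B \<beta> y where y: "regular_epi C \<beta>" "\<beta> \<in> hom C B B1" "y \<in> hom C B (Dom C c)"
        "c \<cdot> y = (v \<cdot> \<alpha>) \<cdot> \<beta>"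
      using cover_lift[OF c] by metis
    have "f \<cdot> (x \<cdot> \<beta>) = m \<cdot> (u \<cdot> (\<alpha> \<cdot> \<beta>))" "f \<cdot> y = m \<cdot> (v \<cdot> (\<alpha> \<cdot> \<beta>))"
      unfolding m(2)[symmetric]
      using m(1) x y uv(1,2) E D x(4)[THEN comp_subst] by (simp_all add: cat_simps)
    then have "f \<cdot> (x \<cdot> \<beta>) = f \<cdot> y"
      using uv(3)[THEN comp_subst] m(1) x(2) y(2) uv(1,2) by (simp add: cat_simps)
    moreover have "x \<cdot> \<beta> \<in> hom C B (Dom C f)" "y \<in> hom C B (Dom C f)"
      using x y f D E by (simp_all add: cat_simps)
    ultimately obtain h where h: "h \<in> hom C B (Dom C p)" "p \<cdot> h = x \<cdot> \<beta>" "q \<cdot> h = y"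
      by (rule pullback_lift[OF pb])
    have "c \<cdot> (p \<cdot> h) = c \<cdot> (q \<cdot> h)"
      using h(1) E D E(7)[THEN comp_subst] by (simp add: cat_simps)
    then have "c \<cdot> (x \<cdot> \<beta>) = c \<cdot> y" by (simp only: h)
    then have "(u \<cdot> \<alpha>) \<cdot> \<beta> = (v \<cdot> \<alpha>) \<cdot> \<beta>"
      using x y E D x(4)[THEN comp_subst] uv(1,2) by (simp add: cat_simps)
    then have "u \<cdot> \<alpha> = v \<cdot> \<alpha>"
      by (rule regular_epi_cancel[OF y(1), of _ _ "Cod C c"]) (use x y uv(1,2) in \<open>simp_all add: cat_simps\<close>)
    then show "u = v"
      by (rule regular_epi_cancel[OF x(1), of _ _ "Cod C c"]) (use x y uv(1,2) in \<open>simp_all add: cat_simps\<close>)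
  qed
  then show thesis
    by (rule that[OF _ m(1) c _ m(2)]) (use E D f m in \<open>simp add: cat_simps\<close>)
qed


text \<open>Extremal epimorphisms are regular: the monic part of the image factorization of \<open>e\<close> is an
  isomorphism, and composing a coequalizer with an isomorphism gives a coequalizer.\<close>

lemma regular_epiI:
  assumes e: "e \<in> hom C a b"
    and extremal: "\<And>m. m \<in> Sub C b \<Longrightarrow> e \<lesssim> m \<Longrightarrow> Ident C b \<lesssim> m"
  shows "regular_epi C e"
proof -
  obtain I m c where m: "is_mono C m" "m \<in> hom C I b" and c: "regular_epi C c" "c \<in> hom C a I"
    and mc: "m \<cdot> c = e"
    using image_factorization[OF e] .
  have "e \<lesssim> m" by (rule factorsI[OF mc]) (use m c e in \<open>simp add: cat_simps\<close>)
  then have "Ident C b \<lesssim> m" using extremal m by (simp add: Sub_def cat_simps)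
  then obtain h where h0: "h \<in> hom C (Dom C (Ident C b)) (Dom C m)" "m \<cdot> h = Ident C b" by (rule factorsE)
  then have h: "h \<in> hom C b I" using e m by (simp add: cat_simps)
  have hm: "h \<cdot> m = Ident C I"
    by (rule mono_cancel[OF m(1), of _ _ I])
      (use h m h0(2)[THEN comp_subst] in \<open>simp_all add: cat_simps\<close>)
  obtain u v where ce: "is_coequalizer C u v c" using c(1) by (auto simp: regular_epi_def)
  note E = coequalizerD[OF ce]
  have eu: "e \<cdot> u = e \<cdot> v" unfolding mc[symmetric] using m c(2) E by (simp add: cat_simps)
  have D: "Cod C u = a" "Cod C e = b" "Cod C c = I" using E c(2) e by (auto simp: hom_iff)
  have "\<exists>!g. g \<in> hom C b T \<and> g \<cdot> e = f" if f: "f \<in> hom C a T" "f \<cdot> u = f \<cdot> v" for T f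
  proof -
    have "f \<in> hom C (Cod C u) T" using f D by simp
    then obtain g where g0: "g \<in> hom C (Cod C c) T" and gc: "g \<cdot> c = f"
      using coequalizer_desc[OF ce f(2)] by blast
    have g: "g \<in> hom C I T" using g0 D by simp
    have "(g \<cdot> h) \<cdot> e = f"
      unfolding mc[symmetric] using gc g m c(2) h hm[THEN comp_subst] by (simp add: cat_simps)
    moreover have "g' = g \<cdot> h" if g': "g' \<in> hom C b T" "g' \<cdot> e = f" for g'
    proof -
      have "(g' \<cdot> m) \<cdot> c = g \<cdot> c" using g' gc mc m c(2) by (simp add: cat_simps)
      then have "g' \<cdot> m = g"
        by (rule regular_epi_cancel[OF c(1), of _ _ T]) (use g g'(1) m c(2) in \<open>simp_all add: cat_simps\<close>)
      then have "(g' \<cdot> m) \<cdot> h = g \<cdot> h" by simp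
      then show ?thesis using g'(1) m h h0(2) by (simp add: cat_simps)
    qed
    moreover have "g \<cdot> h \<in> hom C b T" using g h by (simp add: cat_simps)
    ultimately show ?thesis by blast
  qed
  moreover have "u \<in> Arr C" "v \<in> hom C (Dom C u) a" "e \<in> hom C a b"
    using E D e by (simp_all add: cat_simps)
  ultimately have "is_coequalizer C u v e"
    using eu unfolding is_coequalizer_def D by blast
  then show ?thesis by (auto simp: regular_epi_def)
qed

lemma regular_epi_left_factor:
  assumes gf: "regular_epi C (g \<cdot> f)" and f: "f \<in> hom C a b" and g: "g \<in> hom C b c"
  shows "regular_epi C g"
proof (rule regular_epiI[OF g])
  fix m assume m: "m \<in> Sub C c" "g \<lesssim> m"
  note M = SubD[OF m(1)]
  have "g \<cdot> f \<lesssim> m" by (rule factors_comp) (use m M f g in \<open>simp_all add: cat_simps\<close>)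
  then have "Ident C (Cod C (g \<cdot> f)) \<lesssim> m"
    by (intro regular_epi_extremal[OF gf]) (use M f g in \<open>simp_all add: cat_simps\<close>)
  then show "Ident C c \<lesssim> m" using f g by (simp add: cat_simps)
qed

end

section \<open>Zero arrows and kernels\<close>

locale pointed_cat = cat +
  assumes pointed: "pointed C"
begin

definition zero_ob where
  "zero_ob = (SOME z. is_zero_object C z)"

definition zero_arr where
  "zero_arr a b = (THE v. v \<in> hom C zero_ob b) \<cdot> (THE u. u \<in> hom C a zero_ob)"

lemma zero_ob: "is_zero_object C zero_ob"
  using pointed unfolding pointed_def zero_ob_def by (metis someI)

lemma zero_object_unique_arrow:
  assumes "is_zero_object C z" "a \<in> Ob C"
  shows "\<exists>!f. f \<in> hom C z a" "\<exists>!f. f \<in> hom C a z"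
  using assms unfolding is_zero_object_def is_initial_def is_terminal_def by auto

lemma zero_object_Ob: "is_zero_object C z \<Longrightarrow> z \<in> Ob C"
  unfolding is_zero_object_def is_initial_def by auto

lemma zero_arr_hom: "a \<in> Ob C \<Longrightarrow> b \<in> Ob C \<Longrightarrow> zero_arr a b \<in> hom C a b"
  unfolding zero_arr_def
  by (rule comp_hom[OF theI' theI']) (rule zero_object_unique_arrow[OF zero_ob], assumption)+

lemma zero_arrow_eq:
  assumes z: "is_zero_object C z" and u: "u \<in> hom C a z" and v: "v \<in> hom C z b"
  shows "v \<cdot> u = zero_arr a b"
proof -
  have ob: "a \<in> Ob C" "b \<in> Ob C" "z \<in> Ob C" "zero_ob \<in> Ob C"
    using u v zero_object_Ob[OF zero_ob] by (auto simp: hom_iff)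
  obtain i where i: "i \<in> hom C z zero_ob" using zero_object_unique_arrow(1)[OF z ob(4)] by blast
  obtain j where j: "j \<in> hom C zero_ob z" using zero_object_unique_arrow(2)[OF z ob(4)] by blast
  have ji: "j \<cdot> i = Ident C z"
    using zero_object_unique_arrow(1)[OF z ob(3)] comp_hom[OF i j] Ident_hom[OF ob(3)] by blast
  have "(THE v. v \<in> hom C zero_ob b) = v \<cdot> j"
    by (rule the1_equality[OF zero_object_unique_arrow(1)[OF zero_ob ob(2)] comp_hom[OF j v]])
  moreover have "(THE u. u \<in> hom C a zero_ob) = i \<cdot> u"
    by (rule the1_equality[OF zero_object_unique_arrow(2)[OF zero_ob ob(1)] comp_hom[OF u i]])
  ultimately show ?thesis
    unfolding zero_arr_def using i j u v ji[THEN comp_subst] by (simp add: cat_simps)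
qed

lemma zero_arr_simps:
  assumes "a \<in> Ob C" "b \<in> Ob C"
  shows "zero_arr a b \<in> Arr C" "Dom C (zero_arr a b) = a" "Cod C (zero_arr a b) = b"
  using zero_arr_hom[OF assms] by (auto simp: hom_iff)

text \<open>The definite descriptions in the definition of \<open>zero_arr\<close> are hidden behind this factorization
  through the zero object.\<close>

lemma zero_arr_eq_comp:
  assumes "a \<in> Ob C" "b \<in> Ob C"
  obtains u v where "u \<in> hom C a zero_ob" "v \<in> hom C zero_ob b" "zero_arr a b = v \<cdot> u"
  using zero_object_unique_arrow[OF zero_ob] assms theI' unfolding zero_arr_def by metis

lemma comp_zero_arr:
  assumes "g \<in> Arr C" "Dom C g = b" "a \<in> Ob C"
  shows "g \<cdot> zero_arr a b = zero_arr a (Cod C g)"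
proof -
  obtain u v where uv: "u \<in> hom C a zero_ob" "v \<in> hom C zero_ob b" "zero_arr a b = v \<cdot> u"
    using zero_arr_eq_comp[of a b] assms Dom_Ob by metis
  have "(g \<cdot> v) \<cdot> u = zero_arr a (Cod C g)"
    by (rule zero_arrow_eq[OF zero_ob uv(1)]) (use uv assms in \<open>simp add: cat_simps\<close>)
  then show ?thesis using uv assms by (simp add: cat_simps)
qed

lemma zero_arr_comp:
  assumes "f \<in> Arr C" "Cod C f = b" "c \<in> Ob C"
  shows "zero_arr b c \<cdot> f = zero_arr (Dom C f) c"
proof -
  obtain u v where uv: "u \<in> hom C b zero_ob" "v \<in> hom C zero_ob c" "zero_arr b c = v \<cdot> u"
    using zero_arr_eq_comp[of b c] assms Cod_Ob by metis
  have "v \<cdot> (u \<cdot> f) = zero_arr (Dom C f) c"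
    by (rule zero_arrow_eq[OF zero_ob _ uv(2)]) (use uv assms in \<open>simp add: cat_simps\<close>)
  then show ?thesis using uv assms by (simp add: cat_simps)
qed

lemma is_zero_arrow_iff: "is_zero_arrow C f \<longleftrightarrow> f \<in> Arr C \<and> f = zero_arr (Dom C f) (Cod C f)"
proof
  assume "is_zero_arrow C f"
  then show "f \<in> Arr C \<and> f = zero_arr (Dom C f) (Cod C f)"
    using zero_arrow_eq unfolding is_zero_arrow_def by metis
next
  assume f: "f \<in> Arr C \<and> f = zero_arr (Dom C f) (Cod C f)"
  obtain u v where "u \<in> hom C (Dom C f) zero_ob" "v \<in> hom C zero_ob (Cod C f)" "zero_arr (Dom C f) (Cod C f) = v \<cdot> u"
    by (rule zero_arr_eq_comp[of "Dom C f" "Cod C f"]) (use f Dom_Ob Cod_Ob in auto)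
  then show "is_zero_arrow C f"
    unfolding is_zero_arrow_def using f zero_ob by metis
qed

lemmas pointed_simps = cat_simps zero_arr_simps comp_zero_arr zero_arr_comp

lemma kernelD:
  assumes "is_kernel C f k"
  shows "f \<in> Arr C" "k \<in> Sub C (Dom C f)" "f \<cdot> k = zero_arr (Dom C k) (Cod C f)"
proof -
  have D: "f \<in> Arr C" "k \<in> hom C (Dom C k) (Dom C f)" "is_zero_arrow C (f \<cdot> k)"
    using assms unfolding is_kernel_def by blast+
  then show f: "f \<in> Arr C" and z: "f \<cdot> k = zero_arr (Dom C k) (Cod C f)"
    by (simp_all add: is_zero_arrow_iff pointed_simps)
  have lift: "\<exists>!h. h \<in> hom C T (Dom C k) \<and> k \<cdot> h = g"
    if "g \<in> hom C T (Dom C f)" "is_zero_arrow C (f \<cdot> g)" for T g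
    using assms that unfolding is_kernel_def by blast
  have "is_mono C k"
  proof (rule monoI[OF D(2)])
    fix T u v assume uv: "u \<in> hom C T (Dom C k)" "v \<in> hom C T (Dom C k)" "k \<cdot> u = k \<cdot> v"
    have "\<exists>!h. h \<in> hom C T (Dom C k) \<and> k \<cdot> h = k \<cdot> u"
      by (rule lift) (use uv D z[THEN comp_subst] in \<open>simp_all add: pointed_simps is_zero_arrow_iff\<close>)
    then show "u = v" using uv by metis
  qed
  then show "k \<in> Sub C (Dom C f)" using D by (simp add: Sub_def hom_iff)
qed

lemma kernel_factors_iff:
  assumes k: "is_kernel C f k" and t: "t \<in> hom C T (Dom C f)"
  shows "t \<lesssim> k \<longleftrightarrow> f \<cdot> t = zero_arr T (Cod C f)"
proof
  note D = kernelD[OF k]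
  note S = SubD[OF D(2)]
  assume "t \<lesssim> k"
  then obtain h where h: "h \<in> hom C (Dom C t) (Dom C k)" "k \<cdot> h = t" by (rule factorsE)
  have "f \<cdot> (k \<cdot> h) = zero_arr T (Cod C f)"
    using h(1) D(1) S t D(3)[THEN comp_subst] by (simp add: pointed_simps)
  then show "f \<cdot> t = zero_arr T (Cod C f)" using h by simp
next
  assume "f \<cdot> t = zero_arr T (Cod C f)"
  then have "is_zero_arrow C (f \<cdot> t)" using t kernelD[OF k] by (simp add: pointed_simps is_zero_arrow_iff)
  then obtain h where "h \<in> hom C T (Dom C k)" "k \<cdot> h = t"
    using k t unfolding is_kernel_def by blast
  then show "t \<lesssim> k" using t by (intro factorsI[of k h]) (simp_all add: hom_iff)
qed

lemma kernelI:
  assumes f: "f \<in> hom C a b" and k: "k \<in> Sub C a" "f \<cdot> k = zero_arr (Dom C k) b"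
    and lift: "\<And>T t. t \<in> hom C T a \<Longrightarrow> f \<cdot> t = zero_arr T b \<Longrightarrow> t \<lesssim> k"
  shows "is_kernel C f k"
proof -
  note K = SubD[OF k(1)]
  have a: "Dom C f = a" "f \<in> Arr C" using f by (simp_all add: hom_iff)
  have "\<exists>!h. h \<in> hom C T (Dom C k) \<and> k \<cdot> h = t" if t: "t \<in> hom C T a" "is_zero_arrow C (f \<cdot> t)" for T t
  proof -
    have "f \<cdot> t = zero_arr T b" using t f by (simp add: is_zero_arrow_iff pointed_simps)
    then have "t \<lesssim> k" using lift t(1) by blast
    then obtain h where "h \<in> hom C (Dom C t) (Dom C k)" "k \<cdot> h = t" by (rule factorsE)
    then show ?thesis using mono_cancel K t(1) by (metis hom_iff)
  qed
  moreover have "is_zero_arrow C (f \<cdot> k)" "k \<in> hom C (Dom C k) a"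
    using k f K by (simp_all add: is_zero_arrow_iff pointed_simps)
  ultimately show ?thesis unfolding is_kernel_def a using a by blast
qed

lemma NSubI: "is_kernel C f n \<Longrightarrow> f \<in> hom C X b \<Longrightarrow> n \<in> NSub C X"
  using kernelD[of f n] SubD[of n X] by (auto simp: NSub_def normal_mono_def hom_iff)

lemma NSubE:
  assumes "n \<in> NSub C X"
  obtains Q f where "f \<in> hom C X Q" "is_kernel C f n"
proof -
  obtain f where f: "is_kernel C f n" using assms by (auto simp: NSub_def normal_mono_def)
  have "Dom C f = X" using SubD[OF kernelD(2)[OF f]] assms by (simp add: NSub_def)
  then have "f \<in> hom C X (Cod C f)" using arr_hom[OF kernelD(1)[OF f]] by simp
  then show thesis using that f by blast
qed

lemma NSub_imp_Sub: "n \<in> NSub C X \<Longrightarrow> n \<in> Sub C X"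
  by (erule NSubE) (use kernelD in \<open>auto simp: hom_iff\<close>)

lemma kernel_same_sub:
  assumes k: "is_kernel C f k" and s: "same_sub C k n"
  shows "is_kernel C f n"
proof (rule kernelI)
  note D = kernelD[OF k] and S = same_subD[OF s]
  note K = SubD[OF D(2)]
  show "f \<in> hom C (Dom C f) (Cod C f)" "n \<in> Sub C (Dom C f)"
    using D S K by (simp_all add: Sub_def cat_simps)
  have "n \<in> hom C (Dom C n) (Dom C f)" using D S K by (simp add: cat_simps)
  then show "f \<cdot> n = zero_arr (Dom C n) (Cod C f)" using kernel_factors_iff[OF k] S by blast
  fix T t assume t: "t \<in> hom C T (Dom C f)" "f \<cdot> t = zero_arr T (Cod C f)"
  then have "t \<lesssim> k" using kernel_factors_iff[OF k] by blast
  then show "t \<lesssim> n" using S factors_trans by blast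
qed

lemma NSub_same_sub: "n \<in> NSub C X \<Longrightarrow> same_sub C n n' \<Longrightarrow> n' \<in> NSub C X"
  by (metis NSubE NSubI kernel_same_sub)

lemma kernel_restrict:
  assumes x: "x \<in> Sub C Y" and f: "f \<in> hom C Y Q" and k: "k \<in> Sub C (Dom C x)" and xk: "is_kernel C f (x \<cdot> k)"
  shows "is_kernel C (f \<cdot> x) k"
proof (rule kernelI[OF _ k])
  note X = SubD[OF x] and K = SubD[OF k]
  show "f \<cdot> x \<in> hom C (Dom C x) Q" using f X by (simp add: cat_simps)
  show "(f \<cdot> x) \<cdot> k = zero_arr (Dom C k) Q"
    using kernelD(3)[OF xk] f X K by (simp add: cat_simps)
  fix T t assume t: "t \<in> hom C T (Dom C x)" "(f \<cdot> x) \<cdot> t = zero_arr T Q"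
  have "x \<cdot> t \<lesssim> x \<cdot> k"
    using kernel_factors_iff[OF xk, of "x \<cdot> t" T] t f X by (simp add: cat_simps)
  then show "t \<lesssim> k"
    using comp_factors_comp_iff[of x k "Dom C k" t T] X K t(1) by (simp add: cat_simps)
qed

lemma NSub_restrict:
  assumes "x \<in> Sub C Y" "k \<in> Sub C (Dom C x)" "x \<cdot> k \<in> NSub C Y"
  shows "k \<in> NSub C (Dom C x)"
proof -
  obtain Q f where f: "f \<in> hom C Y Q" "is_kernel C f (x \<cdot> k)" using assms(3) by (rule NSubE)
  have "f \<cdot> x \<in> hom C (Dom C x) Q" using f SubD[OF assms(1)] by (simp add: cat_simps)
  then show ?thesis using NSubI kernel_restrict[OF assms(1) f(1) assms(2) f(2)] by blast
qed

text \<open>If \<open>n\<close> is the kernel of \<open>f\<close>, then its inverse image along \<open>g\<close> is the kernel of \<open>f g\<close>.\<close>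

lemma inverse_image_NSub:
  assumes n: "n \<in> NSub C Y" and m: "m \<in> Sub C P" and g: "g \<in> hom C P Y"
    and iff: "\<And>T t. t \<in> hom C T P \<Longrightarrow> t \<lesssim> m \<longleftrightarrow> g \<cdot> t \<lesssim> n"
  shows "m \<in> NSub C P"
proof -
  obtain Q f where f: "f \<in> hom C Y Q" "is_kernel C f n" using n by (rule NSubE)
  note M = SubD[OF m]
  have iff': "t \<lesssim> m \<longleftrightarrow> (f \<cdot> g) \<cdot> t = zero_arr T Q" if t: "t \<in> hom C T P" for T t
    using iff[OF t] kernel_factors_iff[OF f(2), of "g \<cdot> t" T] f(1) t g by (simp add: cat_simps)
  have fg: "f \<cdot> g \<in> hom C P Q" using f g by (simp add: cat_simps)
  have "is_kernel C (f \<cdot> g) m"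
  proof (rule kernelI[OF fg m])
    have "m \<in> hom C (Dom C m) P" using M by (simp add: cat_simps)
    then show "(f \<cdot> g) \<cdot> m = zero_arr (Dom C m) Q" using iff' factors_refl M by blast
  qed (use iff' in blast)
  then show ?thesis using NSubI fg by blast
qed

end

section \<open>Consequences of protomodularity\<close>

locale semi_abelian_cat =
  fixes C :: "('o, 'm) category" (structure)
  assumes semi_abelian: "semi_abelian C"

sublocale semi_abelian_cat \<subseteq> regular_cat
  by unfold_locales (use semi_abelian in \<open>auto simp: semi_abelian_def barr_exact_def\<close>)

sublocale semi_abelian_cat \<subseteq> pointed_cat
  by unfold_locales (use semi_abelian in \<open>auto simp: semi_abelian_def\<close>)

context semi_abelian_cat
begin

lemma coproduct_exists:
  assumes "a \<in> Ob C" "b \<in> Ob C"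
  obtains i j where "is_coproduct C a b i j"
  using semi_abelian assms unfolding semi_abelian_def has_binary_coproducts_def by blast

lemma kernel_exists:
  assumes f: "f \<in> hom C a b"
  obtains k where "is_kernel C f k"
proof -
  have ob: "a \<in> Ob C" "b \<in> Ob C" using f by (simp_all add: hom_iff)
  obtain k where k: "k \<in> Sub C a" "\<And>T t. t \<in> hom C T a \<Longrightarrow> t \<lesssim> k \<longleftrightarrow> f \<cdot> t = zero_arr a b \<cdot> t"
    using equalizer_subobject[OF f zero_arr_hom[OF ob]] by blast
  have k': "t \<lesssim> k \<longleftrightarrow> f \<cdot> t = zero_arr T b" if "t \<in> hom C T a" for T t
    using k(2)[OF that] that ob by (simp add: pointed_simps)
  have "k \<in> hom C (Dom C k) a" "k \<lesssim> k" using SubD[OF k(1)] factors_refl by (simp_all add: cat_simps)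
  then have "f \<cdot> k = zero_arr (Dom C k) b" using k' by blast
  then have "is_kernel C f k" using kernelI[OF f k(1)] k' by blast
  then show thesis by (rule that)
qed

text \<open>The form in which protomodularity is used. Pulling back along \<open>0 \<rightarrow> A\<close> takes kernels, and the
  hypothesis on \<open>m\<close> says that the arrow of points \<open>m\<close> from \<open>(Dom m, f m)\<close> to \<open>(P, f)\<close> restricts
  to an isomorphism between the kernels; so \<open>m\<close> itself is an isomorphism.\<close>

lemma split_extension_generated:
  assumes f: "f \<in> hom C P A" and s: "s \<in> hom C A P" and fs: "f \<cdot> s = Ident C A"
    and m: "m \<in> Sub C P" and sm: "s \<lesssim> m"
    and ker: "\<And>T t. t \<in> hom C T P \<Longrightarrow> f \<cdot> t = zero_arr T A \<Longrightarrow> t \<lesssim> m"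
  shows "Ident C P \<lesssim> m"
proof -
  note M = SubD[OF m]
  have z: "zero_ob \<in> Ob C" using zero_object_Ob[OF zero_ob] .
  obtain s' where s': "s' \<in> hom C A (Dom C m)" "m \<cdot> s' = s"
    using sm s by (auto simp: sub_le_def hom_def)
  have fm: "f \<cdot> m \<in> hom C (Dom C m) A" using f M by (simp add: cat_simps)
  have v: "zero_arr zero_ob A \<in> hom C zero_ob A" using zero_arr_hom z f by (simp add: hom_iff)
  obtain p p' where pb: "is_pullback C (zero_arr zero_ob A) (f \<cdot> m) p p'" using pullback_exists[OF v fm] .
  obtain q q' where qb: "is_pullback C (zero_arr zero_ob A) f q q'" using pullback_exists[OF v f] .
  note P = pullbackD[OF pb] and Q = pullbackD[OF qb]
  have A: "A \<in> Ob C" using f by (simp add: hom_iff)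
  have ty: "p \<in> hom C (Dom C p) (Dom C (zero_arr zero_ob A))" "m \<cdot> p' \<in> hom C (Dom C p) (Dom C f)"
    "(zero_arr zero_ob A) \<cdot> p = f \<cdot> (m \<cdot> p')"
    using P M fm v f by (simp_all add: cat_simps)
  \<comment> \<open>\<open>p'\<close> and \<open>q'\<close> are the kernels of \<open>f m\<close> and \<open>f\<close>, and \<open>h'\<close> is the restriction of \<open>m\<close>;
    its inverse \<open>b\<close> comes from the hypothesis on the kernel of \<open>f\<close>.\<close>
  obtain h' where h': "h' \<in> hom C (Dom C p) (Dom C q)" "q \<cdot> h' = p" "q' \<cdot> h' = m \<cdot> p'"
    using pullback_lift[OF qb ty(3) ty(1,2)] .
  have q': "q' \<in> hom C (Dom C q) P" using Q f by (simp add: cat_simps)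
  have "f \<cdot> q' = zero_arr (Dom C q) A" using Q(9) Q z A by (simp add: pointed_simps)
  then have "q' \<lesssim> m" using ker q' by blast
  then obtain a where a: "a \<in> hom C (Dom C q) (Dom C m)" "m \<cdot> a = q'"
    using q' by (auto simp: sub_le_def hom_def)
  have ty2: "q \<in> hom C (Dom C q) (Dom C (zero_arr zero_ob A))" "a \<in> hom C (Dom C q) (Dom C (f \<cdot> m))"
    "zero_arr zero_ob A \<cdot> q = (f \<cdot> m) \<cdot> a"
    using Q a f M by (simp_all add: cat_simps)
  obtain b where b: "b \<in> hom C (Dom C q) (Dom C p)" "p \<cdot> b = q" "p' \<cdot> b = a"
    using pullback_lift[OF pb ty2(3) ty2(1,2)] .
  have D: "Dom C p' = Dom C p" "Cod C p' = Dom C m" using P fm by (simp_all add: cat_simps)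
  have "h' \<cdot> b = Ident C (Dom C q)"
    by (rule jointly_monicD[OF pullback_jointly_monic[OF qb], of _ _ "Dom C q"])
      (use h' b a P Q M D h'(2,3)[THEN comp_subst] in \<open>simp_all add: cat_simps\<close>)
  moreover have "b \<cdot> h' = Ident C (Dom C p)"
  proof (rule jointly_monicD[OF pullback_jointly_monic[OF pb], of _ _ "Dom C p"])
    show "p \<cdot> (b \<cdot> h') = p \<cdot> Ident C (Dom C p)"
      using h' b P b(2)[THEN comp_subst] by (simp add: cat_simps)
    have "m \<cdot> (a \<cdot> h') = m \<cdot> p'"
      using a h' M a(2)[THEN comp_subst] by (simp add: cat_simps)
    then have "a \<cdot> h' = p'"
      by (rule mono_cancel[rotated, of _ _ _ "Dom C p"]) (use a h' P M D in \<open>simp_all add: cat_simps\<close>)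
    then show "p' \<cdot> (b \<cdot> h') = p' \<cdot> Ident C (Dom C p)"
      using h' b P D b(3)[THEN comp_subst] by (simp add: cat_simps)
  qed (use h' b P in \<open>simp_all add: cat_simps\<close>)
  ultimately have iso: "is_iso C h'"
    unfolding is_iso_def using h' b by (auto simp: hom_def)
  have pt: "((Dom C m, f \<cdot> m, s'), m, (P, f, s)) \<in> Arr (Pt C (Cod C (zero_arr zero_ob A)))"
    using f s fs s' M fm v s'(2)[THEN comp_subst] by (simp add: Pt_def cat_simps)
  have "is_iso C m"
    using semi_abelian pt pb qb h' iso P(3) v unfolding semi_abelian_def protomodular_def
    by (metis hom_iff)
  then obtain g where "g \<in> hom C (Cod C m) (Dom C m)" "m \<cdot> g = Ident C (Cod C m)"
    unfolding is_iso_def by blast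
  then show ?thesis using M by (intro factorsI[of m g]) (simp_all add: cat_simps)
qed

text \<open>The analogue for a regular epimorphism instead of a split one. Pulling \<open>g\<close> back along \<open>g i\<close> makes
  it split, with section \<open>(1, i)\<close>, and leaves its kernel unchanged; so the inverse image of \<open>i\<close>
  is everything there, and one descends along the cover \<open>q\<close> of \<open>P\<close>.\<close>

lemma regular_extension_generated:
  assumes g: "g \<in> hom C P Q" and i: "i \<in> Sub C P" and gi: "regular_epi C (g \<cdot> i)"
    and ker: "\<And>T t. t \<in> hom C T P \<Longrightarrow> g \<cdot> t = zero_arr T Q \<Longrightarrow> t \<lesssim> i"
  shows "Ident C P \<lesssim> i"
proof -
  note I = SubD[OF i]
  have gih: "g \<cdot> i \<in> hom C (Dom C i) Q" using g I by (simp add: cat_simps)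
  obtain p q where pb: "is_pullback C (g \<cdot> i) g p q" using pullback_exists[OF gih g] .
  note D = pullbackD[OF pb]
  have qh: "q \<in> hom C (Dom C p) P" and ph: "p \<in> hom C (Dom C p) (Dom C i)"
    using D g gih by (simp_all add: cat_simps)
  obtain m where m: "m \<in> Sub C (Dom C p)" "\<And>T t. t \<in> hom C T (Dom C p) \<Longrightarrow> t \<lesssim> m \<longleftrightarrow> q \<cdot> t \<lesssim> i"
    using inverse_image[OF i qh] by blast
  have ty: "(g \<cdot> i) \<cdot> Ident C (Dom C i) = g \<cdot> i" "Ident C (Dom C i) \<in> hom C (Dom C i) (Dom C (g \<cdot> i))"
    "i \<in> hom C (Dom C i) (Dom C g)"
    using g I by (simp_all add: cat_simps)
  obtain s where s: "s \<in> hom C (Dom C i) (Dom C p)" "p \<cdot> s = Ident C (Dom C i)" "q \<cdot> s = i"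
    using pullback_lift[OF pb ty] .
  have "Ident C (Dom C p) \<lesssim> m"
  proof (rule split_extension_generated[OF ph s(1,2) m(1)])
    show "s \<lesssim> m" using m(2)[OF s(1)] s(3) I factors_refl by simp
    fix T t assume t: "t \<in> hom C T (Dom C p)" "p \<cdot> t = zero_arr T (Dom C i)"
    have ob: "Dom C i \<in> Ob C" "T \<in> Ob C" using I t by (auto simp: hom_iff Dom_Ob)
    have "g \<cdot> (q \<cdot> t) = (g \<cdot> i) \<cdot> (p \<cdot> t)"
      using D(9)[symmetric, THEN comp_subst] t(1) g I qh ph by (simp add: cat_simps)
    also have "\<dots> = zero_arr T Q" using t gih ob by (simp add: pointed_simps)
    finally have "q \<cdot> t \<lesssim> i" by (rule ker[rotated]) (use t qh in \<open>simp add: cat_simps\<close>)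
    then show "t \<lesssim> m" using m(2)[OF t(1)] by blast
  qed
  then have "q \<cdot> Ident C (Dom C p) \<lesssim> i"
    using m(2)[of "Ident C (Dom C p)" "Dom C p"] D Ident_hom Dom_Ob by blast
  then have "q \<lesssim> i" using qh by (simp add: cat_simps)
  moreover have "Cod C q = P" using qh by (simp add: hom_iff)
  ultimately show ?thesis
    using regular_epi_extremal[OF regular_epi_pullback[OF pb gi], of i] I by auto
qed

lemma product_insertions_exist:
  assumes "a \<in> Ob C" "b \<in> Ob C"
  obtains p q i j where "is_product_insertions C a b p q i j"
proof -
  obtain p q where pq: "is_product C a b p q" using product_exists[OF assms] .
  note D = productD[OF pq]
  have id: "Ident C a \<in> hom C a a" "Ident C b \<in> hom C b b" "zero_arr a b \<in> hom C a b" "zero_arr b a \<in> hom C b a"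
    using assms Ident_hom zero_arr_hom by auto
  obtain i where i: "i \<in> hom C a (Dom C p)" "p \<cdot> i = Ident C a" "q \<cdot> i = zero_arr a b"
    using product_lift[OF pq id(1,3)] .
  obtain j where j: "j \<in> hom C b (Dom C p)" "p \<cdot> j = zero_arr b a" "q \<cdot> j = Ident C b"
    using product_lift[OF pq id(4,2)] .
  have "is_product_insertions C a b p q i j"
    unfolding is_product_insertions_def
    using pq i j assms by (simp add: is_zero_arrow_iff pointed_simps)
  then show thesis by (rule that)
qed

lemma product_insertionsD:
  assumes "is_product_insertions C A B p q a b"
  shows "is_product C A B p q" "a \<in> hom C A (Dom C p)" "b \<in> hom C B (Dom C p)"
    "p \<cdot> a = Ident C A" "q \<cdot> a = zero_arr A B" "p \<cdot> b = zero_arr B A" "q \<cdot> b = Ident C B"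
proof -
  show *: "is_product C A B p q" "a \<in> hom C A (Dom C p)" "b \<in> hom C B (Dom C p)"
    "p \<cdot> a = Ident C A" "q \<cdot> b = Ident C B"
    using assms unfolding is_product_insertions_def by blast+
  have "is_zero_arrow C (q \<cdot> a)" "is_zero_arrow C (p \<cdot> b)"
    using assms unfolding is_product_insertions_def by blast+
  then show "q \<cdot> a = zero_arr A B" "p \<cdot> b = zero_arr B A"
    using productD[OF *(1)] *(2,3) by (simp_all add: is_zero_arrow_iff pointed_simps)
qed

text \<open>The product is a split extension of \<open>A\<close> by \<open>B\<close>, so a subobject containing both insertions, such
  as the image of \<open>\<sigma>\<close>, is everything.\<close>

lemma coproduct_to_product_regular:
  assumes ij: "is_coproduct C A B i j" and pr: "is_product_insertions C A B p q a b"
    and \<sigma>: "\<sigma> \<in> hom C (Cod C i) (Dom C p)" "\<sigma> \<cdot> i = a" "\<sigma> \<cdot> j = b"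
  shows "regular_epi C \<sigma>"
proof (rule regular_epiI[OF \<sigma>(1)])
  note I = coproductD[OF ij] and PI = product_insertionsD[OF pr]
  note D = productD[OF PI(1)]
  fix m assume m: "m \<in> Sub C (Dom C p)" "\<sigma> \<lesssim> m"
  note M = SubD[OF m(1)]
  have am: "a \<lesssim> m" unfolding \<sigma>(2)[symmetric]
    by (rule factors_comp) (use m M \<sigma>(1) I in \<open>simp_all add: cat_simps\<close>)
  have bm: "b \<lesssim> m" unfolding \<sigma>(3)[symmetric]
    by (rule factors_comp) (use m M \<sigma>(1) I in \<open>simp_all add: cat_simps\<close>)
  show "Ident C (Dom C p) \<lesssim> m"
  proof (rule split_extension_generated[OF _ PI(2,4) m(1) am])
    show "p \<in> hom C (Dom C p) A" using D by (simp add: cat_simps)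
    fix T t assume t: "t \<in> hom C T (Dom C p)" "p \<cdot> t = zero_arr T A"
    have "t = b \<cdot> (q \<cdot> t)"
      by (rule jointly_monicD[OF product_jointly_monic[OF PI(1)], of _ _ T])
        (use t D PI PI(6,7)[THEN comp_subst] in \<open>simp_all add: pointed_simps\<close>)
    moreover have "b \<cdot> (q \<cdot> t) \<lesssim> m"
      by (rule factors_comp[OF bm]) (use t D PI(3) M in \<open>simp_all add: cat_simps\<close>)
    ultimately show "t \<lesssim> m" by simp
  qed
qed

lemma kernel_pair_exists:
  assumes f: "f \<in> hom C a b"
  obtains R p q r where "is_pullback C f f p q" "p \<in> hom C R a" "q \<in> hom C R a" "f \<cdot> p = f \<cdot> q"
    "r \<in> hom C a R" "p \<cdot> r = Ident C a" "q \<cdot> r = Ident C a"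
proof -
  obtain p q where pb: "is_pullback C f f p q" using pullback_exists[OF f f] .
  note D = pullbackD[OF pb]
  have ty: "Ident C a \<in> hom C a (Dom C f)" using f by (simp add: cat_simps)
  obtain r where r: "r \<in> hom C a (Dom C p)" "p \<cdot> r = Ident C a" "q \<cdot> r = Ident C a"
    using pullback_lift[OF pb refl ty ty] .
  show thesis
    by (rule that[OF pb _ _ D(9) r]) (use D f in \<open>simp_all add: cat_simps\<close>)
qed

text \<open>A regular epimorphism is the cokernel of its kernel. The kernel pair of \<open>e\<close> is generated by the
  diagonal and the pairs \<open>(0, y)\<close> with \<open>y\<close> in the kernel of \<open>e\<close>; if \<open>g\<close> vanishes on this kernel, it
  identifies the two components of all of these, hence of all pairs.\<close>

lemma regular_epi_cokernel:
  assumes e: "regular_epi C e" and eh: "e \<in> hom C X Y" and g: "g \<in> hom C X Z"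
    and ker: "\<And>T t. t \<in> hom C T X \<Longrightarrow> e \<cdot> t = zero_arr T Y \<Longrightarrow> g \<cdot> t = zero_arr T Z"
  obtains h where "h \<in> hom C Y Z" "h \<cdot> e = g"
proof -
  obtain R p q r where pb: "is_pullback C e e p q" and pq: "p \<in> hom C R X" "q \<in> hom C R X" "e \<cdot> p = e \<cdot> q"
    and r: "r \<in> hom C X R" "p \<cdot> r = Ident C X" "q \<cdot> r = Ident C X"
    using kernel_pair_exists[OF eh] .
  have "g \<cdot> p \<in> hom C R Z" "g \<cdot> q \<in> hom C R Z" using g pq by (simp_all add: cat_simps)
  then obtain m where m: "m \<in> Sub C R" "\<And>T t. t \<in> hom C T R \<Longrightarrow> t \<lesssim> m \<longleftrightarrow> (g \<cdot> p) \<cdot> t = (g \<cdot> q) \<cdot> t"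
    by (rule equalizer_subobject) blast
  have "Ident C R \<lesssim> m"
  proof (rule split_extension_generated[OF pq(1) r(1,2) m(1)])
    show "r \<lesssim> m" using m(2)[OF r(1)] r pq g by (simp add: cat_simps)
    fix T t assume t: "t \<in> hom C T R" "p \<cdot> t = zero_arr T X"
    have "e \<cdot> (p \<cdot> t) = e \<cdot> (q \<cdot> t)" using t(1) pq(1,2) eh pq(3)[THEN comp_subst] by (simp add: cat_simps)
    then have "e \<cdot> (q \<cdot> t) = zero_arr T Y" using t eh by (simp add: pointed_simps)
    then have "g \<cdot> (q \<cdot> t) = zero_arr T Z" by (rule ker[rotated]) (use t pq in \<open>simp add: cat_simps\<close>)
    then show "t \<lesssim> m" using m(2)[OF t(1)] t pq g by (simp add: pointed_simps)
  qed
  then have gpq: "g \<cdot> p = g \<cdot> q"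
    using m(2)[of "Ident C R" R] pq g by (simp add: cat_simps)
  obtain u v where ce: "is_coequalizer C u v e" using e by (auto simp: regular_epi_def)
  note E = coequalizerD[OF ce]
  have uv: "u \<in> hom C (Dom C u) (Dom C e)" "v \<in> hom C (Dom C u) (Dom C e)"
    using E eh by (simp_all add: cat_simps)
  obtain w where w: "w \<in> hom C (Dom C u) (Dom C p)" "p \<cdot> w = u" "q \<cdot> w = v"
    using pullback_lift[OF pb E(7) uv] .
  have "g \<cdot> (p \<cdot> w) = g \<cdot> (q \<cdot> w)" using w(1) pq(1,2) g gpq[THEN comp_subst] by (simp add: cat_simps)
  then have gu: "g \<cdot> u = g \<cdot> v" using w by simp
  have "g \<in> hom C (Cod C u) Z" using g E eh by (simp add: hom_iff)
  then obtain h where "h \<in> hom C (Cod C e) Z" "h \<cdot> e = g" using coequalizer_desc[OF ce gu] by blast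
  moreover have "Cod C e = Y" using eh by (simp add: hom_iff)
  ultimately show thesis using that by simp
qed

end

section \<open>Reflexive relations, normal closures and images of normal subobjects\<close>

context semi_abelian_cat
begin

text \<open>Protomodular categories are Mal'tsev categories. Write \<open>x S y\<close> for membership in the relation.
  For symmetry, the triples with \<open>x S y\<close> and \<open>u S y\<close> form a split extension over \<open>S\<close> with section
  \<open>u = x\<close>; those with \<open>u S x\<close> contain the section by reflexivity, and the kernel because there
  \<open>x = y = 0\<close>. So \<open>x S y\<close> and \<open>u S y\<close> always imply \<open>u S x\<close>, and \<open>u = y\<close> gives symmetry.
  Transitivity results in the same way from the triples with \<open>x S y\<close> and \<open>y S z\<close>, with section
  \<open>z = y\<close>.\<close>

lemma reflexive_relation_equivalence:
  assumes jm: "jointly_monic d e" and d: "d \<in> hom C S Y" and e: "e \<in> hom C S Y"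
    and r: "r \<in> hom C Y S" "d \<cdot> r = Ident C Y" "e \<cdot> r = Ident C Y"
  shows "equivalence_relation C d e"
proof -
  have ob: "Y \<in> Ob C" "S \<in> Ob C" using d by (simp_all add: hom_iff)
  obtain P p q s where pb: "is_pullback C e e p q" and pq: "p \<in> hom C P S" "q \<in> hom C P S" "e \<cdot> p = e \<cdot> q"
    and s: "s \<in> hom C S P" "p \<cdot> s = Ident C S" "q \<cdot> s = Ident C S"
    using kernel_pair_exists[OF e] .
  have dq: "d \<cdot> q \<in> hom C P Y" and dp: "d \<cdot> p \<in> hom C P Y" using d pq by (simp_all add: cat_simps)
  obtain n where n: "n \<in> Sub C P"
    "\<And>T t. t \<in> hom C T P \<Longrightarrow> t \<lesssim> n \<longleftrightarrow> related d e ((d \<cdot> q) \<cdot> t) ((d \<cdot> p) \<cdot> t)"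
    using relation_subobject[OF jm d e dq dp] by blast
  have all: "Ident C P \<lesssim> n"
  proof (rule split_extension_generated[OF pq(1) s(1,2) n(1)])
    have "related d e d d"
      by (rule relatedI[of d "r \<cdot> d"]) (use r d e r(2,3)[THEN comp_subst] in \<open>simp_all add: cat_simps\<close>)
    then show "s \<lesssim> n" using n(2)[OF s(1)] s pq d by (simp add: cat_simps)
    fix T t assume t: "t \<in> hom C T P" "p \<cdot> t = zero_arr T S"
    have "e \<cdot> (p \<cdot> t) = e \<cdot> (q \<cdot> t)" using t(1) pq(1,2) e pq(3)[THEN comp_subst] by (simp add: cat_simps)
    then have "related d e (d \<cdot> (q \<cdot> t)) (d \<cdot> (p \<cdot> t))"
      by (intro relatedI[of d "q \<cdot> t"]) (use t pq(1,2) d e ob in \<open>simp_all add: pointed_simps\<close>)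
    then show "t \<lesssim> n" using n(2)[OF t(1)] t(1) pq d by (simp add: cat_simps)
  qed
  have sym: "\<exists>w\<in>hom C S S. d \<cdot> w = e \<and> e \<cdot> w = d"
  proof -
    have ty: "Ident C S \<in> hom C S (Dom C e)" "r \<cdot> e \<in> hom C S (Dom C e)" "e \<cdot> Ident C S = e \<cdot> (r \<cdot> e)"
      using e r r(3)[THEN comp_subst] by (simp_all add: cat_simps)
    obtain w where w: "w \<in> hom C S (Dom C p)" "p \<cdot> w = Ident C S" "q \<cdot> w = r \<cdot> e"
      using pullback_lift[OF pb ty(3) ty(1,2)] .
    have w': "w \<in> hom C S P" using w(1) pq(1) by (simp add: hom_iff)
    have "w \<lesssim> n" by (rule factors_of_Ident[OF all _ w']) (use SubD[OF n(1)] in simp)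
    then have "related d e ((d \<cdot> q) \<cdot> w) ((d \<cdot> p) \<cdot> w)" using n(2)[OF w'] by blast
    then have "related d e e d" using w w' d e r pq r(2)[THEN comp_subst] by (simp add: cat_simps)
    then show ?thesis using d e by (auto simp: related_def hom_def)
  qed
  have trans: "\<exists>t\<in>hom C (Dom C p) (Dom C d). d \<cdot> t = d \<cdot> p \<and> e \<cdot> t = e \<cdot> q"
    if pb: "is_pullback C e d p q" for p q
  proof -
    note D = pullbackD[OF pb]
    have p: "p \<in> hom C (Dom C p) S" and q: "q \<in> hom C (Dom C p) S" using D d e by (simp_all add: cat_simps)
    have ty: "Ident C S \<in> hom C S (Dom C e)" "r \<cdot> e \<in> hom C S (Dom C d)" "e \<cdot> Ident C S = d \<cdot> (r \<cdot> e)"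
      using e d r r(2)[THEN comp_subst] by (simp_all add: cat_simps)
    obtain l where l: "l \<in> hom C S (Dom C p)" "p \<cdot> l = Ident C S" "q \<cdot> l = r \<cdot> e"
      using pullback_lift[OF pb ty(3) ty(1,2)] .
    have dp: "d \<cdot> p \<in> hom C (Dom C p) Y" and eq: "e \<cdot> q \<in> hom C (Dom C p) Y"
      using d e p q by (simp_all add: cat_simps)
    obtain n where n: "n \<in> Sub C (Dom C p)"
      "\<And>T t. t \<in> hom C T (Dom C p) \<Longrightarrow> t \<lesssim> n \<longleftrightarrow> related d e ((d \<cdot> p) \<cdot> t) ((e \<cdot> q) \<cdot> t)"
      using relation_subobject[OF jm d e dp eq] by blast
    have "Ident C (Dom C p) \<lesssim> n"
    proof (rule split_extension_generated[OF p l(1,2) n(1)])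
      have "related d e d e"
        by (rule relatedI[of d "Ident C S"]) (use d e in \<open>simp_all add: cat_simps\<close>)
      then show "l \<lesssim> n" using n(2)[OF l(1)] l p q d e r r(3)[THEN comp_subst] by (simp add: cat_simps)
      fix T t assume t: "t \<in> hom C T (Dom C p)" "p \<cdot> t = zero_arr T S"
      have "e \<cdot> (p \<cdot> t) = d \<cdot> (q \<cdot> t)" using t(1) p q d e D(9)[THEN comp_subst] by (simp add: cat_simps)
      then have "related d e (d \<cdot> (p \<cdot> t)) (e \<cdot> (q \<cdot> t))"
        by (intro relatedI[of d "q \<cdot> t"]) (use t p q d e ob in \<open>simp_all add: pointed_simps\<close>)
      then show "t \<lesssim> n" using n(2)[OF t(1)] t(1) p q d e by (simp add: cat_simps)
    qed
    then have "related d e ((d \<cdot> p) \<cdot> Ident C (Dom C p)) ((e \<cdot> q) \<cdot> Ident C (Dom C p))"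
      using n(2)[of "Ident C (Dom C p)" "Dom C p"] p by (simp add: cat_simps)
    then have "related d e (d \<cdot> p) (e \<cdot> q)" using p q d e by (simp add: cat_simps)
    then obtain h where "h \<in> hom C (Dom C (d \<cdot> p)) (Dom C d)" "d \<cdot> h = d \<cdot> p" "e \<cdot> h = e \<cdot> q"
      by (rule relatedE)
    moreover have "Dom C (d \<cdot> p) = Dom C p" using d p by (simp add: cat_simps)
    ultimately show ?thesis by auto
  qed
  have D: "d \<in> Arr C" "Dom C d = S" "Cod C d = Y" using d by (simp_all add: hom_iff)
  have "u = v" if "u \<in> hom C a S" "v \<in> hom C a S" "d \<cdot> u = d \<cdot> v \<and> e \<cdot> u = e \<cdot> v" for a u v
    using jointly_monicD[OF jm, of u v a] that D by simp
  then show ?thesis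
    unfolding equivalence_relation_def D using D(1) e sym r trans[unfolded D] by blast
qed

lemma reflexive_relation_effective:
  assumes "jointly_monic d e" and d: "d \<in> hom C S Y" and "e \<in> hom C S Y"
    and "r \<in> hom C Y S" "d \<cdot> r = Ident C Y" "e \<cdot> r = Ident C Y"
  obtains Q f where "f \<in> hom C Y Q" "is_pullback C f f d e"
proof -
  obtain f where f: "is_pullback C f f d e"
    using semi_abelian reflexive_relation_equivalence[OF assms] unfolding semi_abelian_def barr_exact_def by blast
  note D = pullbackD[OF f]
  have "Dom C f = Y" using D d by (simp add: hom_iff)
  then show thesis using that[OF _ f, of "Cod C f"] arr_hom[OF D(1)] by simp
qed

lemma image_relation:
  assumes u: "u \<in> hom C D Y" and v: "v \<in> hom C D Y"
  obtains S d e c where "jointly_monic d e" "d \<in> hom C S Y" "e \<in> hom C S Y"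
    "regular_epi C c" "c \<in> hom C D S" "d \<cdot> c = u" "e \<cdot> c = v"
proof -
  have Y: "Y \<in> Ob C" using u by (simp add: hom_iff)
  obtain p q where pq: "is_product C Y Y p q" using product_exists[OF Y Y] .
  note P = productD[OF pq]
  obtain g where g: "g \<in> hom C D (Dom C p)" "p \<cdot> g = u" "q \<cdot> g = v" using product_lift[OF pq u v] .
  obtain S m c where m: "is_mono C m" "m \<in> hom C S (Dom C p)" and c: "regular_epi C c" "c \<in> hom C D S"
    and mc: "m \<cdot> c = g"
    using image_factorization[OF g(1)] .
  have "jointly_monic (p \<cdot> m) (q \<cdot> m)"
    unfolding jointly_monic_def
  proof (intro allI impI)
    fix T a b assume ab: "a \<in> hom C T (Dom C (p \<cdot> m))" "b \<in> hom C T (Dom C (p \<cdot> m))"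
      "(p \<cdot> m) \<cdot> a = (p \<cdot> m) \<cdot> b" "(q \<cdot> m) \<cdot> a = (q \<cdot> m) \<cdot> b"
    have "m \<cdot> a = m \<cdot> b"
      by (rule jointly_monicD[OF product_jointly_monic[OF pq], of _ _ T])
        (use ab P m(2) in \<open>simp_all add: cat_simps\<close>)
    then show "a = b"
      by (rule mono_cancel[OF m(1), of _ _ T]) (use ab P m(2) in \<open>simp_all add: cat_simps\<close>)
  qed
  then show thesis
    by (rule that[OF _ _ _ c]) (use P m(2) c(2) mc g in \<open>simp_all add: cat_simps\<close>)
qed

text \<open>The relation generated by the diagonal and the pairs \<open>(t, 0)\<close> is reflexive, so it is the kernel
  pair of some \<open>f\<close>, and the normal closure of \<open>t\<close> is the kernel of \<open>f\<close>. It is the smallest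
  one because an arrow that vanishes on \<open>t\<close> identifies the components of the generating pairs.\<close>

lemma normal_closure_exists:
  assumes t: "t \<in> hom C A X"
  obtains n where "n \<in> NSub C X" "t \<lesssim> n" "\<And>n'. n' \<in> NSub C X \<Longrightarrow> t \<lesssim> n' \<Longrightarrow> n \<lesssim> n'"
proof -
  have ob: "A \<in> Ob C" "X \<in> Ob C" using t by (simp_all add: hom_iff)
  have z: "zero_arr A X \<in> hom C A X" and id: "Ident C X \<in> hom C X X" using ob zero_arr_hom Ident_hom by auto
  obtain i j where ij: "is_coproduct C A X i j" using coproduct_exists[OF ob] .
  note I = coproductD[OF ij]
  obtain u where u: "u \<in> hom C (Cod C i) X" "u \<cdot> i = t" "u \<cdot> j = Ident C X"
    using coproduct_desc[OF ij t id] .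
  obtain v where v: "v \<in> hom C (Cod C i) X" "v \<cdot> i = zero_arr A X" "v \<cdot> j = Ident C X"
    using coproduct_desc[OF ij z id] .
  obtain S d e c where S: "jointly_monic d e" "d \<in> hom C S X" "e \<in> hom C S X"
    and c: "regular_epi C c" "c \<in> hom C (Cod C i) S" "d \<cdot> c = u" "e \<cdot> c = v"
    using image_relation[OF u(1) v(1)] .
  have r: "c \<cdot> j \<in> hom C X S" "d \<cdot> (c \<cdot> j) = Ident C X" "e \<cdot> (c \<cdot> j) = Ident C X"
    using c I S u v c(3,4)[THEN comp_subst] by (simp_all add: cat_simps)
  obtain Q f where f: "f \<in> hom C X Q" and pb: "is_pullback C f f d e"
    using reflexive_relation_effective[OF S r] .
  obtain n where n: "is_kernel C f n" using kernel_exists[OF f] .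
  note N = SubD[OF kernelD(2)[OF n]]
  have nh: "n \<in> hom C (Dom C n) X" using N f by (simp add: cat_simps)
  show thesis
  proof (rule that[OF NSubI[OF n f]])
    have "f \<cdot> (d \<cdot> (c \<cdot> i)) = f \<cdot> (e \<cdot> (c \<cdot> i))"
      using pullbackD(9)[OF pb, THEN comp_subst] f S c(2) I by (simp add: cat_simps)
    then have "f \<cdot> t = zero_arr A Q"
      using c I S u v f ob c(3,4)[THEN comp_subst] by (simp add: pointed_simps)
    then show "t \<lesssim> n" using kernel_factors_iff[OF n, of t A] t f by (simp add: hom_iff)
    fix n' assume n': "n' \<in> NSub C X" "t \<lesssim> n'"
    obtain W g where g: "g \<in> hom C X W" and gk: "is_kernel C g n'" using n'(1) by (rule NSubE)
    have gt: "g \<cdot> t = zero_arr A W" using kernel_factors_iff[OF gk, of t A] n' t g by (simp add: hom_iff)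
    have guv: "g \<cdot> u = g \<cdot> v"
      by (rule coproduct_jointly_epic[OF ij, of _ _ W]) (use gt u v g ob I in \<open>simp_all add: pointed_simps\<close>)
    have gde: "g \<cdot> d = g \<cdot> e"
      by (rule regular_epi_cancel[OF c(1), of _ _ W]) (use guv c S g in \<open>simp_all add: cat_simps\<close>)
    have ty: "f \<cdot> n = f \<cdot> zero_arr (Dom C n) X" "n \<in> hom C (Dom C n) (Dom C f)" "zero_arr (Dom C n) X \<in> hom C (Dom C n) (Dom C f)"
      using kernelD(3)[OF n] f nh by (simp_all add: pointed_simps)
    obtain h where h: "h \<in> hom C (Dom C n) (Dom C d)" "d \<cdot> h = n" "e \<cdot> h = zero_arr (Dom C n) X"
      using pullback_lift[OF pb ty] .
    have "g \<cdot> (d \<cdot> h) = g \<cdot> (e \<cdot> h)" using gde[THEN comp_subst] g S h(1) by (simp add: cat_simps)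
    then have "g \<cdot> n = zero_arr (Dom C n) W" using h nh g by (simp add: pointed_simps)
    then show "n \<lesssim> n'" using kernel_factors_iff[OF gk, of n "Dom C n"] nh g by (simp add: hom_iff)
  qed
qed

text \<open>The regular epimorphic part of an arrow has the same kernel as that arrow.\<close>

lemma normal_quotient:
  assumes "n \<in> NSub C X"
  obtains Q q where "q \<in> hom C X Q" "regular_epi C q" "is_kernel C q n"
proof -
  obtain W f where f: "f \<in> hom C X W" "is_kernel C f n" using assms by (rule NSubE)
  obtain Q m q where m: "is_mono C m" "m \<in> hom C Q W" and q: "regular_epi C q" "q \<in> hom C X Q" and mq: "m \<cdot> q = f"
    using image_factorization[OF f(1)] .
  note K = kernelD[OF f(2)]
  have n: "n \<in> Sub C X" using NSub_imp_Sub[OF assms] .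
  note N = SubD[OF n]
  have eq: "f \<cdot> t = zero_arr T W \<longleftrightarrow> q \<cdot> t = zero_arr T Q" if t: "t \<in> hom C T X" for T t
  proof
    assume "f \<cdot> t = zero_arr T W"
    then have "m \<cdot> (q \<cdot> t) = m \<cdot> zero_arr T Q" using mq[THEN comp_subst] t m(2) q(2) by (simp add: pointed_simps)
    then show "q \<cdot> t = zero_arr T Q"
      by (rule mono_cancel[OF m(1), of _ _ T]) (use t m(2) q(2) in \<open>simp_all add: pointed_simps\<close>)
  next
    assume "q \<cdot> t = zero_arr T Q"
    then show "f \<cdot> t = zero_arr T W" unfolding mq[symmetric] using t m(2) q(2) by (simp add: pointed_simps)
  qed
  have "is_kernel C q n"
  proof (rule kernelI[OF q(2) n])
    have nh: "n \<in> hom C (Dom C n) X" using N by (simp add: cat_simps)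
    show "q \<cdot> n = zero_arr (Dom C n) Q" using eq[OF nh] K(3) f(1) by (simp add: hom_iff)
    fix T t assume t: "t \<in> hom C T X" "q \<cdot> t = zero_arr T Q"
    then show "t \<lesssim> n" using eq[OF t(1)] kernel_factors_iff[OF f(2), of t T] f(1) by (simp add: hom_iff)
  qed
  then show thesis using that q by blast
qed

text \<open>Let \<open>n\<close> be the kernel of \<open>q\<close>. The image under \<open>e\<close> of the kernel pair \<open>R\<close> of \<open>q\<close> is a reflexive
  relation \<open>S\<close> on \<open>Y\<close>, hence the kernel pair of some \<open>f\<close>, and \<open>m\<close> turns out to be the kernel of
  \<open>f\<close>. If \<open>f y = 0\<close>, then \<open>(0, y)\<close> lies in \<open>S\<close>, and one needs a lift of this pair to \<open>R\<close> whose first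
  component is zero. It exists, after passing to a cover, because \<open>R \<rightarrow> X \<times>\<^sub>Y S\<close> is a regular
  epimorphism.\<close>

lemma regular_image_normal:
  assumes e: "regular_epi C e" "e \<in> hom C X Y" and n: "n \<in> NSub C X"
    and m: "is_mono C m" "m \<in> hom C M Y" and c: "regular_epi C c" "c \<in> hom C (Dom C n) M" "m \<cdot> c = e \<cdot> n"
  shows "m \<in> NSub C Y"
proof -
  obtain Q q where q: "q \<in> hom C X Q" and qn: "is_kernel C q n" using n by (rule NSubE)
  have nS: "n \<in> Sub C X" using NSub_imp_Sub[OF n] .
  note N = SubD[OF nS]
  have nh: "n \<in> hom C (Dom C n) X" using N by (simp add: cat_simps)
  have ob: "X \<in> Ob C" "Y \<in> Ob C" "Q \<in> Ob C" using e q by (simp_all add: hom_iff)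
  obtain R p1 p2 \<delta> where pb: "is_pullback C q q p1 p2"
    and p: "p1 \<in> hom C R X" "p2 \<in> hom C R X" "q \<cdot> p1 = q \<cdot> p2"
    and \<delta>: "\<delta> \<in> hom C X R" "p1 \<cdot> \<delta> = Ident C X" "p2 \<cdot> \<delta> = Ident C X"
    using kernel_pair_exists[OF q] .
  have ep: "e \<cdot> p1 \<in> hom C R Y" "e \<cdot> p2 \<in> hom C R Y" using e p by (simp_all add: cat_simps)
  obtain S d d' s where S: "jointly_monic d d'" "d \<in> hom C S Y" "d' \<in> hom C S Y"
    and s: "regular_epi C s" "s \<in> hom C R S" "d \<cdot> s = e \<cdot> p1" "d' \<cdot> s = e \<cdot> p2"
    using image_relation[OF ep] .
  have id: "Ident C Y \<in> hom C Y Y" using ob Ident_hom by blast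
  obtain T where T: "T \<in> Sub C Y"
    "\<And>U t. t \<in> hom C U Y \<Longrightarrow> t \<lesssim> T \<longleftrightarrow> related d d' (Ident C Y \<cdot> t) (Ident C Y \<cdot> t)"
    using relation_subobject[OF S id id] by blast
  \<comment> \<open>The diagonal of \<open>Y\<close> lies in \<open>S\<close>, since it does so after composition with the cover \<open>e\<close>.\<close>
  have "related d d' e e"
    by (rule relatedI[of d "s \<cdot> \<delta>"])
      (use S s e \<delta> p s(3,4)[THEN comp_subst] in \<open>simp_all add: cat_simps\<close>)
  then have "e \<lesssim> T" using T(2)[OF e(2)] e by (simp add: cat_simps)
  then have "Ident C (Cod C e) \<lesssim> T"
    by (intro regular_epi_extremal[OF e(1)]) (use SubD[OF T(1)] e in \<open>simp_all add: hom_iff\<close>)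
  then have "related d d' (Ident C Y) (Ident C Y)" using T(2)[OF id] id e by (simp add: cat_simps)
  then obtain r where "r \<in> hom C (Dom C (Ident C Y)) (Dom C d)" "d \<cdot> r = Ident C Y" "d' \<cdot> r = Ident C Y"
    by (rule relatedE)
  then have r: "r \<in> hom C Y S" "d \<cdot> r = Ident C Y" "d' \<cdot> r = Ident C Y"
    using S ob by (simp_all add: cat_simps)
  obtain W f where f: "f \<in> hom C Y W" and fpb: "is_pullback C f f d d'"
    using reflexive_relation_effective[OF S r] .
  note F = pullbackD[OF fpb]
  have fm: "f \<cdot> m = zero_arr M W"
  proof (rule regular_epi_cancel[OF c(1), of _ _ W])
    have ty: "q \<cdot> n = q \<cdot> zero_arr (Dom C n) X" "n \<in> hom C (Dom C n) (Dom C q)" "zero_arr (Dom C n) X \<in> hom C (Dom C n) (Dom C q)"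
      using kernelD(3)[OF qn] q nh by (simp_all add: pointed_simps)
    obtain h where h: "h \<in> hom C (Dom C n) (Dom C p1)" "p1 \<cdot> h = n" "p2 \<cdot> h = zero_arr (Dom C n) X"
      using pullback_lift[OF pb ty] .
    have "f \<cdot> (d \<cdot> (s \<cdot> h)) = f \<cdot> (d' \<cdot> (s \<cdot> h))"
      using F(9)[THEN comp_subst] f S s(2) h(1) p by (simp add: cat_simps)
    then have "f \<cdot> (e \<cdot> n) = zero_arr (Dom C n) W"
      using f S s h p e nh ob s(3,4)[THEN comp_subst] by (simp add: pointed_simps)
    then show "(f \<cdot> m) \<cdot> c = zero_arr M W \<cdot> c" using c f m(2) by (simp add: pointed_simps)
  qed (use f m(2) c(2) in \<open>simp_all add: pointed_simps\<close>)
  obtain P1 P2 where Ppb: "is_pullback C e d P1 P2" using pullback_exists[OF e(2) S(2)] .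
  note PD = pullbackD[OF Ppb]
  have Ph: "P1 \<in> hom C (Dom C P1) X" "P2 \<in> hom C (Dom C P1) S" using PD e S by (simp_all add: cat_simps)
  have ty: "e \<cdot> p1 = d \<cdot> s" "p1 \<in> hom C R (Dom C e)" "s \<in> hom C R (Dom C d)"
    using e p s S by (simp_all add: hom_iff)
  obtain \<theta> where \<theta>: "\<theta> \<in> hom C R (Dom C P1)" "P1 \<cdot> \<theta> = p1" "P2 \<cdot> \<theta> = s"
    using pullback_lift[OF Ppb ty] .
  \<comment> \<open>The projection \<open>P2\<close> is a regular epimorphism on the image of \<open>\<theta>\<close>, and its kernel consists of
    pairs \<open>(x, 0)\<close> with \<open>e x = 0\<close>, each of which is the image of the pair \<open>(x, x)\<close> in \<open>R\<close>.\<close>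
  have \<theta>reg: "regular_epi C \<theta>"
  proof (rule regular_epiI[OF \<theta>(1)])
    fix i assume i: "i \<in> Sub C (Dom C P1)" "\<theta> \<lesssim> i"
    note I = SubD[OF i(1)]
    show "Ident C (Dom C P1) \<lesssim> i"
    proof (rule regular_extension_generated[OF Ph(2) i(1)])
      obtain h where h: "h \<in> hom C (Dom C \<theta>) (Dom C i)" "i \<cdot> h = \<theta>" using i(2) by (rule factorsE)
      have h': "h \<in> hom C R (Dom C i)" using h(1) \<theta>(1) by (simp add: hom_iff)
      have "(P2 \<cdot> i) \<cdot> h = s" using h h' \<theta> I Ph by (simp add: cat_simps)
      then show "regular_epi C (P2 \<cdot> i)"
        using regular_epi_left_factor[of "P2 \<cdot> i" h R "Dom C i" S] s(1) h' I Ph by (simp add: cat_simps)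
      fix U t assume t: "t \<in> hom C U (Dom C P1)" "P2 \<cdot> t = zero_arr U S"
      have Sob: "S \<in> Ob C" "U \<in> Ob C" using s t by (simp_all add: hom_iff)
      have "e \<cdot> (P1 \<cdot> t) = d \<cdot> (P2 \<cdot> t)" using PD(9)[THEN comp_subst] t(1) Ph e S by (simp add: cat_simps)
      then have et: "e \<cdot> (P1 \<cdot> t) = zero_arr U Y" using t S Sob by (simp add: pointed_simps)
      have s0: "s \<cdot> (\<delta> \<cdot> (P1 \<cdot> t)) = zero_arr U S"
        by (rule jointly_monicD[OF S(1), of _ _ U])
          (use S s t(1) et Ph \<delta> p e Sob s(3,4)[THEN comp_subst] \<delta>(2,3)[THEN comp_subst] in
            \<open>simp_all add: pointed_simps\<close>)
      have "t = \<theta> \<cdot> (\<delta> \<cdot> (P1 \<cdot> t))"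
        by (rule jointly_monicD[OF pullback_jointly_monic[OF Ppb], of _ _ U])
          (use s0 t Ph \<theta> \<delta> p \<theta>(2,3)[THEN comp_subst] \<delta>(2)[THEN comp_subst] in \<open>simp_all add: pointed_simps\<close>)
      moreover have "\<theta> \<cdot> (\<delta> \<cdot> (P1 \<cdot> t)) \<lesssim> i"
        by (rule factors_comp[OF i(2)]) (use \<theta>(1) \<delta>(1) Ph t(1) I in \<open>simp_all add: cat_simps\<close>)
      ultimately show "t \<lesssim> i" by simp
    qed
  qed
  have "is_kernel C f m"
  proof (rule kernelI[OF f])
    show "m \<in> Sub C Y" "f \<cdot> m = zero_arr (Dom C m) W" using m fm by (simp_all add: Sub_def hom_iff)
    fix U y assume y: "y \<in> hom C U Y" "f \<cdot> y = zero_arr U W"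
    have U: "U \<in> Ob C" using y by (simp add: hom_iff)
    have ty: "f \<cdot> zero_arr U Y = f \<cdot> y" "zero_arr U Y \<in> hom C U (Dom C f)" "y \<in> hom C U (Dom C f)"
      using f y by (simp_all add: pointed_simps)
    obtain h where h: "h \<in> hom C U (Dom C d)" "d \<cdot> h = zero_arr U Y" "d' \<cdot> h = y"
      using pullback_lift[OF fpb ty] .
    have ty: "e \<cdot> zero_arr U X = d \<cdot> h" "zero_arr U X \<in> hom C U (Dom C e)" "h \<in> hom C U (Dom C d)"
      using h e U ob by (simp_all add: pointed_simps)
    obtain z where z: "z \<in> hom C U (Dom C P1)" "P1 \<cdot> z = zero_arr U X" "P2 \<cdot> z = h"
      using pullback_lift[OF Ppb ty] .
    have "z \<in> hom C U (Cod C \<theta>)" using z \<theta> by (simp add: hom_iff)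
    then obtain B \<alpha> \<beta> where ab: "regular_epi C \<alpha>" "\<alpha> \<in> hom C B U" "\<beta> \<in> hom C B (Dom C \<theta>)" "\<theta> \<cdot> \<beta> = z \<cdot> \<alpha>"
      using cover_lift[OF \<theta>reg] by blast
    have \<beta>: "\<beta> \<in> hom C B R" and B: "B \<in> Ob C" using ab(3) \<theta> by (simp_all add: hom_iff)
    have "P1 \<cdot> (\<theta> \<cdot> \<beta>) = P1 \<cdot> (z \<cdot> \<alpha>)" "P2 \<cdot> (\<theta> \<cdot> \<beta>) = P2 \<cdot> (z \<cdot> \<alpha>)" using ab(4) by simp_all
    then have 1: "p1 \<cdot> \<beta> = zero_arr B X" and 2: "s \<cdot> \<beta> = h \<cdot> \<alpha>"
      using \<theta> z \<beta> ab(2) Ph ob U \<theta>(2,3)[THEN comp_subst] z(2,3)[THEN comp_subst]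
      by (simp_all add: pointed_simps)
    have "q \<cdot> (p1 \<cdot> \<beta>) = q \<cdot> (p2 \<cdot> \<beta>)" using p(3)[THEN comp_subst] p(1,2) q \<beta> by (simp add: cat_simps)
    then have "q \<cdot> (p2 \<cdot> \<beta>) = zero_arr B Q" using 1 q B by (simp add: pointed_simps)
    then have "p2 \<cdot> \<beta> \<lesssim> n"
      using kernel_factors_iff[OF qn, of "p2 \<cdot> \<beta>" B] p \<beta> q by (simp add: cat_simps)
    then obtain \<gamma> where \<gamma>0: "\<gamma> \<in> hom C (Dom C (p2 \<cdot> \<beta>)) (Dom C n)" "n \<cdot> \<gamma> = p2 \<cdot> \<beta>" by (rule factorsE)
    then have \<gamma>: "\<gamma> \<in> hom C B (Dom C n)" using p \<beta> by (simp add: cat_simps)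
    have "d' \<cdot> (s \<cdot> \<beta>) = d' \<cdot> (h \<cdot> \<alpha>)" using 2 by simp
    then have "e \<cdot> (p2 \<cdot> \<beta>) = y \<cdot> \<alpha>"
      using S s(2) \<beta> h ab(2) e p y(1) s(4)[THEN comp_subst] h(3)[THEN comp_subst] by (simp add: cat_simps)
    then have "m \<cdot> (c \<cdot> \<gamma>) = y \<cdot> \<alpha>"
      using c(3)[THEN comp_subst] \<gamma> \<gamma>0(2) c(2) m(2) e nh by (simp add: cat_simps)
    then have ym: "y \<cdot> \<alpha> \<lesssim> m" by (rule factorsI) (use \<gamma> c(2) m(2) ab y in \<open>simp add: cat_simps\<close>)
    show "y \<lesssim> m"
      by (rule regular_epi_factors_local[OF ab(1) m(1)]) (use ym ab(2) y m(2) in \<open>simp_all add: hom_iff\<close>)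
  qed
  then show ?thesis using NSubI f by blast
qed

text \<open>Divide by \<open>k\<close>, take the image of \<open>l\<close>, which is normal, and let \<open>j\<close> be its inverse image. A
  subobject \<open>n\<close> that contains \<open>k\<close> and \<open>l\<close> contains the kernel of \<open>j \<rightarrow> q(l)\<close> and still maps onto
  \<open>q(l)\<close>; so it contains all of \<open>j\<close>.\<close>

lemma join_of_normal_exists:
  assumes k: "k \<in> NSub C X" and l: "l \<in> NSub C X"
  obtains j where "j \<in> NSub C X" "is_join C k l j"
proof -
  obtain Q q where q: "q \<in> hom C X Q" "regular_epi C q" "is_kernel C q k" using normal_quotient[OF k] .
  note K = SubD[OF NSub_imp_Sub[OF k]] and L = SubD[OF NSub_imp_Sub[OF l]]
  have kh: "k \<in> hom C (Dom C k) X" and lh: "l \<in> hom C (Dom C l) X" using K L by (simp_all add: cat_simps)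
  have ql: "q \<cdot> l \<in> hom C (Dom C l) Q" using q lh by (simp add: cat_simps)
  obtain M m c where m: "is_mono C m" "m \<in> hom C M Q" and c: "regular_epi C c" "c \<in> hom C (Dom C l) M"
    and mc: "m \<cdot> c = q \<cdot> l"
    using image_factorization[OF ql] .
  have mN: "m \<in> NSub C Q" by (rule regular_image_normal[OF q(2,1) l m c mc])
  have mS: "m \<in> Sub C Q" using NSub_imp_Sub[OF mN] .
  obtain j where j: "j \<in> Sub C X" "\<And>T t. t \<in> hom C T X \<Longrightarrow> t \<lesssim> j \<longleftrightarrow> q \<cdot> t \<lesssim> m"
    using inverse_image[OF mS q(1)] by blast
  have jN: "j \<in> NSub C X" using inverse_image_NSub[OF mN j(1) q(1) j(2)] .
  note J = SubD[OF j(1)]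
  have jh: "j \<in> hom C (Dom C j) X" using J by (simp add: cat_simps)
  have ob: "M \<in> Ob C" "Dom C k \<in> Ob C" using m(2) kh by (simp_all add: hom_iff)
  have "zero_arr (Dom C k) Q \<lesssim> m"
    by (rule factorsI[of m "zero_arr (Dom C k) M"]) (use m(2) ob in \<open>simp_all add: pointed_simps\<close>)
  moreover have "q \<cdot> k = zero_arr (Dom C k) Q" using kernelD(3)[OF q(3)] q(1) by (simp add: hom_iff)
  ultimately have kj: "k \<lesssim> j" using j(2)[OF kh] by simp
  have "q \<cdot> l \<lesssim> m" by (rule factorsI[OF mc]) (use c m ql in \<open>simp add: hom_iff\<close>)
  then have lj: "l \<lesssim> j" using j(2)[OF lh] by simp
  have "j \<lesssim> n" if n: "n \<in> Sub C X" "k \<lesssim> n" "l \<lesssim> n" for n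
  proof -
    note N = SubD[OF n(1)]
    have "q \<cdot> j \<lesssim> m" using j(2)[OF jh] factors_refl J by blast
    then obtain g where "g \<in> hom C (Dom C (q \<cdot> j)) (Dom C m)" "m \<cdot> g = q \<cdot> j" by (rule factorsE)
    then have g: "g \<in> hom C (Dom C j) M" "m \<cdot> g = q \<cdot> j" using q(1) jh m(2) by (simp_all add: cat_simps)
    obtain i where i: "i \<in> Sub C (Dom C j)" "\<And>T t. t \<in> hom C T (Dom C j) \<Longrightarrow> t \<lesssim> i \<longleftrightarrow> j \<cdot> t \<lesssim> n"
      using inverse_image[OF n(1) jh] by blast
    note I = SubD[OF i(1)]
    have "Ident C (Dom C j) \<lesssim> i"
    proof (rule regular_extension_generated[OF g(1) i(1)])
      obtain l' where l': "l' \<in> hom C (Dom C l) (Dom C j)" "j \<cdot> l' = l" using lj by (rule factorsE)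
      have "l' \<lesssim> i" using i(2)[OF l'(1)] l'(2) n(3) by simp
      then obtain h where "h \<in> hom C (Dom C l') (Dom C i)" "i \<cdot> h = l'" by (rule factorsE)
      then have h: "h \<in> hom C (Dom C l) (Dom C i)" "i \<cdot> h = l'" using l' by (simp_all add: hom_iff)
      have "m \<cdot> (g \<cdot> l') = m \<cdot> c"
        using g l' mc m(2) c(2) q(1) jh g(2)[THEN comp_subst] by (simp add: cat_simps)
      then have "g \<cdot> l' = c"
        by (rule mono_cancel[OF m(1), of _ _ "Dom C l"]) (use g l' m(2) c(2) in \<open>simp_all add: cat_simps\<close>)
      then have "(g \<cdot> i) \<cdot> h = c" using h g(1) I by (simp add: cat_simps)
      then show "regular_epi C (g \<cdot> i)"
        using regular_epi_left_factor[of "g \<cdot> i" h "Dom C l" "Dom C i" M] c(1) h g(1) I by (simp add: cat_simps)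
      fix T t assume t: "t \<in> hom C T (Dom C j)" "g \<cdot> t = zero_arr T M"
      have "q \<cdot> (j \<cdot> t) = m \<cdot> (g \<cdot> t)"
        using g t(1) m(2) q(1) jh g(2)[THEN comp_subst] by (simp add: cat_simps)
      then have "q \<cdot> (j \<cdot> t) = zero_arr T Q" using t m(2) by (simp add: pointed_simps)
      then have "j \<cdot> t \<lesssim> k"
        using kernel_factors_iff[OF q(3), of "j \<cdot> t" T] t(1) jh q(1) by (simp add: cat_simps)
      then have "j \<cdot> t \<lesssim> n" using n(2) N factors_trans by blast
      then show "t \<lesssim> i" using i(2)[OF t(1)] by blast
    qed
    then have "j \<cdot> Ident C (Dom C j) \<lesssim> n" using i(2)[of "Ident C (Dom C j)" "Dom C j"] jh by (simp add: cat_simps)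
    then show ?thesis using jh by (simp add: cat_simps)
  qed
  then have "is_join C k l j"
    unfolding is_join_def using j(1) kj lj K by simp
  then show thesis using that jN by blast
qed

end

section \<open>Higgins and Huq commutators\<close>

context semi_abelian_cat
begin

text \<open>Products are not chosen, so the ones occurring in the definitions of the Higgins commutator and
  of commuting arrows have to be compared.\<close>

lemma product_insertions_compare:
  assumes pr: "is_product_insertions C A B p q a b" and pr': "is_product_insertions C A B p' q' a' b'"
  obtains \<psi> where "\<psi> \<in> hom C (Dom C p) (Dom C p')" "\<psi> \<cdot> a = a'" "\<psi> \<cdot> b = b'"
proof -
  note I = product_insertionsD[OF pr] and I' = product_insertionsD[OF pr']
  note D = productD[OF I(1)] and D' = productD[OF I'(1)]
  have ty: "p \<in> hom C (Dom C p) A" "q \<in> hom C (Dom C p) B" using D by (simp_all add: cat_simps)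
  obtain \<psi> where \<psi>: "\<psi> \<in> hom C (Dom C p) (Dom C p')" "p' \<cdot> \<psi> = p" "q' \<cdot> \<psi> = q"
    using product_lift[OF I'(1) ty] .
  have a: "\<psi> \<cdot> a = a'"
    by (rule jointly_monicD[OF product_jointly_monic[OF I'(1)], of _ _ A])
      (use \<psi> I I' D' \<psi>(2,3)[THEN comp_subst] in \<open>simp_all add: pointed_simps\<close>)
  have b: "\<psi> \<cdot> b = b'"
    by (rule jointly_monicD[OF product_jointly_monic[OF I'(1)], of _ _ B])
      (use \<psi> I I' D' \<psi>(2,3)[THEN comp_subst] in \<open>simp_all add: pointed_simps\<close>)
  show thesis using that[OF \<psi>(1) a b] .
qed

lemma higgins_dataE:
  assumes "is_higgins_commutator C k l m"
  obtains i j p q a b \<sigma> \<kappa> w e where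
    "is_coproduct C (Dom C k) (Dom C l) i j" "is_product_insertions C (Dom C k) (Dom C l) p q a b"
    "\<sigma> \<in> hom C (Cod C i) (Dom C p)" "\<sigma> \<cdot> i = a" "\<sigma> \<cdot> j = b" "is_kernel C \<sigma> \<kappa>"
    "w \<in> hom C (Cod C i) (Cod C k)" "w \<cdot> i = k" "w \<cdot> j = l"
    "is_mono C m" "e \<in> hom C (Dom C \<kappa>) (Dom C m)" "regular_epi C e" "m \<cdot> e = w \<cdot> \<kappa>"
    "\<kappa> \<in> hom C (Dom C \<kappa>) (Cod C i)" "m \<in> hom C (Dom C m) (Cod C k)"
proof -
  obtain i j p q a b \<sigma> \<kappa> w where H:
    "is_coproduct C (Dom C k) (Dom C l) i j" "is_product_insertions C (Dom C k) (Dom C l) p q a b"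
    "\<sigma> \<in> hom C (Cod C i) (Dom C p)" "\<sigma> \<cdot> i = a" "\<sigma> \<cdot> j = b" "is_kernel C \<sigma> \<kappa>"
    "w \<in> hom C (Cod C i) (Cod C k)" "w \<cdot> i = k" "w \<cdot> j = l"
    and im: "is_regular_image C (w \<cdot> \<kappa>) m"
    using assms unfolding is_higgins_commutator_def by blast
  have \<kappa>: "\<kappa> \<in> hom C (Dom C \<kappa>) (Cod C i)"
    using SubD[OF kernelD(2)[OF H(6)]] H(3) by (simp add: cat_simps)
  have D: "Dom C (w \<cdot> \<kappa>) = Dom C \<kappa>" "Cod C (w \<cdot> \<kappa>) = Cod C k" using \<kappa> H(7) by (simp_all add: cat_simps)
  obtain e where e: "is_mono C m" "e \<in> hom C (Dom C \<kappa>) (Dom C m)" "regular_epi C e" "m \<cdot> e = w \<cdot> \<kappa>"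
    using im unfolding is_regular_image_def D by blast
  have "Cod C (m \<cdot> e) = Cod C m" using mono_arr[OF e(1)] e(2) by (simp add: cat_simps)
  then have "m \<in> hom C (Dom C m) (Cod C k)"
    using arr_hom[OF mono_arr[OF e(1)]] D e(4) by simp
  then show thesis using that[OF H e \<kappa>] by blast
qed

lemma higgins_exists:
  assumes k: "k \<in> hom C K X" and l: "l \<in> hom C L X"
  obtains m where "is_higgins_commutator C k l m"
proof -
  have ob: "K \<in> Ob C" "L \<in> Ob C" using k l by (simp_all add: hom_iff)
  have D: "Dom C k = K" "Dom C l = L" "Cod C k = X" using k l by (simp_all add: hom_iff)
  obtain i j where ij: "is_coproduct C K L i j" using coproduct_exists[OF ob] .
  obtain p q a b where pr: "is_product_insertions C K L p q a b" using product_insertions_exist[OF ob] .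
  note P = product_insertionsD[OF pr]
  obtain \<sigma> where \<sigma>: "\<sigma> \<in> hom C (Cod C i) (Dom C p)" "\<sigma> \<cdot> i = a" "\<sigma> \<cdot> j = b"
    using coproduct_desc[OF ij P(2,3)] .
  obtain \<kappa> where \<kappa>: "is_kernel C \<sigma> \<kappa>" using kernel_exists[OF \<sigma>(1)] .
  obtain w where w: "w \<in> hom C (Cod C i) X" "w \<cdot> i = k" "w \<cdot> j = l"
    using coproduct_desc[OF ij k l] .
  have "w \<cdot> \<kappa> \<in> hom C (Dom C \<kappa>) X"
    using SubD[OF kernelD(2)[OF \<kappa>]] \<sigma>(1) w(1) by (simp add: cat_simps)
  then obtain I m c where m: "is_mono C m" "m \<in> hom C I X" "regular_epi C c" "c \<in> hom C (Dom C \<kappa>) I" "m \<cdot> c = w \<cdot> \<kappa>"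
    by (rule image_factorization)
  have "Dom C (w \<cdot> \<kappa>) = Dom C \<kappa>" "Dom C m = I"
    using SubD[OF kernelD(2)[OF \<kappa>]] \<sigma>(1) w(1) m(2) by (simp_all add: cat_simps)
  then have "is_regular_image C (w \<cdot> \<kappa>) m"
    unfolding is_regular_image_def using m by auto
  then have "is_higgins_commutator C k l m"
    unfolding is_higgins_commutator_def D using ij pr \<sigma> \<kappa> w by blast
  then show thesis by (rule that)
qed

text \<open>Membership in \<open>[K,L]\<close> can be tested in any coproduct and product of \<open>K\<close> and \<open>L\<close>, not only in those
  by which \<open>m\<close> was obtained. In particular, \<open>m\<close> is unique up to isomorphism.\<close>

lemma higgins_contains:
  assumes m: "is_higgins_commutator C k l m"
    and cp: "is_coproduct C (Dom C k) (Dom C l) i j"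
    and pr: "is_product_insertions C (Dom C k) (Dom C l) p q a b"
    and \<sigma>: "\<sigma> \<in> hom C (Cod C i) (Dom C p)" "\<sigma> \<cdot> i = a" "\<sigma> \<cdot> j = b"
    and w: "w \<in> hom C (Cod C i) (Cod C k)" "w \<cdot> i = k" "w \<cdot> j = l"
    and t: "t \<in> hom C T (Cod C i)" "\<sigma> \<cdot> t = zero_arr T (Dom C p)"
  shows "w \<cdot> t \<lesssim> m"
proof -
  obtain i' j' p' q' a' b' \<sigma>' \<kappa> w' e where H:
    "is_coproduct C (Dom C k) (Dom C l) i' j'" "is_product_insertions C (Dom C k) (Dom C l) p' q' a' b'"
    "\<sigma>' \<in> hom C (Cod C i') (Dom C p')" "\<sigma>' \<cdot> i' = a'" "\<sigma>' \<cdot> j' = b'" "is_kernel C \<sigma>' \<kappa>"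
    "w' \<in> hom C (Cod C i') (Cod C k)" "w' \<cdot> i' = k" "w' \<cdot> j' = l"
    "is_mono C m" "e \<in> hom C (Dom C \<kappa>) (Dom C m)" "regular_epi C e" "m \<cdot> e = w' \<cdot> \<kappa>"
    "\<kappa> \<in> hom C (Dom C \<kappa>) (Cod C i')" "m \<in> hom C (Dom C m) (Cod C k)"
    using m by (rule higgins_dataE)
  note I = coproductD[OF cp] and I' = coproductD[OF H(1)]
  have ty: "i' \<in> hom C (Dom C k) (Cod C i')" "j' \<in> hom C (Dom C l) (Cod C i')"
    using I' by (simp_all add: cat_simps)
  obtain \<phi> where \<phi>: "\<phi> \<in> hom C (Cod C i) (Cod C i')" "\<phi> \<cdot> i = i'" "\<phi> \<cdot> j = j'"
    using coproduct_desc[OF cp ty] .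
  obtain \<psi> where \<psi>: "\<psi> \<in> hom C (Dom C p) (Dom C p')" "\<psi> \<cdot> a = a'" "\<psi> \<cdot> b = b'"
    using product_insertions_compare[OF pr H(2)] .
  have \<sigma>\<phi>: "\<sigma>' \<cdot> \<phi> = \<psi> \<cdot> \<sigma>"
    by (rule coproduct_jointly_epic[OF cp, of _ _ "Dom C p'"])
      (use \<phi> \<psi> \<sigma> H(3-5) I in \<open>simp_all add: cat_simps\<close>)
  have w\<phi>: "w' \<cdot> \<phi> = w"
    by (rule coproduct_jointly_epic[OF cp, of _ _ "Cod C k"])
      (use \<phi> w H(7-9) I in \<open>simp_all add: cat_simps\<close>)
  have "\<sigma>' \<cdot> (\<phi> \<cdot> t) = zero_arr T (Dom C p')"
    using \<sigma>\<phi>[THEN comp_subst] \<phi>(1) \<psi>(1) \<sigma>(1) H(3) t by (simp add: pointed_simps)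
  then have "\<phi> \<cdot> t \<lesssim> \<kappa>"
    using kernel_factors_iff[OF H(6), of "\<phi> \<cdot> t" T] \<phi>(1) t(1) H(3) by (simp add: cat_simps)
  then obtain \<theta> where \<theta>0: "\<theta> \<in> hom C (Dom C (\<phi> \<cdot> t)) (Dom C \<kappa>)" "\<kappa> \<cdot> \<theta> = \<phi> \<cdot> t" by (rule factorsE)
  then have \<theta>: "\<theta> \<in> hom C T (Dom C \<kappa>)" using \<phi>(1) t(1) by (simp add: cat_simps)
  have "m \<cdot> (e \<cdot> \<theta>) = w' \<cdot> (\<kappa> \<cdot> \<theta>)"
    using H(13)[THEN comp_subst] \<theta> H(11,14,15,7) by (simp add: cat_simps)
  also have "\<dots> = w \<cdot> t"
    using \<theta>0(2) w\<phi>[THEN comp_subst] \<phi>(1) t(1) H(7) by (simp add: cat_simps)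
  finally show ?thesis by (rule factorsI) (use \<theta> H(11) w(1) t(1) in \<open>simp add: cat_simps\<close>)
qed

lemma higgins_le:
  assumes m: "is_higgins_commutator C k l m" and m': "is_higgins_commutator C k l m'"
  shows "m' \<lesssim> m"
proof -
  obtain i j p q a b \<sigma> \<kappa> w e where H:
    "is_coproduct C (Dom C k) (Dom C l) i j" "is_product_insertions C (Dom C k) (Dom C l) p q a b"
    "\<sigma> \<in> hom C (Cod C i) (Dom C p)" "\<sigma> \<cdot> i = a" "\<sigma> \<cdot> j = b" "is_kernel C \<sigma> \<kappa>"
    "w \<in> hom C (Cod C i) (Cod C k)" "w \<cdot> i = k" "w \<cdot> j = l"
    "is_mono C m'" "e \<in> hom C (Dom C \<kappa>) (Dom C m')" "regular_epi C e" "m' \<cdot> e = w \<cdot> \<kappa>"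
    "\<kappa> \<in> hom C (Dom C \<kappa>) (Cod C i)" "m' \<in> hom C (Dom C m') (Cod C k)"
    using m' by (rule higgins_dataE)
  have mm: "is_mono C m" "m \<in> hom C (Dom C m) (Cod C k)" using m by (blast elim: higgins_dataE)+
  have "\<sigma> \<cdot> \<kappa> = zero_arr (Dom C \<kappa>) (Dom C p)" using kernelD(3)[OF H(6)] H(3) by (simp add: hom_iff)
  then have "m' \<cdot> e \<lesssim> m"
    unfolding H(13) using higgins_contains[OF m H(1-5,7-9,14)] by blast
  then show ?thesis
    by (rule regular_epi_factors_local[OF H(12) mm(1), rotated]) (use H(11,15) mm in \<open>simp add: hom_iff\<close>)
qed

lemma higgins_same_sub:
  "is_higgins_commutator C k l m \<Longrightarrow> is_higgins_commutator C k l m' \<Longrightarrow> same_sub C m m'"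
  unfolding same_sub_def using higgins_le by (blast elim: higgins_dataE)

lemma higgins_spec:
  "k \<in> hom C K X \<Longrightarrow> l \<in> hom C L X \<Longrightarrow> is_higgins_commutator C k l (higgins C k l)"
  unfolding higgins_def by (metis higgins_exists someI)

text \<open>The Higgins commutator does not see the ambient object.\<close>

lemma higgins_comp:
  assumes m: "is_higgins_commutator C k l m" and x: "is_mono C x" "x \<in> hom C X Y"
    and k: "k \<in> hom C K X" and l: "l \<in> hom C L X"
  shows "is_higgins_commutator C (x \<cdot> k) (x \<cdot> l) (x \<cdot> m)"
proof -
  obtain i j p q a b \<sigma> \<kappa> w e where H:
    "is_coproduct C (Dom C k) (Dom C l) i j" "is_product_insertions C (Dom C k) (Dom C l) p q a b"
    "\<sigma> \<in> hom C (Cod C i) (Dom C p)" "\<sigma> \<cdot> i = a" "\<sigma> \<cdot> j = b" "is_kernel C \<sigma> \<kappa>"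
    "w \<in> hom C (Cod C i) (Cod C k)" "w \<cdot> i = k" "w \<cdot> j = l"
    "is_mono C m" "e \<in> hom C (Dom C \<kappa>) (Dom C m)" "regular_epi C e" "m \<cdot> e = w \<cdot> \<kappa>"
    "\<kappa> \<in> hom C (Dom C \<kappa>) (Cod C i)" "m \<in> hom C (Dom C m) (Cod C k)"
    using m by (rule higgins_dataE)
  note I = coproductD[OF H(1)]
  have D: "Dom C (x \<cdot> k) = Dom C k" "Dom C (x \<cdot> l) = Dom C l" "Cod C (x \<cdot> k) = Y"
    using x(2) k l by (simp_all add: cat_simps)
  have w': "w \<in> hom C (Cod C i) X" using H(7) k by (simp add: hom_iff)
  have m': "m \<in> hom C (Dom C m) X" using H(15) k by (simp add: hom_iff)
  have W: "x \<cdot> w \<in> hom C (Cod C i) Y" "(x \<cdot> w) \<cdot> i = x \<cdot> k" "(x \<cdot> w) \<cdot> j = x \<cdot> l"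
    using w' H(8,9) x(2) I by (simp_all add: cat_simps)
  have E: "Dom C ((x \<cdot> w) \<cdot> \<kappa>) = Dom C \<kappa>" "Dom C (x \<cdot> m) = Dom C m"
    using w' H(14) m' x(2) by (simp_all add: cat_simps)
  have "is_mono C (x \<cdot> m)" by (rule mono_comp[OF x(1) H(10)]) (use m' x(2) in \<open>simp add: hom_iff\<close>)
  moreover have "(x \<cdot> m) \<cdot> e = (x \<cdot> w) \<cdot> \<kappa>" using H(13,11,14) m' w' x(2) by (simp add: cat_simps)
  ultimately have "is_regular_image C ((x \<cdot> w) \<cdot> \<kappa>) (x \<cdot> m)"
    unfolding is_regular_image_def E using H(11,12) by blast
  then show ?thesis
    unfolding is_higgins_commutator_def D using H(1-6) W by blast
qed

text \<open>If \<open>X\<close> is the join of \<open>k\<close> and \<open>l\<close>, then \<open>K + L \<rightarrow> X\<close> is a regular epimorphism, and \<open>m\<close> is the image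
  under it of the normal subobject \<open>K \<diamond> L\<close>.\<close>

lemma higgins_normal_in_join:
  assumes m: "is_higgins_commutator C k l m" and k: "k \<in> Sub C X" and l: "l \<in> Sub C X"
    and join: "is_join C k l (Ident C X)"
  shows "m \<in> NSub C X"
proof -
  obtain i j p q a b \<sigma> \<kappa> w e where H:
    "is_coproduct C (Dom C k) (Dom C l) i j" "is_product_insertions C (Dom C k) (Dom C l) p q a b"
    "\<sigma> \<in> hom C (Cod C i) (Dom C p)" "\<sigma> \<cdot> i = a" "\<sigma> \<cdot> j = b" "is_kernel C \<sigma> \<kappa>"
    "w \<in> hom C (Cod C i) (Cod C k)" "w \<cdot> i = k" "w \<cdot> j = l"
    "is_mono C m" "e \<in> hom C (Dom C \<kappa>) (Dom C m)" "regular_epi C e" "m \<cdot> e = w \<cdot> \<kappa>"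
    "\<kappa> \<in> hom C (Dom C \<kappa>) (Cod C i)" "m \<in> hom C (Dom C m) (Cod C k)"
    using m by (rule higgins_dataE)
  note I = coproductD[OF H(1)] and K = SubD[OF k] and L = SubD[OF l]
  have D: "Cod C k = X" using K by simp
  have w: "w \<in> hom C (Cod C i) X" using H(7) D by simp
  have "regular_epi C w"
  proof (rule regular_epiI[OF w])
    fix n assume n: "n \<in> Sub C X" "w \<lesssim> n"
    note N = SubD[OF n(1)]
    have "w \<cdot> i \<lesssim> n" "w \<cdot> j \<lesssim> n"
      using n(2) w N I by (auto intro!: factors_comp simp: hom_iff)
    then show "Ident C X \<lesssim> n" using join n(1) H(8,9) unfolding is_join_def D by simp
  qed
  moreover have "\<kappa> \<in> NSub C (Cod C i)" using NSubI[OF H(6,3)] .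
  moreover have "m \<in> hom C (Dom C m) X" using H(15) D by simp
  ultimately show ?thesis using regular_image_normal w H(10-13) by blast
qed

text \<open>An arrow \<open>K + L \<rightarrow> Q\<close> factors through \<open>K \<times> L\<close> exactly when it vanishes on \<open>K \<diamond> L\<close>, as \<open>\<sigma>\<close> is the
  cokernel of \<open>\<kappa>\<close>. The arrow to be considered is \<open>g w\<close>, and \<open>m\<close> is the image of \<open>w \<kappa>\<close>.\<close>

lemma arrows_commute_iff:
  assumes m: "is_higgins_commutator C k l m" and k: "k \<in> hom C K X" and l: "l \<in> hom C L X"
    and g: "g \<in> hom C X Q"
  shows "arrows_commute C (g \<cdot> k) (g \<cdot> l) \<longleftrightarrow> g \<cdot> m = zero_arr (Dom C m) Q"
proof -
  obtain i j p q a b \<sigma> \<kappa> w e where H: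
    "is_coproduct C (Dom C k) (Dom C l) i j" "is_product_insertions C (Dom C k) (Dom C l) p q a b"
    "\<sigma> \<in> hom C (Cod C i) (Dom C p)" "\<sigma> \<cdot> i = a" "\<sigma> \<cdot> j = b" "is_kernel C \<sigma> \<kappa>"
    "w \<in> hom C (Cod C i) (Cod C k)" "w \<cdot> i = k" "w \<cdot> j = l"
    "is_mono C m" "e \<in> hom C (Dom C \<kappa>) (Dom C m)" "regular_epi C e" "m \<cdot> e = w \<cdot> \<kappa>"
    "\<kappa> \<in> hom C (Dom C \<kappa>) (Cod C i)" "m \<in> hom C (Dom C m) (Cod C k)"
    using m by (rule higgins_dataE)
  note I = coproductD[OF H(1)]
  have D: "Dom C (g \<cdot> k) = Dom C k" "Dom C (g \<cdot> l) = Dom C l" "Cod C (g \<cdot> k) = Q"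
    using g k l by (simp_all add: cat_simps)
  have w: "w \<in> hom C (Cod C i) X" and mh: "m \<in> hom C (Dom C m) X" using H(7,15) k by (simp_all add: hom_iff)
  have \<sigma>\<kappa>: "\<sigma> \<cdot> \<kappa> = zero_arr (Dom C \<kappa>) (Dom C p)" using kernelD(3)[OF H(6)] H(3) by (simp add: hom_iff)
  have ob: "Q \<in> Ob C" "Dom C p \<in> Ob C" using g H(3) by (simp_all add: hom_iff)
  show ?thesis
  proof
    assume "arrows_commute C (g \<cdot> k) (g \<cdot> l)"
    then obtain p' q' a' b' \<phi> where c: "is_product_insertions C (Dom C k) (Dom C l) p' q' a' b'"
      "\<phi> \<in> hom C (Dom C p') Q" "\<phi> \<cdot> a' = g \<cdot> k" "\<phi> \<cdot> b' = g \<cdot> l"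
      unfolding arrows_commute_def D by blast
    obtain \<psi> where \<psi>: "\<psi> \<in> hom C (Dom C p) (Dom C p')" "\<psi> \<cdot> a = a'" "\<psi> \<cdot> b = b'"
      using product_insertions_compare[OF H(2) c(1)] .
    have gw: "g \<cdot> w = \<phi> \<cdot> (\<psi> \<cdot> \<sigma>)"
      by (rule coproduct_jointly_epic[OF H(1), of _ _ Q])
        (use g w c(2-4) \<psi> H(3-5,8,9) I in \<open>simp_all add: cat_simps\<close>)
    have "g \<cdot> (m \<cdot> e) = (g \<cdot> w) \<cdot> \<kappa>" unfolding H(13) using g w H(14) by (simp add: cat_simps)
    also have "\<dots> = zero_arr (Dom C \<kappa>) Q"
      unfolding gw using c(2) \<psi>(1) H(3,14) \<sigma>\<kappa> ob by (simp add: pointed_simps)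
    finally have gme: "g \<cdot> (m \<cdot> e) = zero_arr (Dom C \<kappa>) Q" .
    show "g \<cdot> m = zero_arr (Dom C m) Q"
      by (rule regular_epi_cancel[OF H(12), of _ _ Q])
        (use gme g mh H(11) ob in \<open>simp_all add: pointed_simps\<close>)
  next
    assume gm: "g \<cdot> m = zero_arr (Dom C m) Q"
    have gwk: "g \<cdot> (w \<cdot> \<kappa>) = zero_arr (Dom C \<kappa>) Q"
      unfolding H(13)[symmetric] using gm[THEN comp_subst] g mh H(11) ob by (simp add: pointed_simps)
    have gw: "g \<cdot> w \<in> hom C (Cod C i) Q" using g w by (simp add: cat_simps)
    have ker: "(g \<cdot> w) \<cdot> t = zero_arr T Q" if t: "t \<in> hom C T (Cod C i)" "\<sigma> \<cdot> t = zero_arr T (Dom C p)" for T t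
    proof -
      have "t \<lesssim> \<kappa>" using kernel_factors_iff[OF H(6), of t T] t H(3) by (simp add: hom_iff)
      then obtain h where h: "h \<in> hom C (Dom C t) (Dom C \<kappa>)" "\<kappa> \<cdot> h = t" by (rule factorsE)
      have "(g \<cdot> (w \<cdot> \<kappa>)) \<cdot> h = zero_arr (Dom C t) Q" unfolding gwk using h(1) ob by (simp add: pointed_simps)
      then show ?thesis using h g w H(14) t(1) by (simp add: cat_simps)
    qed
    obtain \<phi> where \<phi>: "\<phi> \<in> hom C (Dom C p) Q" "\<phi> \<cdot> \<sigma> = g \<cdot> w"
      using regular_epi_cokernel[OF coproduct_to_product_regular[OF H(1-5)] H(3) gw ker] by blast
    have "\<phi> \<cdot> (\<sigma> \<cdot> i) = g \<cdot> (w \<cdot> i)" "\<phi> \<cdot> (\<sigma> \<cdot> j) = g \<cdot> (w \<cdot> j)"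
      using \<phi>(2)[THEN comp_subst] \<phi>(1) H(3) g w I by (simp_all add: cat_simps)
    then have "\<phi> \<cdot> a = g \<cdot> k" "\<phi> \<cdot> b = g \<cdot> l" using H by simp_all
    moreover have "g \<cdot> k \<in> Arr C" "g \<cdot> l \<in> hom C (Dom C l) Q" using g k l by (simp_all add: cat_simps)
    ultimately show "arrows_commute C (g \<cdot> k) (g \<cdot> l)"
      unfolding arrows_commute_def D using H(2) \<phi>(1) by blast
  qed
qed

lemma commute_modulo_iff:
  assumes m: "is_higgins_commutator C k l m" and k: "k \<in> hom C K X" and l: "l \<in> hom C L X"
    and n: "n \<in> NSub C X"
  shows "commute_modulo C k l n \<longleftrightarrow> m \<lesssim> n"
proof
  have mh: "m \<in> hom C (Dom C m) X" using m k by (auto elim!: higgins_dataE simp: hom_iff)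
  note N = SubD[OF NSub_imp_Sub[OF n]]
  have nh: "n \<in> hom C (Dom C n) X" using N by (simp add: cat_simps)
  { assume "commute_modulo C k l n"
    then obtain q where q: "is_cokernel C n q" "arrows_commute C (q \<cdot> k) (q \<cdot> l)"
      by (auto simp: commute_modulo_def)
    have qh: "q \<in> hom C X (Cod C q)" using q(1) N unfolding is_cokernel_def by simp
    have qm: "q \<cdot> m = zero_arr (Dom C m) (Cod C q)" using arrows_commute_iff[OF m k l qh] q(2) by blast
    obtain W f where f: "f \<in> hom C X W" "is_kernel C f n" using n by (rule NSubE)
    have "is_zero_arrow C (f \<cdot> n)" "f \<in> hom C (Cod C n) W"
      using kernelD(3)[OF f(2)] f(1) nh by (simp_all add: is_zero_arrow_iff pointed_simps)
    then obtain h where h: "h \<in> hom C (Cod C q) W" "h \<cdot> q = f"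
      using q(1) unfolding is_cokernel_def by blast
    have "f \<cdot> m = zero_arr (Dom C m) W"
      unfolding h(2)[symmetric] using h(1) qh mh qm by (simp add: pointed_simps)
    then show "m \<lesssim> n" using kernel_factors_iff[OF f(2), of m "Dom C m"] mh f(1) by (simp add: hom_iff) }
  assume mn: "m \<lesssim> n"
  obtain Q q where q: "q \<in> hom C X Q" "regular_epi C q" "is_kernel C q n" using normal_quotient[OF n] .
  have qD: "Dom C q = X" "Cod C q = Q" "Cod C n = X" using q(1) N by (simp_all add: hom_iff)
  have cok: "\<exists>!h. h \<in> hom C Q T \<and> h \<cdot> q = g" if g: "g \<in> hom C X T" "is_zero_arrow C (g \<cdot> n)" for T g
  proof -
    have gn: "g \<cdot> n = zero_arr (Dom C n) T" using g nh by (simp add: is_zero_arrow_iff pointed_simps)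
    have ker: "g \<cdot> t = zero_arr U T" if t: "t \<in> hom C U X" "q \<cdot> t = zero_arr U Q" for U t
    proof -
      have "t \<lesssim> n" using kernel_factors_iff[OF q(3), of t U] t qD by simp
      then obtain h where h: "h \<in> hom C (Dom C t) (Dom C n)" "n \<cdot> h = t" by (rule factorsE)
      have "g \<cdot> (n \<cdot> h) = zero_arr (Dom C t) T"
        using gn[THEN comp_subst] g(1) nh h(1) by (simp add: pointed_simps)
      then show ?thesis using h t(1) by (simp add: hom_iff)
    qed
    obtain h where "h \<in> hom C Q T" "h \<cdot> q = g" using regular_epi_cokernel[OF q(2,1) g(1) ker] by blast
    moreover have "u = v" if "u \<in> hom C Q T" "v \<in> hom C Q T" "u \<cdot> q = v \<cdot> q" for u v
      using regular_epi_cancel[OF q(2) that(3), of T] that qD by simp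
    ultimately show ?thesis by blast
  qed
  have "is_zero_arrow C (q \<cdot> n)"
    using kernelD(3)[OF q(3)] q(1) nh by (simp add: is_zero_arrow_iff pointed_simps)
  then have "is_cokernel C n q"
    unfolding is_cokernel_def qD using N q(1) cok by blast
  moreover have "q \<cdot> m = zero_arr (Dom C m) Q"
    using kernel_factors_iff[OF q(3), of m "Dom C m"] mn mh qD by simp
  then have "arrows_commute C (q \<cdot> k) (q \<cdot> l)" using arrows_commute_iff[OF m k l q(1)] by blast
  ultimately show "commute_modulo C k l n" by (auto simp: commute_modulo_def)
qed

text \<open>The Huq commutator is the normal closure of the Higgins commutator.\<close>

lemma huq_iff:
  assumes m: "is_higgins_commutator C k l m" and k: "k \<in> hom C K X" and l: "l \<in> hom C L X"
  shows "is_huq_commutator C k l h \<longleftrightarrow>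
    h \<in> NSub C X \<and> m \<lesssim> h \<and> (\<forall>n\<in>NSub C X. m \<lesssim> n \<longrightarrow> h \<lesssim> n)"
proof -
  have "Cod C k = X" using k by (simp add: hom_iff)
  then show ?thesis unfolding is_huq_commutator_def using commute_modulo_iff[OF m k l] by auto
qed

lemma huq_spec:
  assumes k: "k \<in> hom C K X" and l: "l \<in> hom C L X"
  shows "is_huq_commutator C k l (huq C k l)"
proof -
  obtain m where m: "is_higgins_commutator C k l m" using higgins_exists[OF k l] .
  have mh: "m \<in> hom C (Dom C m) X" using m k by (auto elim!: higgins_dataE simp: hom_iff)
  obtain n where "n \<in> NSub C X" "m \<lesssim> n" "\<And>n'. n' \<in> NSub C X \<Longrightarrow> m \<lesssim> n' \<Longrightarrow> n \<lesssim> n'"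
    using normal_closure_exists[OF mh] by blast
  then have "is_huq_commutator C k l n" using huq_iff[OF m k l] by blast
  then show ?thesis unfolding huq_def by (rule someI)
qed

lemma huq_normal: "k \<in> hom C K X \<Longrightarrow> l \<in> hom C L X \<Longrightarrow> huq C k l \<in> NSub C X"
  using huq_spec[of k K X l L] by (simp add: is_huq_commutator_def hom_iff)

lemma normal_higgins_same_huq:
  assumes m: "is_higgins_commutator C k l m" and k: "k \<in> hom C K X" and l: "l \<in> hom C L X"
    and n: "m \<in> NSub C X"
  shows "same_sub C m (huq C k l)"
proof -
  have h: "huq C k l \<in> NSub C X" "m \<lesssim> huq C k l" "huq C k l \<lesssim> m"
    using huq_spec[OF k l] n factors_refl SubD[OF NSub_imp_Sub[OF n]] unfolding huq_iff[OF m k l] by blast+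
  then show ?thesis
    using SubD[OF NSub_imp_Sub[OF n]] SubD[OF NSub_imp_Sub[OF h(1)]] by (simp add: same_sub_def)
qed

text \<open>\<open>[K,L]\<^sub>Y\<close> is the least normal subobject of \<open>Y\<close> that contains \<open>[K,L]\<close>. Its restriction to \<open>X\<close> is
  normal and so contains \<open>[K,L]\<^sub>X\<close>; hence \<open>[K,L]\<^sub>X \<le> [K,L]\<^sub>Y\<close> in any case, and the converse
  inequality amounts to the normality of \<open>[K,L]\<^sub>X\<close> in \<open>Y\<close>.\<close>

lemma huq_agrees_iff_normal:
  assumes x: "x \<in> Sub C Y" and k: "k \<in> Sub C (Dom C x)" and l: "l \<in> Sub C (Dom C x)"
  shows "same_sub C (x \<cdot> huq C k l) (huq C (x \<cdot> k) (x \<cdot> l)) \<longleftrightarrow> x \<cdot> huq C k l \<in> NSub C Y"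
proof -
  note X = SubD[OF x] and K = SubD[OF k] and L = SubD[OF l]
  have kh: "k \<in> hom C (Dom C k) (Dom C x)" and lh: "l \<in> hom C (Dom C l) (Dom C x)"
    and xh: "x \<in> hom C (Dom C x) Y"
    using X K L by (simp_all add: cat_simps)
  have xkh: "x \<cdot> k \<in> hom C (Dom C k) Y" and xlh: "x \<cdot> l \<in> hom C (Dom C l) Y"
    using kh lh xh by (simp_all add: cat_simps)
  obtain m where m: "is_higgins_commutator C k l m" using higgins_exists[OF kh lh] .
  have mh: "m \<in> hom C (Dom C m) (Dom C x)" using m kh by (auto elim!: higgins_dataE simp: hom_iff)
  have xm: "is_higgins_commutator C (x \<cdot> k) (x \<cdot> l) (x \<cdot> m)"
    using higgins_comp[OF m _ xh kh lh] X by blast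
  define h where "h = huq C k l"
  have H: "h \<in> NSub C (Dom C x)" "m \<lesssim> h" "\<And>n. n \<in> NSub C (Dom C x) \<Longrightarrow> m \<lesssim> n \<Longrightarrow> h \<lesssim> n"
    using huq_spec[OF kh lh] unfolding huq_iff[OF m kh lh] h_def by blast+
  note HS = SubD[OF NSub_imp_Sub[OF H(1)]]
  have hh: "h \<in> hom C (Dom C h) (Dom C x)" using HS by (simp add: cat_simps)
  define h' where "h' = huq C (x \<cdot> k) (x \<cdot> l)"
  have H': "h' \<in> NSub C Y" "x \<cdot> m \<lesssim> h'" "\<And>n. n \<in> NSub C Y \<Longrightarrow> x \<cdot> m \<lesssim> n \<Longrightarrow> h' \<lesssim> n"
    using huq_spec[OF xkh xlh] unfolding huq_iff[OF xm xkh xlh] h'_def by blast+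
  note HS' = SubD[OF NSub_imp_Sub[OF H'(1)]]
  have "same_sub C (x \<cdot> h) h' \<longleftrightarrow> x \<cdot> h \<in> NSub C Y"
  proof
    assume "same_sub C (x \<cdot> h) h'"
    then show "x \<cdot> h \<in> NSub C Y" using NSub_same_sub[OF H'(1)] same_sub_sym by blast
  next
    assume N: "x \<cdot> h \<in> NSub C Y"
    have "x \<cdot> m \<lesssim> x \<cdot> h" using comp_factors_comp_iff[of x h "Dom C h" m "Dom C m"] X hh mh H(2) by blast
    then have 1: "h' \<lesssim> x \<cdot> h" using H'(3)[OF N] by blast
    have h'S: "h' \<in> Sub C Y" using NSub_imp_Sub[OF H'(1)] .
    obtain n where n: "n \<in> Sub C (Dom C x)" "\<And>T t. t \<in> hom C T (Dom C x) \<Longrightarrow> t \<lesssim> n \<longleftrightarrow> x \<cdot> t \<lesssim> h'"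
      using inverse_image[OF h'S xh] by blast
    have "n \<in> NSub C (Dom C x)" using inverse_image_NSub[OF H'(1) n(1) xh n(2)] .
    moreover have "m \<lesssim> n" using n(2)[OF mh] H'(2) by blast
    ultimately have "h \<lesssim> n" by (rule H(3))
    then have "x \<cdot> h \<lesssim> h'" using n(2)[OF hh] by blast
    then show "same_sub C (x \<cdot> h) h'"
      using 1 HS' mono_comp[of x h] X HS by (simp add: same_sub_def)
  qed
  then show ?thesis by (simp add: h_def h'_def)
qed

lemma join_comp:
  assumes join: "is_join C k l (Ident C X)" and x: "is_mono C x" "x \<in> hom C X Y"
    and k: "k \<in> hom C K X" and l: "l \<in> hom C L X"
  shows "is_join C (x \<cdot> k) (x \<cdot> l) x"
proof -
  have D: "Cod C (x \<cdot> k) = Y" "Cod C k = X" "Cod C x = Y" using x k by (simp_all add: cat_simps)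
  have le: "x \<cdot> k \<lesssim> x" "x \<cdot> l \<lesssim> x" using x k l by (auto intro!: factors_comp_left simp: hom_iff)
  have "x \<lesssim> n" if n: "n \<in> Sub C Y" "x \<cdot> k \<lesssim> n" "x \<cdot> l \<lesssim> n" for n
  proof -
    obtain i where i: "i \<in> Sub C X" "\<And>T t. t \<in> hom C T X \<Longrightarrow> t \<lesssim> i \<longleftrightarrow> x \<cdot> t \<lesssim> n"
      using inverse_image[OF n(1) x(2)] by blast
    have "k \<lesssim> i" "l \<lesssim> i" using i(2)[OF k] i(2)[OF l] n by blast+
    then have "Ident C X \<lesssim> i" using join i(1) unfolding is_join_def D by blast
    moreover have "Ident C X \<in> hom C X X" using Ident_hom x(2) by (simp add: hom_iff)
    ultimately have "x \<cdot> Ident C X \<lesssim> n" using i(2) by blast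
    then show ?thesis using x(2) by (simp add: cat_simps)
  qed
  then show ?thesis unfolding is_join_def D using le x D by (simp add: Sub_def)
qed

lemma join_comp_cancel:
  assumes join: "is_join C (x \<cdot> k) (x \<cdot> l) x" and x: "is_mono C x" "x \<in> hom C X Y"
    and k: "k \<in> hom C K X" and l: "l \<in> hom C L X"
  shows "is_join C k l (Ident C X)"
proof -
  have D: "Cod C (x \<cdot> k) = Y" "Cod C k = X" "Cod C x = Y" using x k by (simp_all add: cat_simps)
  have ob: "X \<in> Ob C" using k by (simp add: hom_iff)
  have le: "k \<lesssim> Ident C X" "l \<lesssim> Ident C X"
    by (rule factors_of_Ident[OF factors_refl _ k], use ob in \<open>simp_all add: cat_simps\<close>)
      (rule factors_of_Ident[OF factors_refl _ l], use ob in \<open>simp_all add: cat_simps\<close>)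
  have "Ident C X \<lesssim> n" if n: "n \<in> Sub C X" "k \<lesssim> n" "l \<lesssim> n" for n
  proof -
    note N = SubD[OF n(1)]
    have nh: "n \<in> hom C (Dom C n) (Dom C x)" using N x(2) by (simp add: cat_simps)
    have "x \<cdot> k \<lesssim> x \<cdot> n" "x \<cdot> l \<lesssim> x \<cdot> n"
      using comp_factors_comp_iff[OF x(1) nh, of k K] comp_factors_comp_iff[OF x(1) nh, of l L] n k l x(2)
      by (simp_all add: hom_iff)
    moreover have "x \<cdot> n \<in> Sub C Y"
      using mono_comp[of x n] N x nh by (simp add: Sub_def cat_simps)
    ultimately have "x \<lesssim> x \<cdot> n" using join unfolding is_join_def D by blast
    then have "x \<cdot> Ident C X \<lesssim> x \<cdot> n" using x(2) by (simp add: cat_simps)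
    then show ?thesis
      using comp_factors_comp_iff[OF x(1) nh, of "Ident C X" X] Ident_hom[OF ob] x(2) by (simp add: hom_iff)
  qed
  then show ?thesis
    unfolding is_join_def D using le mono_Ident[OF ob] ob by (simp add: Sub_def Ident_simps)
qed

end

section \<open>Normal subobjects in categories of points\<close>

context semi_abelian_cat
begin

lemma Pt_Ob_iff:
  "(Y, f, s) \<in> Ob (Pt C Z) \<longleftrightarrow> Y \<in> Ob C \<and> f \<in> hom C Y Z \<and> s \<in> hom C Z Y \<and> f \<cdot> s = Ident C Z"
  by (simp add: Pt_def)

lemma Pt_Arr_iff:
  "((Y, f, s), m, (Y', f', s')) \<in> Arr (Pt C Z) \<longleftrightarrow>
    (Y, f, s) \<in> Ob (Pt C Z) \<and> (Y', f', s') \<in> Ob (Pt C Z) \<and> m \<in> hom C Y Y' \<and> f' \<cdot> m = f \<and> m \<cdot> s = s'"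
  by (auto simp: Pt_def)

lemma Pt_simps:
  "Dom (Pt C Z) (A, m, B) = A" "Cod (Pt C Z) (A, m, B) = B" "Ident (Pt C Z) A = (A, Ident C (fst A), A)"
  "Comp (Pt C Z) (B', n, D) (A, m, B) = (A, n \<cdot> m, D)"
  by (simp_all add: Pt_def)

lemma Pt_ArrE:
  assumes "\<alpha> \<in> Arr (Pt C Z)"
  obtains Y f s m Y' f' s' where "\<alpha> = ((Y, f, s), m, (Y', f', s'))"
  using assms by (auto simp: Pt_def)

lemma Pt_homE:
  assumes "\<alpha> \<in> hom (Pt C Z) (Y, f, s) (Y', f', s')"
  obtains m where "\<alpha> = ((Y, f, s), m, (Y', f', s'))" "((Y, f, s), m, (Y', f', s')) \<in> Arr (Pt C Z)"
proof -
  have a: "\<alpha> \<in> Arr (Pt C Z)" "Dom (Pt C Z) \<alpha> = (Y, f, s)" "Cod (Pt C Z) \<alpha> = (Y', f', s')"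
    using assms by (auto simp: hom_def)
  obtain m where "\<alpha> = ((Y, f, s), m, (Y', f', s'))"
    using a(2,3) Pt_ArrE[OF a(1)] by (metis Pt_simps(1,2))
  then show thesis using that a(1) by blast
qed

lemma Pt_homI: "((Y, f, s), m, (Y', f', s')) \<in> Arr (Pt C Z) \<Longrightarrow>
    ((Y, f, s), m, (Y', f', s')) \<in> hom (Pt C Z) (Y, f, s) (Y', f', s')"
  by (simp add: hom_def Pt_simps)

lemma Pt_zero_object:
  assumes Z: "Z \<in> Ob C"
  shows "is_zero_object (Pt C Z) (Z, Ident C Z, Ident C Z)"
proof -
  let ?O = "(Z, Ident C Z, Ident C Z)"
  have O: "?O \<in> Ob (Pt C Z)" using Z Ident_hom by (simp add: Pt_Ob_iff cat_simps)
  have "\<exists>!\<alpha>. \<alpha> \<in> hom (Pt C Z) ?O A" if "A \<in> Ob (Pt C Z)" for A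
  proof -
    obtain Y f s where A: "A = (Y, f, s)" by (cases A)
    note P = that[unfolded A]
    have "(?O, s, (Y, f, s)) \<in> Arr (Pt C Z)"
      unfolding Pt_Arr_iff using P O by (simp add: Pt_Ob_iff cat_simps)
    moreover have "m = s" if "(?O, m, (Y, f, s)) \<in> Arr (Pt C Z)" for m
      using that unfolding Pt_Arr_iff by (auto simp: cat_simps)
    ultimately show ?thesis unfolding A by (blast intro: Pt_homI elim: Pt_homE)
  qed
  moreover have "\<exists>!\<alpha>. \<alpha> \<in> hom (Pt C Z) A ?O" if "A \<in> Ob (Pt C Z)" for A
  proof -
    obtain Y f s where A: "A = (Y, f, s)" by (cases A)
    note P = that[unfolded A]
    have "((Y, f, s), f, ?O) \<in> Arr (Pt C Z)"
      unfolding Pt_Arr_iff using P O by (simp add: Pt_Ob_iff cat_simps)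
    moreover have "m = f" if "((Y, f, s), m, ?O) \<in> Arr (Pt C Z)" for m
      using that unfolding Pt_Arr_iff by (auto simp: cat_simps)
    ultimately show ?thesis unfolding A by (blast intro: Pt_homI elim: Pt_homE)
  qed
  ultimately show ?thesis using O unfolding is_zero_object_def is_initial_def is_terminal_def by blast
qed

text \<open>The zero object of \<open>Pt C Z\<close> is the point \<open>(Z, 1, 1)\<close>, so the zero arrow between two points is the
  projection of the first followed by the section of the second.\<close>

lemma Pt_zero_arrow_iff:
  assumes m: "((Y, f, s), m, (Y', f', s')) \<in> Arr (Pt C Z)"
  shows "is_zero_arrow (Pt C Z) ((Y, f, s), m, (Y', f', s')) \<longleftrightarrow> m = s' \<cdot> f"
proof
  assume "is_zero_arrow (Pt C Z) ((Y, f, s), m, (Y', f', s'))"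
  then obtain z \<alpha> \<beta> where z: "is_zero_object (Pt C Z) z"
    and \<alpha>: "\<alpha> \<in> hom (Pt C Z) (Y, f, s) z" and \<beta>: "\<beta> \<in> hom (Pt C Z) z (Y', f', s')"
    and eq: "((Y, f, s), m, (Y', f', s')) = Comp (Pt C Z) \<beta> \<alpha>"
    unfolding is_zero_arrow_def by (auto simp: Pt_simps)
  obtain W h t where W: "z = (W, h, t)" by (cases z)
  obtain u where u: "\<alpha> = ((Y, f, s), u, (W, h, t))" "((Y, f, s), u, (W, h, t)) \<in> Arr (Pt C Z)"
    using \<alpha> unfolding W by (rule Pt_homE)
  obtain v where v: "\<beta> = ((W, h, t), v, (Y', f', s'))" "((W, h, t), v, (Y', f', s')) \<in> Arr (Pt C Z)"
    using \<beta> unfolding W by (rule Pt_homE)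
  note U = u(2)[unfolded Pt_Arr_iff Pt_Ob_iff] and V = v(2)[unfolded Pt_Arr_iff Pt_Ob_iff]
  have "((W, h, t), t \<cdot> h, (W, h, t)) \<in> Arr (Pt C Z)"
    unfolding Pt_Arr_iff Pt_Ob_iff using U comp_subst[of h t "Ident C Z" h] by (simp add: cat_simps)
  moreover have "((W, h, t), Ident C W, (W, h, t)) \<in> Arr (Pt C Z)"
    unfolding Pt_Arr_iff Pt_Ob_iff using U by (simp add: cat_simps)
  moreover have "z \<in> Ob (Pt C Z)" "\<forall>A\<in>Ob (Pt C Z). \<exists>!\<gamma>. \<gamma> \<in> hom (Pt C Z) A z"
    using z unfolding is_zero_object_def is_terminal_def by blast+
  ultimately have "((W, h, t), t \<cdot> h, (W, h, t)) = ((W, h, t), Ident C W, (W, h, t))"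
    using Pt_homI unfolding W by blast
  then have th: "t \<cdot> h = Ident C W" by simp
  have "m = v \<cdot> u" using eq u(1) v(1) by (simp add: Pt_simps)
  also have "\<dots> = v \<cdot> ((t \<cdot> h) \<cdot> u)" unfolding th using U by (simp add: cat_simps)
  also have "\<dots> = s' \<cdot> f"
    using U V comp_subst[of v t s' f] by (simp add: cat_simps)
  finally show "m = s' \<cdot> f" .
next
  assume eq: "m = s' \<cdot> f"
  note M = m[unfolded Pt_Arr_iff Pt_Ob_iff]
  let ?O = "(Z, Ident C Z, Ident C Z)"
  have Z: "Z \<in> Ob C" using M by (simp add: hom_iff)
  have "((Y, f, s), f, ?O) \<in> Arr (Pt C Z)" "(?O, s', (Y', f', s')) \<in> Arr (Pt C Z)"
    unfolding Pt_Arr_iff Pt_Ob_iff using M Z by (simp_all add: cat_simps)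
  then have "((Y, f, s), f, ?O) \<in> hom (Pt C Z) (Y, f, s) ?O" "(?O, s', (Y', f', s')) \<in> hom (Pt C Z) ?O (Y', f', s')"
    by (simp_all add: Pt_homI)
  moreover have "((Y, f, s), m, (Y', f', s')) = Comp (Pt C Z) (?O, s', (Y', f', s')) ((Y, f, s), f, ?O)"
    using eq by (simp add: Pt_simps)
  ultimately show "is_zero_arrow (Pt C Z) ((Y, f, s), m, (Y', f', s'))"
    unfolding is_zero_arrow_def Pt_simps(1,2) using m Pt_zero_object[OF Z] by blast
qed

text \<open>Let \<open>k'\<close> be the kernel in \<open>Pt C Z\<close> of \<open>q\<close>, an arrow to \<open>(W, h, t)\<close>; in \<open>C\<close> it is the equalizer of
  \<open>q\<close> and \<open>t f\<close>. Then \<open>x k\<close> is the kernel of \<open>q\<close> in \<open>C\<close>: an element \<open>y\<close> lies in \<open>x k\<close> if and only if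
  \<open>f y = 0\<close> and \<open>q y = t (f y)\<close>, which together say just \<open>q y = 0\<close>, since \<open>f = h q\<close>.\<close>

lemma kernel_of_normal_in_points:
  assumes k': "k' \<in> NSub (Pt C Z) (Y, f, s)" and ker: "is_Ker C x k' k"
  shows "k \<in> Sub C (Dom C x)" "x \<cdot> k \<in> NSub C Y"
proof -
  obtain \<phi> where \<phi>: "is_kernel (Pt C Z) \<phi> k'" and ck: "Cod (Pt C Z) k' = (Y, f, s)"
    using k' by (auto simp: NSub_def normal_mono_def)
  have \<phi>A: "\<phi> \<in> Arr (Pt C Z)" and k'h: "k' \<in> hom (Pt C Z) (Dom (Pt C Z) k') (Dom (Pt C Z) \<phi>)"
    and k'z: "is_zero_arrow (Pt C Z) (Comp (Pt C Z) \<phi> k')"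
    and univ: "\<And>c \<gamma>. \<gamma> \<in> hom (Pt C Z) c (Dom (Pt C Z) \<phi>) \<Longrightarrow> is_zero_arrow (Pt C Z) (Comp (Pt C Z) \<phi> \<gamma>) \<Longrightarrow>
      \<exists>!\<eta>. \<eta> \<in> hom (Pt C Z) c (Dom (Pt C Z) k') \<and> Comp (Pt C Z) k' \<eta> = \<gamma>"
    using \<phi> unfolding is_kernel_def by blast+
  have d\<phi>: "Dom (Pt C Z) \<phi> = (Y, f, s)" using k'h ck by (auto simp: hom_def)
  obtain W h t q where \<phi>E: "\<phi> = ((Y, f, s), q, (W, h, t))"
    using Pt_ArrE[OF \<phi>A] d\<phi> by (metis Pt_simps(1))
  have k'A: "k' \<in> Arr (Pt C Z)" using k'h by (simp add: hom_def)
  obtain V g' s' g where k'E: "k' = ((V, g', s'), g, (Y, f, s))"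
    using Pt_ArrE[OF k'A] ck by (metis Pt_simps(2))
  note Q = \<phi>A[unfolded \<phi>E Pt_Arr_iff Pt_Ob_iff] and G = k'A[unfolded k'E Pt_Arr_iff Pt_Ob_iff]
  have q: "q \<in> hom C Y W" "h \<cdot> q = f" "q \<cdot> s = t" and f: "f \<in> hom C Y Z" and s: "s \<in> hom C Z Y"
    and fs: "f \<cdot> s = Ident C Z" and h: "h \<in> hom C W Z" and t: "t \<in> hom C Z W"
    using Q by blast+
  have g: "g \<in> hom C V Y" "f \<cdot> g = g'" "g \<cdot> s' = s" and g': "g' \<in> hom C V Z" and s': "s' \<in> hom C Z V"
    and gs': "g' \<cdot> s' = Ident C Z"
    using G by blast+
  have ob: "Z \<in> Ob C" "W \<in> Ob C" "Y \<in> Ob C" using f h q by (simp_all add: hom_iff)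
  have "((V, g', s'), q \<cdot> g, (W, h, t)) \<in> Arr (Pt C Z)"
    unfolding Pt_Arr_iff using G Q q(2)[THEN comp_subst] g(3) by (simp add: Pt_Ob_iff cat_simps)
  then have qg: "q \<cdot> g = t \<cdot> g'" using k'z by (simp add: \<phi>E k'E Pt_simps Pt_zero_arrow_iff)
  obtain \<kappa> where x: "is_kernel C f x" and \<kappa>: "is_kernel C g' \<kappa>"
    and k: "k \<in> hom C (Dom C \<kappa>) (Dom C x)" and xk: "x \<cdot> k = g \<cdot> \<kappa>"
    using ker by (auto simp: is_Ker_def k'E)
  note X = SubD[OF kernelD(2)[OF x]] and KA = SubD[OF kernelD(2)[OF \<kappa>]]
  have xh: "x \<in> hom C (Dom C x) Y" using X f by (simp add: cat_simps)
  have \<kappa>h: "\<kappa> \<in> hom C (Dom C \<kappa>) V" using KA g' by (simp add: cat_simps)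
  have tf: "t \<cdot> f \<in> hom C Y W" using t f by (simp add: cat_simps)
  \<comment> \<open>The subobject of all \<open>y\<close> with \<open>q y = t (f y)\<close> is a point over \<open>Z\<close>, and \<open>q\<close> restricts
    to a zero arrow of points on it; it serves to use the universal property of \<open>k'\<close>, which only concerns points.\<close>
  obtain v where v: "v \<in> Sub C Y" "\<And>T u. u \<in> hom C T Y \<Longrightarrow> u \<lesssim> v \<longleftrightarrow> q \<cdot> u = (t \<cdot> f) \<cdot> u"
    using equalizer_subobject[OF q(1) tf] by blast
  note VS = SubD[OF v(1)]
  have vh: "v \<in> hom C (Dom C v) Y" using VS by (simp add: cat_simps)
  have qv: "q \<cdot> v = t \<cdot> (f \<cdot> v)" using v(2)[OF vh] factors_refl VS t f vh by (simp add: cat_simps)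
  have "s \<lesssim> v" using v(2)[OF s] q fs t f s by (simp add: cat_simps)
  then obtain r where "r \<in> hom C (Dom C s) (Dom C v)" "v \<cdot> r = s" by (rule factorsE)
  then have r: "r \<in> hom C Z (Dom C v)" "v \<cdot> r = s" using s by (simp_all add: hom_iff)
  have vA: "((Dom C v, f \<cdot> v, r), v, (Y, f, s)) \<in> Arr (Pt C Z)"
    unfolding Pt_Arr_iff Pt_Ob_iff using vh r f s fs by (simp add: cat_simps)
  have qvA: "((Dom C v, f \<cdot> v, r), q \<cdot> v, (W, h, t)) \<in> Arr (Pt C Z)"
    unfolding Pt_Arr_iff using Q q(2)[THEN comp_subst] vh r f s fs by (simp add: Pt_Ob_iff cat_simps)
  have "is_zero_arrow (Pt C Z) (Comp (Pt C Z) \<phi> ((Dom C v, f \<cdot> v, r), v, (Y, f, s)))"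
    unfolding \<phi>E Pt_simps Pt_zero_arrow_iff[OF qvA] by (rule qv)
  moreover have "((Dom C v, f \<cdot> v, r), v, (Y, f, s)) \<in> hom (Pt C Z) (Dom C v, f \<cdot> v, r) (Dom (Pt C Z) \<phi>)"
    unfolding d\<phi> by (rule Pt_homI[OF vA])
  moreover have dk': "Dom (Pt C Z) k' = (V, g', s')" by (simp add: k'E Pt_simps)
  ultimately obtain \<eta> where \<eta>: "\<eta> \<in> hom (Pt C Z) (Dom C v, f \<cdot> v, r) (V, g', s')"
      "Comp (Pt C Z) k' \<eta> = ((Dom C v, f \<cdot> v, r), v, (Y, f, s))"
    using univ unfolding dk' by blast
  obtain w where w\<eta>: "\<eta> = ((Dom C v, f \<cdot> v, r), w, (V, g', s'))"
    and wA: "((Dom C v, f \<cdot> v, r), w, (V, g', s')) \<in> Arr (Pt C Z)"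
    using \<eta>(1) by (rule Pt_homE)
  have gw: "g \<cdot> w = v" using \<eta>(2) by (simp add: w\<eta> k'E Pt_simps)
  have w: "w \<in> hom C (Dom C v) V" "g' \<cdot> w = f \<cdot> v" "w \<cdot> r = s'"
    using wA unfolding Pt_Arr_iff by blast+
  have "q \<cdot> g = (t \<cdot> f) \<cdot> g" using qg g t f by (simp add: cat_simps)
  then have "g \<lesssim> v" using v(2)[OF g(1)] by blast
  then obtain w' where "w' \<in> hom C (Dom C g) (Dom C v)" and vw': "v \<cdot> w' = g" by (rule factorsE)
  then have w': "w' \<in> hom C V (Dom C v)" using g by (simp add: hom_iff)
  have ww': "w \<cdot> w' = Ident C V"
  proof -
    have w's': "w' \<cdot> s' = r"
      by (rule mono_cancel[of v _ _ Z])
        (use VS vw'[THEN comp_subst] w' s' vh g r in \<open>simp_all add: cat_simps\<close>)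
    have 1: "g \<cdot> (w \<cdot> w') = g" using gw[THEN comp_subst] vw' w w' g by (simp add: cat_simps)
    have 2: "((V, g', s'), w \<cdot> w', (V, g', s')) \<in> Arr (Pt C Z)"
      unfolding Pt_Arr_iff using G w w' w's' w(2)[THEN comp_subst] f vh g vw' by (simp add: Pt_Ob_iff cat_simps)
    have 3: "((V, g', s'), Ident C V, (V, g', s')) \<in> Arr (Pt C Z)"
      unfolding Pt_Arr_iff using G by (simp add: Pt_Ob_iff cat_simps)
    have "\<exists>!\<eta>. \<eta> \<in> hom (Pt C Z) (V, g', s') (V, g', s') \<and> Comp (Pt C Z) k' \<eta> = k'"
      using univ[OF _ k'z] k'h unfolding d\<phi> k'E Pt_simps by blast
    moreover have "Comp (Pt C Z) k' ((V, g', s'), w \<cdot> w', (V, g', s')) = k'"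
      "Comp (Pt C Z) k' ((V, g', s'), Ident C V, (V, g', s')) = k'"
      using 1 g by (simp_all add: k'E Pt_simps cat_simps)
    ultimately have "((V, g', s'), w \<cdot> w', (V, g', s')) = ((V, g', s'), Ident C V, (V, g', s'))"
      using Pt_homI[OF 2] Pt_homI[OF 3] by blast
    then show ?thesis by simp
  qed
  have "is_mono C w'" by (rule split_mono[OF ww' w' w(1)])
  then have "is_mono C (v \<cdot> w')" by (rule mono_comp[rotated]) (use VS w' in \<open>simp_all add: hom_iff\<close>)
  then have "is_mono C g" by (simp add: vw')
  then have "is_mono C (g \<cdot> \<kappa>)" by (rule mono_comp) (use KA \<kappa>h g in \<open>simp_all add: hom_iff\<close>)
  then have xkm: "is_mono C (x \<cdot> k)" by (simp add: xk)
  show "k \<in> Sub C (Dom C x)"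
    using mono_right_factor[OF xkm k xh] k by (simp add: Sub_def hom_iff)
  have "is_kernel C q (x \<cdot> k)"
  proof (rule kernelI[OF q(1)])
    show "x \<cdot> k \<in> Sub C Y" using xkm xh k by (simp add: Sub_def cat_simps)
    have "q \<cdot> (g \<cdot> \<kappa>) = t \<cdot> (g' \<cdot> \<kappa>)" using qg[THEN comp_subst] q(1) g(1) \<kappa>h t g' by (simp add: cat_simps)
    also have "\<dots> = zero_arr (Dom C \<kappa>) W" using kernelD(3)[OF \<kappa>] g' t \<kappa>h ob by (simp add: pointed_simps)
    finally show "q \<cdot> (x \<cdot> k) = zero_arr (Dom C (x \<cdot> k)) W" using xk g(1) \<kappa>h by (simp add: cat_simps)
    fix T u assume u: "u \<in> hom C T Y" "q \<cdot> u = zero_arr T W"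
    have fu: "f \<cdot> u = zero_arr T Z" unfolding q(2)[symmetric] using u h q(1) by (simp add: pointed_simps)
    have "u \<lesssim> v" using v(2)[OF u(1)] u fu t f by (simp add: pointed_simps)
    then obtain b where "b \<in> hom C (Dom C u) (Dom C v)" "v \<cdot> b = u" by (rule factorsE)
    then have b: "b \<in> hom C T (Dom C v)" "v \<cdot> b = u" using u by (simp_all add: hom_iff)
    have "g' \<cdot> (w \<cdot> b) = f \<cdot> (v \<cdot> b)" using w(2)[THEN comp_subst] w(1) b(1) g' f vh by (simp add: cat_simps)
    then have "g' \<cdot> (w \<cdot> b) = zero_arr T Z" using fu b(2) by simp
    then have "w \<cdot> b \<lesssim> \<kappa>"
      using kernel_factors_iff[OF \<kappa>, of "w \<cdot> b" T] w(1) b(1) g' by (simp add: cat_simps)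
    then obtain c where "c \<in> hom C (Dom C (w \<cdot> b)) (Dom C \<kappa>)" "\<kappa> \<cdot> c = w \<cdot> b" by (rule factorsE)
    then have c: "c \<in> hom C T (Dom C \<kappa>)" "\<kappa> \<cdot> c = w \<cdot> b" using w(1) b(1) by (simp_all add: cat_simps)
    have "(x \<cdot> k) \<cdot> c = g \<cdot> (w \<cdot> b)" unfolding xk using c \<kappa>h g(1) by (simp add: cat_simps)
    also have "\<dots> = u" using gw[THEN comp_subst] g(1) w(1) b by (simp add: cat_simps)
    finally show "u \<lesssim> x \<cdot> k" by (rule factorsI) (use c u(1) xh k in \<open>simp add: cat_simps\<close>)
  qed
  then show "x \<cdot> k \<in> NSub C Y" using NSubI q(1) by blast
qed

text \<open>Conversely, if \<open>x n\<close> is normal in \<open>Y\<close>, then \<open>f\<close> factors through the quotient \<open>q\<close> of \<open>Y\<close> by \<open>x n\<close>,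
  which thereby becomes an arrow of points. Its kernel \<open>N\<close> in \<open>Pt C Z\<close> is the equalizer of \<open>q\<close> and
  \<open>q s f\<close>.\<close>

lemma normal_in_points_exists:
  assumes pt: "(Y, f, s) \<in> Ob (Pt C Z)" and x: "is_kernel C f x"
    and n: "n \<in> hom C A (Dom C x)" and xn: "x \<cdot> n \<in> NSub C Y"
  obtains N where "N \<in> NSub (Pt C Z) (Y, f, s)" "is_Ker C x N n"
proof -
  have f: "f \<in> hom C Y Z" and s: "s \<in> hom C Z Y" and fs: "f \<cdot> s = Ident C Z" and ob: "Y \<in> Ob C" "Z \<in> Ob C"
    using pt by (auto simp: Pt_Ob_iff hom_iff)
  note X = SubD[OF kernelD(2)[OF x]]
  have xh: "x \<in> hom C (Dom C x) Y" using X f by (simp add: cat_simps)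
  have xnh: "x \<cdot> n \<in> hom C A Y" using xh n by (simp add: cat_simps)
  obtain W q where q: "q \<in> hom C Y W" "regular_epi C q" "is_kernel C q (x \<cdot> n)" using normal_quotient[OF xn] .
  have W: "W \<in> Ob C" using q(1) by (simp add: hom_iff)
  have fx: "f \<cdot> x = zero_arr (Dom C x) Z" using kernelD(3)[OF x] f by (simp add: hom_iff)
  have ker: "f \<cdot> u = zero_arr T Z" if u: "u \<in> hom C T Y" "q \<cdot> u = zero_arr T W" for T u
  proof -
    have "u \<lesssim> x \<cdot> n" using kernel_factors_iff[OF q(3), of u T] u q(1) by (simp add: hom_iff)
    then obtain b where "b \<in> hom C (Dom C u) (Dom C (x \<cdot> n))" "(x \<cdot> n) \<cdot> b = u" by (rule factorsE)
    then have b: "b \<in> hom C T A" "(x \<cdot> n) \<cdot> b = u" using u xnh by (simp_all add: hom_iff)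
    have "f \<cdot> ((x \<cdot> n) \<cdot> b) = zero_arr T Z"
      using fx[THEN comp_subst] f xh n b(1) ob by (simp add: pointed_simps)
    then show ?thesis using b(2) by simp
  qed
  obtain h where h: "h \<in> hom C W Z" "h \<cdot> q = f"
    using regular_epi_cokernel[OF q(2,1) f ker] by blast
  define t where "t = q \<cdot> s"
  have t: "t \<in> hom C Z W" using q(1) s by (simp add: t_def cat_simps)
  have ht: "h \<cdot> t = Ident C Z" unfolding t_def using h(2)[THEN comp_subst] h(1) q(1) s fs by (simp add: cat_simps)
  have ptW: "(W, h, t) \<in> Ob (Pt C Z)" using W h t ht by (simp add: Pt_Ob_iff)
  let ?\<phi> = "((Y, f, s), q, (W, h, t))"
  have \<phi>A: "?\<phi> \<in> Arr (Pt C Z)" unfolding Pt_Arr_iff using pt ptW q(1) h(2) t_def by simp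
  have tf: "t \<cdot> f \<in> hom C Y W" using t f by (simp add: cat_simps)
  obtain v where v: "v \<in> Sub C Y" "\<And>T u. u \<in> hom C T Y \<Longrightarrow> u \<lesssim> v \<longleftrightarrow> q \<cdot> u = (t \<cdot> f) \<cdot> u"
    using equalizer_subobject[OF q(1) tf] by blast
  note V = SubD[OF v(1)]
  have vh: "v \<in> hom C (Dom C v) Y" using V by (simp add: cat_simps)
  have qv: "q \<cdot> v = t \<cdot> (f \<cdot> v)" using v(2)[OF vh] factors_refl V t f vh by (simp add: cat_simps)
  have "s \<lesssim> v" using v(2)[OF s] q(1) fs t f s t_def by (simp add: cat_simps)
  then obtain r where "r \<in> hom C (Dom C s) (Dom C v)" "v \<cdot> r = s" by (rule factorsE)
  then have r: "r \<in> hom C Z (Dom C v)" "v \<cdot> r = s" using s by (simp_all add: hom_iff)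
  let ?V = "(Dom C v, f \<cdot> v, r)"
  let ?N = "(?V, v, (Y, f, s))"
  have NA: "?N \<in> Arr (Pt C Z)"
    unfolding Pt_Arr_iff Pt_Ob_iff using vh r f s fs by (simp add: cat_simps)
  have zero_iff: "is_zero_arrow (Pt C Z) (Comp (Pt C Z) ?\<phi> ((T, a, b), u, (Y, f, s))) \<longleftrightarrow> q \<cdot> u = t \<cdot> a"
    if "((T, a, b), u, (Y, f, s)) \<in> Arr (Pt C Z)" for T a b u
  proof -
    have "((T, a, b), q \<cdot> u, (W, h, t)) \<in> Arr (Pt C Z)"
      using that ptW q(1) h h(2)[THEN comp_subst] t_def unfolding Pt_Arr_iff by (auto simp: Pt_Ob_iff cat_simps)
    then show ?thesis by (simp add: Pt_simps Pt_zero_arrow_iff)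
  qed
  have univ: "\<exists>!\<eta>. \<eta> \<in> hom (Pt C Z) c ?V \<and> Comp (Pt C Z) ?N \<eta> = \<gamma>"
    if \<gamma>: "\<gamma> \<in> hom (Pt C Z) c (Y, f, s)" "is_zero_arrow (Pt C Z) (Comp (Pt C Z) ?\<phi> \<gamma>)" for c \<gamma>
  proof -
    obtain T a b where c: "c = (T, a, b)" by (cases c)
    obtain u where u: "\<gamma> = ((T, a, b), u, (Y, f, s))" "((T, a, b), u, (Y, f, s)) \<in> Arr (Pt C Z)"
      using \<gamma>(1) unfolding c by (rule Pt_homE)
    have uD: "u \<in> hom C T Y" "f \<cdot> u = a" "u \<cdot> b = s" "b \<in> hom C Z T" "(T, a, b) \<in> Ob (Pt C Z)"
      using u(2) unfolding Pt_Arr_iff Pt_Ob_iff by blast+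
    have "q \<cdot> u = t \<cdot> a" using zero_iff[OF u(2)] \<gamma>(2) unfolding u(1) by blast
    then have "u \<lesssim> v" using v(2)[OF uD(1)] uD t f by (simp add: cat_simps)
    then obtain w where "w \<in> hom C (Dom C u) (Dom C v)" "v \<cdot> w = u" by (rule factorsE)
    then have w: "w \<in> hom C T (Dom C v)" "v \<cdot> w = u" using uD by (simp_all add: hom_iff)
    have "w \<cdot> b = r"
      by (rule mono_cancel[of v _ _ Z])
        (use V w(2)[THEN comp_subst] w(1) uD vh r in \<open>simp_all add: cat_simps\<close>)
    then have wA: "((T, a, b), w, ?V) \<in> Arr (Pt C Z)"
      using NA uD w f vh unfolding Pt_Arr_iff[of _ _ _ w] Pt_Arr_iff[of _ _ _ v] by (simp add: cat_simps)
    show ?thesis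
    proof (rule ex1I[of _ "((T, a, b), w, ?V)"])
      show "((T, a, b), w, ?V) \<in> hom (Pt C Z) c ?V \<and> Comp (Pt C Z) ?N ((T, a, b), w, ?V) = \<gamma>"
        unfolding c u(1) Pt_simps w(2) using Pt_homI[OF wA] by blast
      fix \<eta> assume \<eta>: "\<eta> \<in> hom (Pt C Z) c ?V \<and> Comp (Pt C Z) ?N \<eta> = \<gamma>"
      have "\<eta> \<in> hom (Pt C Z) (T, a, b) ?V" using \<eta> c by blast
      then obtain w' where w': "\<eta> = ((T, a, b), w', ?V)" "((T, a, b), w', ?V) \<in> Arr (Pt C Z)"
        by (rule Pt_homE)
      have w'h: "w' \<in> hom C T (Dom C v)" using w'(2) unfolding Pt_Arr_iff by blast
      have "v \<cdot> w' = u" using \<eta> unfolding u(1) w'(1) Pt_simps by simp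
      then have "w' = w" using mono_cancel[of v w' w T] V w w'h by simp
      then show "\<eta> = ((T, a, b), w, ?V)" using w'(1) by simp
    qed
  qed
  have "is_zero_arrow (Pt C Z) (Comp (Pt C Z) ?\<phi> ?N)" using zero_iff[OF NA] qv by blast
  then have "is_kernel (Pt C Z) ?\<phi> ?N"
    unfolding is_kernel_def using \<phi>A univ Pt_homI[OF NA] by (simp add: Pt_simps)
  then have N: "?N \<in> NSub (Pt C Z) (Y, f, s)" unfolding NSub_def normal_mono_def mem_Collect_eq Pt_simps by blast
  have qxn: "q \<cdot> (x \<cdot> n) = zero_arr A W" using kernelD(3)[OF q(3)] q(1) xnh by (simp add: hom_iff)
  have fxn: "f \<cdot> (x \<cdot> n) = zero_arr A Z" using ker[OF xnh qxn] .
  have "x \<cdot> n \<lesssim> v" using v(2)[OF xnh] qxn fxn t f xnh xh n ob by (simp add: pointed_simps)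
  then obtain \<kappa> where "\<kappa> \<in> hom C (Dom C (x \<cdot> n)) (Dom C v)" "v \<cdot> \<kappa> = x \<cdot> n" by (rule factorsE)
  then have \<kappa>: "\<kappa> \<in> hom C A (Dom C v)" "v \<cdot> \<kappa> = x \<cdot> n" using xnh by (simp_all add: hom_iff)
  have "is_kernel C (f \<cdot> v) \<kappa>"
  proof (rule kernelI)
    show "f \<cdot> v \<in> hom C (Dom C v) Z" using f vh by (simp add: cat_simps)
    have "is_mono C (v \<cdot> \<kappa>)" unfolding \<kappa>(2) using SubD[OF NSub_imp_Sub[OF xn]] by blast
    then show "\<kappa> \<in> Sub C (Dom C v)" using mono_right_factor[OF _ \<kappa>(1) vh] \<kappa>(1) by (simp add: Sub_def hom_iff)
    show "(f \<cdot> v) \<cdot> \<kappa> = zero_arr (Dom C \<kappa>) Z" using \<kappa> fxn f vh by (simp add: cat_simps)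
    fix T u assume u: "u \<in> hom C T (Dom C v)" "(f \<cdot> v) \<cdot> u = zero_arr T Z"
    have vu: "v \<cdot> u \<in> hom C T Y" using vh u(1) by (simp add: cat_simps)
    have "q \<cdot> (v \<cdot> u) = t \<cdot> ((f \<cdot> v) \<cdot> u)" using qv[THEN comp_subst] q(1) vh u(1) t f by (simp add: cat_simps)
    then have "q \<cdot> (v \<cdot> u) = zero_arr T W" using u t by (simp add: pointed_simps)
    then have "v \<cdot> u \<lesssim> v \<cdot> \<kappa>"
      unfolding \<kappa>(2) using kernel_factors_iff[OF q(3), of "v \<cdot> u" T] vu q(1) by (simp add: hom_iff)
    then show "u \<lesssim> \<kappa>" using comp_factors_comp_iff[of v \<kappa> A u T] V \<kappa>(1) u(1) by blast
  qed
  then have "is_Ker C x ?N n"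
    unfolding is_Ker_def using x n \<kappa> by (auto simp: hom_iff intro!: exI[of _ \<kappa>])
  then show thesis using that N by blast
qed

end

section \<open>The condition (NH)\<close>

context semi_abelian_cat
begin

lemma protosplit_NSub_imp_NSub: "x \<in> protosplit_NSub C Y \<Longrightarrow> x \<in> NSub C Y"
  by (auto simp: protosplit_NSub_def NSub_def normal_mono_def)

lemma NSub_Ob: "n \<in> NSub C X \<Longrightarrow> X \<in> Ob C"
  using NSub_imp_Sub SubD by blast

text \<open>Normality in \<open>Y\<close> restricts to \<open>X\<close>, so (NH) makes \<open>[K,L]\<close> normal both in \<open>X\<close>, where it is then the
  Huq commutator, and in \<open>Y\<close>.\<close>

lemma NH_imp_huq_normal:
  assumes NH: "NH C" and x: "x \<in> Sub C Y" and k: "k \<in> Sub C (Dom C x)" and l: "l \<in> Sub C (Dom C x)"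
    and xk: "x \<cdot> k \<in> NSub C Y" and xl: "x \<cdot> l \<in> NSub C Y"
  shows "x \<cdot> huq C k l \<in> NSub C Y"
proof -
  note X = SubD[OF x] and K = SubD[OF k] and L = SubD[OF l]
  have kh: "k \<in> hom C (Dom C k) (Dom C x)" and lh: "l \<in> hom C (Dom C l) (Dom C x)"
    and xh: "x \<in> hom C (Dom C x) Y"
    using X K L by (simp_all add: cat_simps)
  have xkh: "x \<cdot> k \<in> hom C (Dom C k) Y" and xlh: "x \<cdot> l \<in> hom C (Dom C l) Y"
    using kh lh xh by (simp_all add: cat_simps)
  have kN: "k \<in> NSub C (Dom C x)" and lN: "l \<in> NSub C (Dom C x)"
    using NSub_restrict[OF x k xk] NSub_restrict[OF x l xl] .
  define m where "m = higgins C k l"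
  have m: "is_higgins_commutator C k l m" unfolding m_def by (rule higgins_spec[OF kh lh])
  have mN: "m \<in> NSub C (Dom C x)" using NH kN lN NSub_Ob[OF kN] unfolding NH_def m_def by blast
  have "higgins C (x \<cdot> k) (x \<cdot> l) \<in> NSub C Y" using NH xk xl NSub_Ob[OF xk] unfolding NH_def by blast
  moreover have "same_sub C (higgins C (x \<cdot> k) (x \<cdot> l)) (x \<cdot> m)"
    using higgins_same_sub[OF higgins_spec[OF xkh xlh]] higgins_comp[OF m _ xh kh lh] X by blast
  ultimately have xm: "x \<cdot> m \<in> NSub C Y" by (rule NSub_same_sub)
  have "same_sub C (x \<cdot> m) (x \<cdot> huq C k l)"
    using same_sub_comp[OF normal_higgins_same_huq[OF m kh lh mN]] X SubD[OF NSub_imp_Sub[OF mN]] by blast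
  then show ?thesis using NSub_same_sub[OF xm] by blast
qed

text \<open>\<open>R\<close> is the kernel pair of an arrow with kernel \<open>j\<close>, the join of \<open>k\<close> and \<open>l\<close>; \<open>x\<close> embeds \<open>J\<close> into
  \<open>R\<close> by \<open>y \<mapsto> (0, y)\<close>. The hypothesis is applied to the protosplit \<open>x\<close>, and the normal subobject of
  \<open>R\<close> that it provides is sent to \<open>X\<close> by the second projection.\<close>

lemma protosplit_imp_higgins_normal:
  assumes hyp: "\<And>Y x k l. x \<in> protosplit_NSub C Y \<Longrightarrow> k \<in> Sub C (Dom C x) \<Longrightarrow> l \<in> Sub C (Dom C x) \<Longrightarrow>
      x \<cdot> k \<in> NSub C Y \<Longrightarrow> x \<cdot> l \<in> NSub C Y \<Longrightarrow> is_join C (x \<cdot> k) (x \<cdot> l) x \<Longrightarrow>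
      x \<cdot> huq C k l \<in> NSub C Y"
    and k: "k \<in> NSub C X" and l: "l \<in> NSub C X"
  shows "higgins C k l \<in> NSub C X"
proof -
  note K = SubD[OF NSub_imp_Sub[OF k]] and L = SubD[OF NSub_imp_Sub[OF l]]
  have kh: "k \<in> hom C (Dom C k) X" and lh: "l \<in> hom C (Dom C l) X" using K L by (simp_all add: cat_simps)
  have X: "X \<in> Ob C" using K by blast
  obtain j where j: "j \<in> NSub C X" and join: "is_join C k l j" using join_of_normal_exists[OF k l] .
  note JS = SubD[OF NSub_imp_Sub[OF j]]
  have jh: "j \<in> hom C (Dom C j) X" and J: "Dom C j \<in> Ob C" using JS by (simp_all add: cat_simps)
  have "k \<lesssim> j" "l \<lesssim> j" using join by (auto simp: is_join_def)
  then obtain k1 l1 where k1: "k1 \<in> hom C (Dom C k) (Dom C j)" "j \<cdot> k1 = k"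
    and l1: "l1 \<in> hom C (Dom C l) (Dom C j)" "j \<cdot> l1 = l"
    by (auto elim!: factorsE)
  have k1S: "k1 \<in> Sub C (Dom C j)" and l1S: "l1 \<in> Sub C (Dom C j)"
    using mono_right_factor[OF _ k1(1) jh] mono_right_factor[OF _ l1(1) jh] K L k1 l1
    by (simp_all add: Sub_def hom_iff)
  have join1: "is_join C k1 l1 (Ident C (Dom C j))"
    using join_comp_cancel[OF _ _ jh k1(1) l1(1)] join JS k1(2) l1(2) by simp
  obtain Q \<psi> where \<psi>: "\<psi> \<in> hom C X Q" "is_kernel C \<psi> j" using j by (rule NSubE)
  obtain R p1 p2 r where pb: "is_pullback C \<psi> \<psi> p1 p2"
    and p: "p1 \<in> hom C R X" "p2 \<in> hom C R X" "\<psi> \<cdot> p1 = \<psi> \<cdot> p2"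
    and r: "r \<in> hom C X R" "p1 \<cdot> r = Ident C X" "p2 \<cdot> r = Ident C X"
    using kernel_pair_exists[OF \<psi>(1)] .
  have R: "R \<in> Ob C" using r(1) by (simp add: hom_iff)
  have ty: "\<psi> \<cdot> zero_arr (Dom C j) X = \<psi> \<cdot> j" "zero_arr (Dom C j) X \<in> hom C (Dom C j) (Dom C \<psi>)" "j \<in> hom C (Dom C j) (Dom C \<psi>)"
    using kernelD(3)[OF \<psi>(2)] \<psi>(1) jh by (simp_all add: pointed_simps)
  obtain x where "x \<in> hom C (Dom C j) (Dom C p1)" and px: "p1 \<cdot> x = zero_arr (Dom C j) X" "p2 \<cdot> x = j"
    using pullback_lift[OF pb ty] .
  then have xh: "x \<in> hom C (Dom C j) R" using p(1) by (simp add: hom_iff)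
  have "is_mono C (p2 \<cdot> x)" using px(2) JS by simp
  then have xm: "is_mono C x" using mono_right_factor xh p(2) by blast
  \<comment> \<open>A normal subobject \<open>j k'\<close> of \<open>X\<close> gives the subobject \<open>x k'\<close> of all pairs \<open>(0, y)\<close> in \<open>R\<close>
    with \<open>y\<close> in \<open>j k'\<close>.\<close>
  have normal_in_R: "x \<cdot> k' \<in> NSub C R" if k': "k' \<in> hom C A (Dom C j)" and N: "j \<cdot> k' \<in> NSub C X" for A k'
  proof -
    obtain W \<phi> where \<phi>: "\<phi> \<in> hom C X W" "is_kernel C \<phi> (j \<cdot> k')" using N by (rule NSubE)
    have W: "W \<in> Ob C" using \<phi>(1) by (simp add: hom_iff)
    obtain a b where ab: "is_product C X W a b" using product_exists[OF X W] .
    note P = productD[OF ab]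
    have \<phi>p: "\<phi> \<cdot> p2 \<in> hom C R W" using \<phi>(1) p(2) by (simp add: cat_simps)
    obtain g where g: "g \<in> hom C R (Dom C a)" "a \<cdot> g = p1" "b \<cdot> g = \<phi> \<cdot> p2"
      using product_lift[OF ab p(1) \<phi>p] .
    have aob: "Dom C a \<in> Ob C" "A \<in> Ob C" using g(1) k' by (simp_all add: hom_iff)
    have xk': "x \<cdot> k' \<in> hom C A R" using xh k' by (simp add: cat_simps)
    have jk: "\<phi> \<cdot> (j \<cdot> k') = zero_arr A W" using kernelD(3)[OF \<phi>(2)] \<phi>(1) jh k' by (simp add: cat_simps)
    have "is_mono C (p2 \<cdot> (x \<cdot> k'))"
      using SubD[OF NSub_imp_Sub[OF N]] px(2)[THEN comp_subst] p(2) xh k' by (simp add: hom_iff)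
    then have mono: "is_mono C (x \<cdot> k')" using mono_right_factor[OF _ xk' p(2)] by blast
    have ker: "g \<cdot> (x \<cdot> k') = zero_arr A (Dom C a)"
      by (rule jointly_monicD[OF product_jointly_monic[OF ab], of _ _ A])
        (use g xh k' P p \<phi>(1) jk px X J aob W px[THEN comp_subst] g(2,3)[THEN comp_subst] in
          \<open>simp_all add: pointed_simps\<close>)
    have "is_kernel C g (x \<cdot> k')"
    proof (rule kernelI[OF g(1)])
      show "x \<cdot> k' \<in> Sub C R" using mono xk' by (simp add: Sub_def hom_iff)
      show "g \<cdot> (x \<cdot> k') = zero_arr (Dom C (x \<cdot> k')) (Dom C a)" using ker xk' by (simp add: hom_iff)
      fix T t assume t: "t \<in> hom C T R" "g \<cdot> t = zero_arr T (Dom C a)"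
      have T: "T \<in> Ob C" using t(1) by (simp add: hom_iff)
      have "a \<cdot> (g \<cdot> t) = zero_arr T X" "b \<cdot> (g \<cdot> t) = zero_arr T W" using t P T by (simp_all add: pointed_simps)
      then have pt: "p1 \<cdot> t = zero_arr T X" "\<phi> \<cdot> (p2 \<cdot> t) = zero_arr T W"
        using g(2,3)[THEN comp_subst] t(1) g(1) P p(1,2) \<phi>(1) by (simp_all add: cat_simps)
      have "p2 \<cdot> t \<lesssim> j \<cdot> k'"
        using kernel_factors_iff[OF \<phi>(2), of "p2 \<cdot> t" T] pt(2) t(1) p(2) \<phi>(1) by (simp add: cat_simps)
      then obtain h where "h \<in> hom C (Dom C (p2 \<cdot> t)) (Dom C (j \<cdot> k'))" "(j \<cdot> k') \<cdot> h = p2 \<cdot> t" by (rule factorsE)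
      then have h: "h \<in> hom C T A" "j \<cdot> (k' \<cdot> h) = p2 \<cdot> t" using t(1) p(2) jh k' by (simp_all add: cat_simps)
      have "(x \<cdot> k') \<cdot> h = t"
        by (rule jointly_monicD[OF pullback_jointly_monic[OF pb], of _ _ T])
          (use h pt t(1) xh k' p X J px[THEN comp_subst] in \<open>simp_all add: pointed_simps\<close>)
      then show "t \<lesssim> x \<cdot> k'" by (rule factorsI) (use h t(1) xk' in \<open>simp add: hom_iff\<close>)
    qed
    then show ?thesis using NSubI g(1) by blast
  qed
  have xker: "is_kernel C p1 x"
  proof (rule kernelI[OF p(1)])
    show "x \<in> Sub C R" "p1 \<cdot> x = zero_arr (Dom C x) X" using xm xh px by (simp_all add: Sub_def hom_iff)
    fix T t assume t: "t \<in> hom C T R" "p1 \<cdot> t = zero_arr T X"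
    have "\<psi> \<cdot> (p1 \<cdot> t) = \<psi> \<cdot> (p2 \<cdot> t)" using p(3)[THEN comp_subst] p(1,2) t(1) \<psi>(1) by (simp add: cat_simps)
    then have "\<psi> \<cdot> (p2 \<cdot> t) = zero_arr T Q" using t \<psi>(1) by (simp add: pointed_simps)
    then have "p2 \<cdot> t \<lesssim> j" using kernel_factors_iff[OF \<psi>(2), of "p2 \<cdot> t" T] t(1) p(2) \<psi>(1) by (simp add: cat_simps)
    then obtain h where "h \<in> hom C (Dom C (p2 \<cdot> t)) (Dom C j)" and jt: "j \<cdot> h = p2 \<cdot> t" by (rule factorsE)
    then have h: "h \<in> hom C T (Dom C j)" using t(1) p(2) by (simp add: cat_simps)
    have "x \<cdot> h = t"
      by (rule jointly_monicD[OF pullback_jointly_monic[OF pb], of _ _ T])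
        (use h jt t xh p X px[THEN comp_subst] in \<open>simp_all add: pointed_simps\<close>)
    then show "t \<lesssim> x" by (rule factorsI) (use h t(1) xh in \<open>simp add: hom_iff\<close>)
  qed
  have "x \<in> protosplit_NSub C R"
    unfolding protosplit_NSub_def using xker xh p(1) r(1,2) by (auto simp: hom_iff intro!: exI[of _ p1] bexI[of _ r])
  moreover have D: "Dom C x = Dom C j" using xh by (simp add: hom_iff)
  moreover have "x \<cdot> k1 \<in> NSub C R" "x \<cdot> l1 \<in> NSub C R"
    using normal_in_R[OF k1(1)] normal_in_R[OF l1(1)] k1(2) l1(2) k l by simp_all
  moreover have "is_join C (x \<cdot> k1) (x \<cdot> l1) x" by (rule join_comp[OF join1 xm xh k1(1) l1(1)])
  ultimately have xhuq: "x \<cdot> huq C k1 l1 \<in> NSub C R" using hyp k1S l1S by simp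
  obtain m where m: "is_higgins_commutator C k1 l1 m" using higgins_exists[OF k1(1) l1(1)] .
  have mN: "m \<in> NSub C (Dom C j)" by (rule higgins_normal_in_join[OF m k1S l1S join1])
  note M = SubD[OF NSub_imp_Sub[OF mN]]
  have mh: "m \<in> hom C (Dom C m) (Dom C j)" using M by (simp add: cat_simps)
  have "same_sub C (x \<cdot> m) (x \<cdot> huq C k1 l1)"
    using same_sub_comp[OF normal_higgins_same_huq[OF m k1(1) l1(1) mN] xm] M D by simp
  then have xmN: "x \<cdot> m \<in> NSub C R" using NSub_same_sub[OF xhuq] same_sub_sym by blast
  have "j \<cdot> m \<in> NSub C X"
  proof (rule regular_image_normal[OF _ p(2) xmN, of _ "Dom C m" "Ident C (Dom C m)"])
    show "regular_epi C p2" by (rule split_epi_regular[OF r(3) p(2) r(1)])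
    show "is_mono C (j \<cdot> m)" using mono_comp JS M by simp
    show "regular_epi C (Ident C (Dom C m))" using regular_epi_Ident M Dom_Ob by blast
  qed (use jh mh xh p(2) px(2)[THEN comp_subst] in \<open>simp_all add: cat_simps\<close>)
  moreover have "is_higgins_commutator C k l (j \<cdot> m)"
    using higgins_comp[OF m _ jh k1(1) l1(1)] JS k1(2) l1(2) by simp
  then have "same_sub C (j \<cdot> m) (higgins C k l)" using higgins_same_sub higgins_spec[OF kh lh] by blast
  ultimately show ?thesis by (rule NSub_same_sub)
qed

end

lemma all_equivalent_of_implications:
  assumes "i \<Longrightarrow> ii" "ii \<Longrightarrow> iii" "iii \<Longrightarrow> iv" "iii \<Longrightarrow> v" "v \<Longrightarrow> vi" "iv \<Longrightarrow> vii" "vii \<Longrightarrow> viii" "viii \<Longrightarrow> vi" "vi \<Longrightarrow> i"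
  shows "all_equivalent [i, ii, iii, iv, v, vi, vii, viii]"
proof -
  have "ii = i" "iii = i" "iv = i" "v = i" "vi = i" "vii = i" "viii = i"
    using assms by blast+
  then show ?thesis by (simp add: all_equivalent_def)
qed

theorem theorem2p8:
  fixes C :: "('o, 'm) category"
  assumes "semi_abelian C"
  shows "all_equivalent
    [ NH C,
      \<forall>Y\<in>Ob C. \<forall>x\<in>Sub C Y. \<forall>k\<in>Sub C (Dom C x). \<forall>l\<in>Sub C (Dom C x).
        x \<cdot>\<^bsub>C\<^esub> k \<in> NSub C Y \<longrightarrow> x \<cdot>\<^bsub>C\<^esub> l \<in> NSub C Y \<longrightarrow>
        same_sub C (x \<cdot>\<^bsub>C\<^esub> huq C k l) (huq C (x \<cdot>\<^bsub>C\<^esub> k) (x \<cdot>\<^bsub>C\<^esub> l)),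
      \<forall>Y\<in>Ob C. \<forall>x\<in>NSub C Y. \<forall>k\<in>Sub C (Dom C x). \<forall>l\<in>Sub C (Dom C x).
        x \<cdot>\<^bsub>C\<^esub> k \<in> NSub C Y \<longrightarrow> x \<cdot>\<^bsub>C\<^esub> l \<in> NSub C Y \<longrightarrow>
        same_sub C (x \<cdot>\<^bsub>C\<^esub> huq C k l) (huq C (x \<cdot>\<^bsub>C\<^esub> k) (x \<cdot>\<^bsub>C\<^esub> l)),
      \<forall>Y\<in>Ob C. \<forall>x\<in>protosplit_NSub C Y. \<forall>k\<in>Sub C (Dom C x). \<forall>l\<in>Sub C (Dom C x).
        x \<cdot>\<^bsub>C\<^esub> k \<in> NSub C Y \<longrightarrow> x \<cdot>\<^bsub>C\<^esub> l \<in> NSub C Y \<longrightarrow>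
        same_sub C (x \<cdot>\<^bsub>C\<^esub> huq C k l) (huq C (x \<cdot>\<^bsub>C\<^esub> k) (x \<cdot>\<^bsub>C\<^esub> l)),
      \<forall>Y\<in>Ob C. \<forall>x\<in>NSub C Y. \<forall>k\<in>Sub C (Dom C x). \<forall>l\<in>Sub C (Dom C x).
        x \<cdot>\<^bsub>C\<^esub> k \<in> NSub C Y \<longrightarrow> x \<cdot>\<^bsub>C\<^esub> l \<in> NSub C Y \<longrightarrow>
        is_join C (x \<cdot>\<^bsub>C\<^esub> k) (x \<cdot>\<^bsub>C\<^esub> l) x \<longrightarrow>
        same_sub C (x \<cdot>\<^bsub>C\<^esub> huq C k l) (huq C (x \<cdot>\<^bsub>C\<^esub> k) (x \<cdot>\<^bsub>C\<^esub> l)),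
      \<forall>Y\<in>Ob C. \<forall>x\<in>protosplit_NSub C Y. \<forall>k\<in>Sub C (Dom C x). \<forall>l\<in>Sub C (Dom C x).
        x \<cdot>\<^bsub>C\<^esub> k \<in> NSub C Y \<longrightarrow> x \<cdot>\<^bsub>C\<^esub> l \<in> NSub C Y \<longrightarrow>
        is_join C (x \<cdot>\<^bsub>C\<^esub> k) (x \<cdot>\<^bsub>C\<^esub> l) x \<longrightarrow>
        same_sub C (x \<cdot>\<^bsub>C\<^esub> huq C k l) (huq C (x \<cdot>\<^bsub>C\<^esub> k) (x \<cdot>\<^bsub>C\<^esub> l)),
      \<forall>Z\<in>Ob C. \<forall>Y f s x k' l' k l.
        (Y, f, s) \<in> Ob (Pt C Z) \<longrightarrow> is_kernel C f x \<longrightarrow>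
        k' \<in> NSub (Pt C Z) (Y, f, s) \<longrightarrow> l' \<in> NSub (Pt C Z) (Y, f, s) \<longrightarrow>
        is_Ker C x k' k \<longrightarrow> is_Ker C x l' l \<longrightarrow>
        (\<exists>N\<in>NSub (Pt C Z) (Y, f, s). \<exists>n. is_Ker C x N n \<and> same_sub C n (huq C k l)),
      \<forall>Z\<in>Ob C. \<forall>Y f s x k' l' k l.
        (Y, f, s) \<in> Ob (Pt C Z) \<longrightarrow> is_kernel C f x \<longrightarrow>
        k' \<in> NSub (Pt C Z) (Y, f, s) \<longrightarrow> l' \<in> NSub (Pt C Z) (Y, f, s) \<longrightarrow>
        is_Ker C x k' k \<longrightarrow> is_Ker C x l' l \<longrightarrow>
        is_join C k l (Ident C (Dom C x)) \<longrightarrow>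
        (\<exists>N\<in>NSub (Pt C Z) (Y, f, s). \<exists>n. is_Ker C x N n \<and> same_sub C n (huq C k l)) ]"
proof -
  interpret semi_abelian_cat C by unfold_locales (rule assms)
  show ?thesis
  proof (rule all_equivalent_of_implications, goal_cases)
    case 1
    show ?case
    proof (intro ballI impI)
      fix Y x k l
      assume x: "x \<in> Sub C Y" and k: "k \<in> Sub C (Dom C x)" and l: "l \<in> Sub C (Dom C x)"
        and N: "x \<cdot>\<^bsub>C\<^esub> k \<in> NSub C Y" "x \<cdot>\<^bsub>C\<^esub> l \<in> NSub C Y"
      show "same_sub C (x \<cdot>\<^bsub>C\<^esub> huq C k l) (huq C (x \<cdot>\<^bsub>C\<^esub> k) (x \<cdot>\<^bsub>C\<^esub> l))"
        using huq_agrees_iff_normal[OF x k l] NH_imp_huq_normal[OF 1 x k l N] by blast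
    qed
  next
    case 2
    show ?case
    proof (intro ballI impI)
      fix Y x k l
      assume "Y \<in> Ob C" "x \<in> NSub C Y" "k \<in> Sub C (Dom C x)" "l \<in> Sub C (Dom C x)"
        "x \<cdot>\<^bsub>C\<^esub> k \<in> NSub C Y" "x \<cdot>\<^bsub>C\<^esub> l \<in> NSub C Y"
      then show "same_sub C (x \<cdot>\<^bsub>C\<^esub> huq C k l) (huq C (x \<cdot>\<^bsub>C\<^esub> k) (x \<cdot>\<^bsub>C\<^esub> l))"
        using 2 NSub_imp_Sub by blast
    qed
  next
    case 3
    show ?case
    proof (intro ballI impI)
      fix Y x k l
      assume "Y \<in> Ob C" "x \<in> protosplit_NSub C Y" "k \<in> Sub C (Dom C x)" "l \<in> Sub C (Dom C x)"
        "x \<cdot>\<^bsub>C\<^esub> k \<in> NSub C Y" "x \<cdot>\<^bsub>C\<^esub> l \<in> NSub C Y"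
      then show "same_sub C (x \<cdot>\<^bsub>C\<^esub> huq C k l) (huq C (x \<cdot>\<^bsub>C\<^esub> k) (x \<cdot>\<^bsub>C\<^esub> l))"
        using 3 protosplit_NSub_imp_NSub by blast
    qed
  next
    case 4
    then show ?case by blast
  next
    case 5
    show ?case
    proof (intro ballI impI)
      fix Y x k l
      assume "Y \<in> Ob C" "x \<in> protosplit_NSub C Y" "k \<in> Sub C (Dom C x)" "l \<in> Sub C (Dom C x)"
        "x \<cdot>\<^bsub>C\<^esub> k \<in> NSub C Y" "x \<cdot>\<^bsub>C\<^esub> l \<in> NSub C Y" "is_join C (x \<cdot>\<^bsub>C\<^esub> k) (x \<cdot>\<^bsub>C\<^esub> l) x"
      then show "same_sub C (x \<cdot>\<^bsub>C\<^esub> huq C k l) (huq C (x \<cdot>\<^bsub>C\<^esub> k) (x \<cdot>\<^bsub>C\<^esub> l))"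
        using 5 protosplit_NSub_imp_NSub by blast
    qed
  next
    case 6
    show ?case
    proof (intro ballI allI impI)
      fix Z Y f s x k' l' k l
      assume pt: "(Y, f, s) \<in> Ob (Pt C Z)" and x: "is_kernel C f x"
        and k': "k' \<in> NSub (Pt C Z) (Y, f, s)" and l': "l' \<in> NSub (Pt C Z) (Y, f, s)"
        and k: "is_Ker C x k' k" and l: "is_Ker C x l' l"
      have P: "Y \<in> Ob C" "f \<in> hom C Y Z" "s \<in> hom C Z Y" "f \<cdot>\<^bsub>C\<^esub> s = Ident C Z"
        using pt by (simp_all add: Pt_Ob_iff)
      have xY: "x \<in> Sub C Y" using kernelD(2)[OF x] P(2) by (simp add: hom_iff)
      have "Dom C f = Y" "Cod C f = Z" "Cod C x = Y" using P SubD[OF xY] by (simp_all add: hom_iff)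
      then have xp: "x \<in> protosplit_NSub C Y"
        using x P(3,4) unfolding protosplit_NSub_def by blast
      note kS = kernel_of_normal_in_points[OF k' k] and lS = kernel_of_normal_in_points[OF l' l]
      have "x \<cdot>\<^bsub>C\<^esub> huq C k l \<in> NSub C Y"
        using 6 P(1) xp kS lS huq_agrees_iff_normal[OF xY kS(1) lS(1)] by blast
      moreover have H: "huq C k l \<in> NSub C (Dom C x)"
        using huq_normal SubD[OF kS(1)] SubD[OF lS(1)] arr_hom by metis
      have "huq C k l \<in> hom C (Dom C (huq C k l)) (Dom C x)"
        using SubD[OF NSub_imp_Sub[OF H]] by (simp add: cat_simps)
      ultimately obtain N where "N \<in> NSub (Pt C Z) (Y, f, s)" "is_Ker C x N (huq C k l)"
        using normal_in_points_exists[OF pt x] by blast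
      moreover have "same_sub C (huq C k l) (huq C k l)"
        using SubD[OF NSub_imp_Sub[OF H]] factors_refl by (simp add: same_sub_def)
      ultimately show "\<exists>N\<in>NSub (Pt C Z) (Y, f, s). \<exists>n. is_Ker C x N n \<and> same_sub C n (huq C k l)"
        by blast
    qed
  next
    case 7
    then show ?case by blast
  next
    case 8
    show ?case
    proof (intro ballI impI)
      fix Y x k l
      assume Y: "Y \<in> Ob C" and xp: "x \<in> protosplit_NSub C Y"
        and k: "k \<in> Sub C (Dom C x)" and l: "l \<in> Sub C (Dom C x)"
        and xk: "x \<cdot>\<^bsub>C\<^esub> k \<in> NSub C Y" and xl: "x \<cdot>\<^bsub>C\<^esub> l \<in> NSub C Y"
        and join: "is_join C (x \<cdot>\<^bsub>C\<^esub> k) (x \<cdot>\<^bsub>C\<^esub> l) x"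
      obtain f s where x: "is_kernel C f x" and s: "s \<in> hom C (Cod C f) (Dom C f)" "f \<cdot>\<^bsub>C\<^esub> s = Ident C (Cod C f)"
        and cx: "Cod C x = Y"
        using xp by (auto simp: protosplit_NSub_def)
      have xY: "x \<in> Sub C Y" using NSub_imp_Sub[OF protosplit_NSub_imp_NSub[OF xp]] .
      have fY: "Dom C f = Y" using SubD[OF kernelD(2)[OF x]] cx by simp
      have f: "f \<in> hom C Y (Cod C f)" using arr_hom[OF kernelD(1)[OF x]] fY by simp
      have pt: "(Y, f, s) \<in> Ob (Pt C (Cod C f))" using Y f s fY by (simp add: Pt_Ob_iff)
      have xh: "is_mono C x" "x \<in> hom C (Dom C x) Y" using SubD[OF xY] by (simp_all add: cat_simps)
      have kh: "k \<in> hom C (Dom C k) (Dom C x)" and lh: "l \<in> hom C (Dom C l) (Dom C x)"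
        using SubD[OF k] SubD[OF l] by (simp_all add: cat_simps)
      obtain k' where k': "k' \<in> NSub (Pt C (Cod C f)) (Y, f, s)" "is_Ker C x k' k"
        using normal_in_points_exists[OF pt x kh xk] .
      obtain l' where l': "l' \<in> NSub (Pt C (Cod C f)) (Y, f, s)" "is_Ker C x l' l"
        using normal_in_points_exists[OF pt x lh xl] .
      have "is_join C k l (Ident C (Dom C x))" by (rule join_comp_cancel[OF join xh kh lh])
      moreover have "Cod C f \<in> Ob C" using f by (simp add: hom_iff)
      ultimately obtain N n where N: "N \<in> NSub (Pt C (Cod C f)) (Y, f, s)" "is_Ker C x N n"
        and n: "same_sub C n (huq C k l)"
        using 8 pt x k' l' by blast
      note nS = kernel_of_normal_in_points[OF N]
      have "same_sub C (x \<cdot>\<^bsub>C\<^esub> n) (x \<cdot>\<^bsub>C\<^esub> huq C k l)"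
        using same_sub_comp[OF n xh(1)] SubD[OF nS(1)] by blast
      then have "x \<cdot>\<^bsub>C\<^esub> huq C k l \<in> NSub C Y" by (rule NSub_same_sub[OF nS(2)])
      then show "same_sub C (x \<cdot>\<^bsub>C\<^esub> huq C k l) (huq C (x \<cdot>\<^bsub>C\<^esub> k) (x \<cdot>\<^bsub>C\<^esub> l))"
        using huq_agrees_iff_normal[OF xY k l] by blast
    qed
  next
    case 9
    show ?case
      unfolding NH_def
    proof (intro ballI)
      fix X k l assume "k \<in> NSub C X" "l \<in> NSub C X"
      then show "higgins C k l \<in> NSub C X"
      proof (rule protosplit_imp_higgins_normal[rotated])
        fix Y x k l
        assume x: "x \<in> protosplit_NSub C Y" and k: "k \<in> Sub C (Dom C x)" and l: "l \<in> Sub C (Dom C x)"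
          and hyp: "x \<cdot>\<^bsub>C\<^esub> k \<in> NSub C Y" "x \<cdot>\<^bsub>C\<^esub> l \<in> NSub C Y" "is_join C (x \<cdot>\<^bsub>C\<^esub> k) (x \<cdot>\<^bsub>C\<^esub> l) x"
        have xS: "x \<in> Sub C Y" using NSub_imp_Sub[OF protosplit_NSub_imp_NSub[OF x]] .
        show "x \<cdot>\<^bsub>C\<^esub> huq C k l \<in> NSub C Y"
          using 9 x k l hyp NSub_Ob[OF hyp(1)] huq_agrees_iff_normal[OF xS k l] by blast
      qed
    qed
  qed
qed

end
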